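(* There exist two compact real-analytic Riemannian manifolds with boundary $(M_1,g_1)$ and $(M_2,g_2)$ and an isometry $\phi:\partial M_1\to\partial M_2$ between their boundaries (with the induced Riemannian metrics) such that, when the boundaries are identified via $\phi$, the two manifolds have identical lens data, but the $C^\infty$ jets of $g_1$ and $g_2$ at the boundary are different.
   Context: Lens data: let $(M,g)$ be a Riemannian manifold with boundary, $\nu$ the inward-pointing unit normal along $\partial M$, and $\partial(SM)$ the set of unit tangent vectors of $M$ with base point in $\partial M$. Let $\Omega\subset\partial(SM)\times\partial(SM)\times\mathbb{R}^+$ be the set of triples $(\gamma'(0),\gamma'(T),T)$ such that (1) $\gamma$ is a unit speed geodesic of $M$, (2) $\langle\gamma'(0),\nu\rangle>0$, i.e. $\gamma'(0)$ points inwards, and (3) $T$ is the first time at which $\gamma$ hits $\partial M$ again. Let $B(\partial M)\subset T(\partial M)$ be the open unit ball bundle and $\overline{B(\partial M)}$ the closed unit ball bundle of $\partial M$. Orthogonal projection $\partial(SM)\to\overline{B(\partial M)}$ (removing the normal component) maps $\Omega$ to a set $\Omega'\subset B(\partial M)\times\overline{B(\partial M)}\times\mathbb{R}^+$. The lens data of $(M,g)$ consist of $\Omega'$ together with the restriction of the distance function $\tau$ of $(M,g)$ to $\partial M\times\partial M$. Here $\tau(p,q)$ is the infimum of $g$-lengths of curves in $M$ from $p$ to $q$ (curves may run along $\partial M$). Boundary normal coordinates: given a coordinate chart $(x_1,\dots,x_{n-1})$ on $\partial M$ ($n=\dim M$), a point $p\in M$ close enough to $\partial M$ gets coordinates $(y_1,\dots,y_{n-1},y_n)$,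 where $(y_1,\dots,y_{n-1})$ are the coordinates of the unique boundary point closest to $p$ and $y_n$ is the distance from $p$ to it. $C^\infty$ jet at the boundary: the collection of all derivatives $\partial_{x_n}^k g_{ij}|_{\partial M}$, $k\ge 0$, in boundary normal coordinates. The jets of $g_1$ and $g_2$ are different if, for some chart of the (identified) boundary, some $k\ge0$ and some $i,j$, the functions $\partial_{x_n}^k (g_1)_{ij}|_{\partial M}$ and $\partial_{x_n}^k (g_2)_{ij}|_{\partial M}$ in the corresponding boundary normal coordinates are not equal. *)

theory Defs
  imports "HOL-Analysis.Analysis"
begin

section \<open>Calculus in coordinates\<close>

text \<open>
  The dimension of a manifold is a value, not a type, so \<open>\<real>\<^sup>n\<close> is the library's
  \<open>Euclidean_space n\<close>, i.e. the sequences \<open>nat \<Rightarrow> real\<close> vanishing from index \<open>n\<close> on.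
  Coordinates are numbered \<open>0, \<dots>, n - 1\<close>; the last one, \<open>n - 1\<close>, is the normal one. In this
  model \<open>\<real>\<^sup>n\<^sup>-\<^sup>1\<close> is literally the subset \<open>x (n - 1) = 0\<close> of \<open>\<real>\<^sup>n\<close>.
\<close>

definition half_space :: "nat \<Rightarrow> (nat \<Rightarrow> real) topology" where
  "half_space n = subtopology (Euclidean_space n) {x. 0 \<le> x (n - 1)}"

text \<open>The derivative is taken within \<open>S\<close>, so it is one-sided at the boundary of a half-space.\<close>

definition partial_deriv ::
    "(nat \<Rightarrow> real) set \<Rightarrow> nat \<Rightarrow> ((nat \<Rightarrow> real) \<Rightarrow> real) \<Rightarrow> (nat \<Rightarrow> real) \<Rightarrow> real" where
  "partial_deriv S i f x =
     vector_derivative (\<lambda>s. f (x(i := s))) (at (x i) within {s. x(i := s) \<in> S})"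

primrec Ck_on :: "nat \<Rightarrow> nat \<Rightarrow> (nat \<Rightarrow> real) set \<Rightarrow> ((nat \<Rightarrow> real) \<Rightarrow> real) \<Rightarrow> bool" where
  "Ck_on 0 m S f \<longleftrightarrow> continuous_on S f"
| "Ck_on (Suc r) m S f \<longleftrightarrow> continuous_on S f \<and>
     (\<forall>i<m. (\<forall>x\<in>S. (\<lambda>s. f (x(i := s))) differentiable (at (x i) within {s. x(i := s) \<in> S})) \<and>
            Ck_on r m S (partial_deriv S i f))"

definition smooth_fun_on :: "nat \<Rightarrow> (nat \<Rightarrow> real) set \<Rightarrow> ((nat \<Rightarrow> real) \<Rightarrow> real) \<Rightarrow> bool" where
  "smooth_fun_on m S f \<longleftrightarrow> (\<forall>r. Ck_on r m S f)"

text \<open>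
  Used for relatively open subsets \<open>S\<close> of the half-space of dimension \<open>n\<close>: near every point \<open>f\<close> is
  the sum of a power series (over multi-indices \<open>\<alpha>\<close>). At a boundary point the series converges
  absolutely on a half-box, hence on the full box, so this is analyticity up to the boundary in
  the usual sense of having local analytic extensions to open sets of \<open>\<real>\<^sup>n\<close>.
\<close>

definition real_analytic_on :: "nat \<Rightarrow> (nat \<Rightarrow> real) set \<Rightarrow> ((nat \<Rightarrow> real) \<Rightarrow> real) \<Rightarrow> bool" where
  "real_analytic_on n S f \<longleftrightarrow>
     (\<forall>a\<in>S. \<exists>r>0. \<exists>coef :: (nat \<Rightarrow> nat) \<Rightarrow> real.
        \<forall>x\<in>S. (\<forall>i<n. \<bar>x i - a i\<bar> < r) \<longrightarrow>
          ((\<lambda>\<alpha>. coef \<alpha> * (\<Prod>i<n. (x i - a i) ^ \<alpha> i)) has_sum f x) {\<alpha>. \<forall>i\<ge>n. \<alpha> i = 0})"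

section \<open>Compact real-analytic Riemannian manifolds with boundary\<close>

type_synonym 'p chart = "'p set \<times> ('p \<Rightarrow> nat \<Rightarrow> real)"

text \<open>
  \<open>mfd_metric M c i j\<close> is the component \<open>g\<^sub>i\<^sub>j\<close> of the metric in the chart \<open>c\<close>, as a function of the
  coordinates.
\<close>

record 'p riem_mfd =
  mfd_top :: "'p topology"
  mfd_dim :: nat
  mfd_atlas :: "'p chart set"
  mfd_metric :: "'p chart \<Rightarrow> nat \<Rightarrow> nat \<Rightarrow> (nat \<Rightarrow> real) \<Rightarrow> real"

definition chart_inv :: "'p chart \<Rightarrow> (nat \<Rightarrow> real) \<Rightarrow> 'p" where
  "chart_inv c = inv_into (fst c) (snd c)"

definition chart_overlap :: "'p chart \<Rightarrow> 'p chart \<Rightarrow> (nat \<Rightarrow> real) set" where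
  "chart_overlap c d = snd c ` (fst c \<inter> fst d)"

definition transition :: "'p chart \<Rightarrow> 'p chart \<Rightarrow> (nat \<Rightarrow> real) \<Rightarrow> nat \<Rightarrow> real" where
  "transition c d x = snd d (chart_inv c x)"

definition transition_jac :: "'p chart \<Rightarrow> 'p chart \<Rightarrow> nat \<Rightarrow> nat \<Rightarrow> (nat \<Rightarrow> real) \<Rightarrow> real" where
  "transition_jac c d k i x = partial_deriv (chart_overlap c d) i (\<lambda>y. transition c d y k) x"

definition analytic_mfd_with_boundary :: "'p riem_mfd \<Rightarrow> bool" where
  "analytic_mfd_with_boundary M \<longleftrightarrow>
     1 \<le> mfd_dim M \<and>
     Hausdorff_space (mfd_top M) \<and>
     (\<Union>c\<in>mfd_atlas M. fst c) = topspace (mfd_top M) \<and>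
     (\<forall>c\<in>mfd_atlas M.
        openin (mfd_top M) (fst c) \<and>
        openin (half_space (mfd_dim M)) (snd c ` fst c) \<and>
        homeomorphic_map (subtopology (mfd_top M) (fst c))
          (subtopology (half_space (mfd_dim M)) (snd c ` fst c)) (snd c)) \<and>
     (\<forall>c\<in>mfd_atlas M. \<forall>d\<in>mfd_atlas M. \<forall>k<mfd_dim M.
        real_analytic_on (mfd_dim M) (chart_overlap c d) (\<lambda>x. transition c d x k))"

definition analytic_metric :: "'p riem_mfd \<Rightarrow> bool" where
  "analytic_metric M \<longleftrightarrow> (let n = mfd_dim M; g = mfd_metric M in
     (\<forall>c\<in>mfd_atlas M.
        (\<forall>i<n. \<forall>j<n. real_analytic_on n (snd c ` fst c) (g c i j)) \<and>
        (\<forall>x\<in>snd c ` fst c.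
           (\<forall>i<n. \<forall>j<n. g c i j x = g c j i x) \<and>
           (\<forall>v. (\<exists>i<n. v i \<noteq> 0) \<longrightarrow> 0 < (\<Sum>i<n. \<Sum>j<n. g c i j x * v i * v j)))) \<and>
     (\<forall>c\<in>mfd_atlas M. \<forall>d\<in>mfd_atlas M. \<forall>x\<in>chart_overlap c d. \<forall>i<n. \<forall>j<n.
        g c i j x = (\<Sum>k<n. \<Sum>l<n.
          transition_jac c d k i x * transition_jac c d l j x * g d k l (transition c d x))))"

text \<open>
  Second countability is automatic from compactness. Manifolds are connected, so that the
  Riemannian distance is finite.
\<close>

definition compact_analytic_riem_mfd :: "'p riem_mfd \<Rightarrow> bool" where
  "compact_analytic_riem_mfd M \<longleftrightarrow>
     analytic_mfd_with_boundary M \<and> analytic_metric M \<and>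
     compact_space (mfd_top M) \<and> connected_space (mfd_top M)"

definition bdry :: "'p riem_mfd \<Rightarrow> 'p set" where
  "bdry M = {p. \<exists>c\<in>mfd_atlas M. p \<in> fst c \<and> snd c p (mfd_dim M - 1) = 0}"

section \<open>Tangent vectors\<close>

text \<open>
  A tangent vector at \<open>p\<close> is the family of its component vectors in all charts around \<open>p\<close>, related by
  the Jacobians of the transition maps (and \<open>0\<close> for other arguments, for uniqueness of the
  representation). An element of the tangent bundle is a pair of a base point and such a family.
\<close>

type_synonym 'p tvec = "'p chart \<Rightarrow> nat \<Rightarrow> real"

definition tangent_space :: "'p riem_mfd \<Rightarrow> 'p \<Rightarrow> 'p tvec set" where
  "tangent_space M p = {v.
     (\<forall>c. \<not> (c \<in> mfd_atlas M \<and> p \<in> fst c) \<longrightarrow> v c = (\<lambda>_. 0)) \<and>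
     (\<forall>c k. mfd_dim M \<le> k \<longrightarrow> v c k = 0) \<and>
     (\<forall>c\<in>mfd_atlas M. \<forall>d\<in>mfd_atlas M. p \<in> fst c \<inter> fst d \<longrightarrow>
        (\<forall>k<mfd_dim M. v d k = (\<Sum>i<mfd_dim M. transition_jac c d k i (snd c p) * v c i)))}"

definition chart_at :: "'p riem_mfd \<Rightarrow> 'p \<Rightarrow> 'p chart" where
  "chart_at M p = (SOME c. c \<in> mfd_atlas M \<and> p \<in> fst c)"

text \<open>The value does not depend on the chart chosen, by the transformation laws.\<close>

definition ginner :: "'p riem_mfd \<Rightarrow> 'p \<Rightarrow> 'p tvec \<Rightarrow> 'p tvec \<Rightarrow> real" where
  "ginner M p v w = (let c = chart_at M p in
     \<Sum>i<mfd_dim M. \<Sum>j<mfd_dim M. mfd_metric M c i j (snd c p) * v c i * w c j)"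

text \<open>
  Boundary charts are the restrictions of the charts of \<open>M\<close>, with values in \<open>\<real>\<^sup>n\<^sup>-\<^sup>1\<close>; so the
  tangent space of the boundary is the subspace of vectors whose last component vanishes.
\<close>

definition bdry_tangent_space :: "'p riem_mfd \<Rightarrow> 'p \<Rightarrow> 'p tvec set" where
  "bdry_tangent_space M p = {v \<in> tangent_space M p.
     \<forall>c\<in>mfd_atlas M. p \<in> fst c \<longrightarrow> v c (mfd_dim M - 1) = 0}"

definition inward_normal :: "'p riem_mfd \<Rightarrow> 'p \<Rightarrow> 'p tvec" where
  "inward_normal M p = (THE v. v \<in> tangent_space M p \<and>
     (\<forall>w\<in>bdry_tangent_space M p. ginner M p v w = 0) \<and>
     ginner M p v v = 1 \<and>
     (\<forall>c\<in>mfd_atlas M. p \<in> fst c \<longrightarrow> 0 < v c (mfd_dim M - 1)))"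

definition bdry_proj :: "'p riem_mfd \<Rightarrow> 'p \<times> 'p tvec \<Rightarrow> 'p \<times> 'p tvec" where
  "bdry_proj M = (\<lambda>(p, v). (p, \<lambda>c k.
     v c k - ginner M p v (inward_normal M p) * inward_normal M p c k))"

section \<open>Curves, distance and geodesics\<close>

definition chart_times :: "real set \<Rightarrow> (real \<Rightarrow> 'p) \<Rightarrow> 'p chart \<Rightarrow> real set" where
  "chart_times I \<gamma> c = {s \<in> I. \<gamma> s \<in> fst c}"

definition velocity :: "'p riem_mfd \<Rightarrow> real set \<Rightarrow> (real \<Rightarrow> 'p) \<Rightarrow> real \<Rightarrow> 'p tvec" where
  "velocity M I \<gamma> t = (\<lambda>c k.
     if c \<in> mfd_atlas M \<and> \<gamma> t \<in> fst c \<and> k < mfd_dim M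
     then vector_derivative (\<lambda>s. snd c (\<gamma> s) k) (at t within chart_times I \<gamma> c)
     else 0)"

definition speed :: "'p riem_mfd \<Rightarrow> real set \<Rightarrow> (real \<Rightarrow> 'p) \<Rightarrow> real \<Rightarrow> real" where
  "speed M I \<gamma> t = sqrt (ginner M (\<gamma> t) (velocity M I \<gamma> t) (velocity M I \<gamma> t))"

definition C1_curve_on :: "'p riem_mfd \<Rightarrow> real set \<Rightarrow> (real \<Rightarrow> 'p) \<Rightarrow> bool" where
  "C1_curve_on M I \<gamma> \<longleftrightarrow>
     continuous_map (top_of_set I) (mfd_top M) \<gamma> \<and>
     (\<forall>c\<in>mfd_atlas M. \<forall>k<mfd_dim M. \<exists>V. continuous_on (chart_times I \<gamma> c) V \<and>
        (\<forall>s\<in>chart_times I \<gamma> c.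
           ((\<lambda>u. snd c (\<gamma> u) k) has_real_derivative V s) (at s within chart_times I \<gamma> c)))"

definition piecewise_C1_curve :: "'p riem_mfd \<Rightarrow> (real \<Rightarrow> 'p) \<Rightarrow> bool" where
  "piecewise_C1_curve M \<gamma> \<longleftrightarrow>
     continuous_map (top_of_set {0..1}) (mfd_top M) \<gamma> \<and>
     (\<exists>m t. t 0 = 0 \<and> t m = 1 \<and>
        (\<forall>i<m. t i < t (Suc i) \<and> C1_curve_on M {t i..t (Suc i)} \<gamma>))"

text \<open>At the finitely many break points the integrand is irrelevant.\<close>

definition curve_length :: "'p riem_mfd \<Rightarrow> (real \<Rightarrow> 'p) \<Rightarrow> real" where
  "curve_length M \<gamma> = integral {0..1} (speed M {0..1} \<gamma>)"

definition mfd_dist :: "'p riem_mfd \<Rightarrow> 'p \<Rightarrow> 'p \<Rightarrow> real" where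
  "mfd_dist M p q =
     Inf {curve_length M \<gamma> | \<gamma>. piecewise_C1_curve M \<gamma> \<and> \<gamma> 0 = p \<and> \<gamma> 1 = q}"

definition christoffel_lower ::
    "'p riem_mfd \<Rightarrow> 'p chart \<Rightarrow> nat \<Rightarrow> nat \<Rightarrow> nat \<Rightarrow> (nat \<Rightarrow> real) \<Rightarrow> real" where
  "christoffel_lower M c i j k x = (let D = partial_deriv (snd c ` fst c); g = mfd_metric M c in
     (D i (g j k) x + D j (g i k) x - D k (g i j) x) / 2)"

text \<open>
  The geodesic equation \<open>\<nabla>\<^bsub>\<gamma>'\<^esub> \<gamma>' = 0\<close> in every chart, with the free index lowered by the metric;
  \<open>V\<close> and \<open>A\<close> are the first and second derivatives of the coordinates of \<open>\<gamma>\<close>.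
\<close>

definition geodesic_on :: "'p riem_mfd \<Rightarrow> real set \<Rightarrow> (real \<Rightarrow> 'p) \<Rightarrow> bool" where
  "geodesic_on M I \<gamma> \<longleftrightarrow> (let n = mfd_dim M in
     continuous_map (top_of_set I) (mfd_top M) \<gamma> \<and>
     (\<forall>c\<in>mfd_atlas M. \<exists>V A. \<forall>s\<in>chart_times I \<gamma> c. \<forall>k<n.
        ((\<lambda>u. snd c (\<gamma> u) k) has_real_derivative V k s) (at s within chart_times I \<gamma> c) \<and>
        (V k has_real_derivative A k s) (at s within chart_times I \<gamma> c) \<and>
        (\<Sum>j<n. mfd_metric M c k j (snd c (\<gamma> s)) * A j s) +
        (\<Sum>i<n. \<Sum>j<n. christoffel_lower M c i j k (snd c (\<gamma> s)) * V i s * V j s) = 0))"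

definition unit_speed_geodesic_on :: "'p riem_mfd \<Rightarrow> real set \<Rightarrow> (real \<Rightarrow> 'p) \<Rightarrow> bool" where
  "unit_speed_geodesic_on M I \<gamma> \<longleftrightarrow>
     geodesic_on M I \<gamma> \<and>
     (\<forall>t\<in>I. ginner M (\<gamma> t) (velocity M I \<gamma> t) (velocity M I \<gamma> t) = 1)"

section \<open>Lens data\<close>

definition lens_Omega :: "'p riem_mfd \<Rightarrow> (('p \<times> 'p tvec) \<times> ('p \<times> 'p tvec) \<times> real) set" where
  "lens_Omega M =
     {((\<gamma> 0, velocity M {0..T} \<gamma> 0), (\<gamma> T, velocity M {0..T} \<gamma> T), T) | \<gamma> T.
        0 < T \<and> unit_speed_geodesic_on M {0..T} \<gamma> \<and>
        \<gamma> 0 \<in> bdry M \<and>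
        0 < ginner M (\<gamma> 0) (velocity M {0..T} \<gamma> 0) (inward_normal M (\<gamma> 0)) \<and>
        \<gamma> T \<in> bdry M \<and> (\<forall>t. 0 < t \<and> t < T \<longrightarrow> \<gamma> t \<notin> bdry M)}"

definition lens_Omega' :: "'p riem_mfd \<Rightarrow> (('p \<times> 'p tvec) \<times> ('p \<times> 'p tvec) \<times> real) set" where
  "lens_Omega' M = (\<lambda>(v, w, T). (bdry_proj M v, bdry_proj M w, T)) ` lens_Omega M"

text \<open>
  The coordinate representation of \<open>\<phi> : \<partial>M \<rightarrow> \<partial>N\<close> in the boundary charts obtained by restricting
  \<open>c\<close> and \<open>d\<close>; its domain is a subset of \<open>\<real>\<^sup>n\<^sup>-\<^sup>1\<close>.
\<close>

definition bdry_rep_dom ::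
    "'p riem_mfd \<Rightarrow> ('p \<Rightarrow> 'q) \<Rightarrow> 'p chart \<Rightarrow> 'q chart \<Rightarrow> (nat \<Rightarrow> real) set" where
  "bdry_rep_dom M \<phi> c d = snd c ` {p \<in> fst c \<inter> bdry M. \<phi> p \<in> fst d}"

definition bdry_rep ::
    "('p \<Rightarrow> 'q) \<Rightarrow> 'p chart \<Rightarrow> 'q chart \<Rightarrow> nat \<Rightarrow> (nat \<Rightarrow> real) \<Rightarrow> real" where
  "bdry_rep \<phi> c d k x = snd d (\<phi> (chart_inv c x)) k"

definition smooth_bdry_map :: "'p riem_mfd \<Rightarrow> 'q riem_mfd \<Rightarrow> ('p \<Rightarrow> 'q) \<Rightarrow> bool" where
  "smooth_bdry_map M N \<phi> \<longleftrightarrow>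
     (\<forall>c\<in>mfd_atlas M. \<forall>d\<in>mfd_atlas N. \<forall>k<mfd_dim N - 1.
        smooth_fun_on (mfd_dim M - 1) (bdry_rep_dom M \<phi> c d) (bdry_rep \<phi> c d k))"

text \<open>The differential of \<open>\<phi> : \<partial>M \<rightarrow> \<partial>N\<close> on the tangent bundle of the boundary.\<close>

definition bdry_differential ::
    "'p riem_mfd \<Rightarrow> 'q riem_mfd \<Rightarrow> ('p \<Rightarrow> 'q) \<Rightarrow> 'p \<times> 'p tvec \<Rightarrow> 'q \<times> 'q tvec" where
  "bdry_differential M N \<phi> = (\<lambda>(p, v). (\<phi> p, \<lambda>d k. let c = chart_at M p in
     if d \<in> mfd_atlas N \<and> \<phi> p \<in> fst d \<and> k < mfd_dim N - 1
     then (\<Sum>i<mfd_dim M - 1.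
             partial_deriv (bdry_rep_dom M \<phi> c d) i (bdry_rep \<phi> c d k) (snd c p) * v c i)
     else 0))"

definition bdry_isometry :: "'p riem_mfd \<Rightarrow> 'q riem_mfd \<Rightarrow> ('p \<Rightarrow> 'q) \<Rightarrow> bool" where
  "bdry_isometry M N \<phi> \<longleftrightarrow>
     mfd_dim M = mfd_dim N \<and>
     homeomorphic_map (subtopology (mfd_top M) (bdry M)) (subtopology (mfd_top N) (bdry N)) \<phi> \<and>
     smooth_bdry_map M N \<phi> \<and> smooth_bdry_map N M (inv_into (bdry M) \<phi>) \<and>
     (\<forall>p\<in>bdry M. \<forall>v\<in>bdry_tangent_space M p. \<forall>w\<in>bdry_tangent_space M p.
        ginner N (\<phi> p) (snd (bdry_differential M N \<phi> (p, v))) (snd (bdry_differential M N \<phi> (p, w)))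
        = ginner M p v w)"

definition same_lens_data :: "'p riem_mfd \<Rightarrow> 'q riem_mfd \<Rightarrow> ('p \<Rightarrow> 'q) \<Rightarrow> bool" where
  "same_lens_data M N \<phi> \<longleftrightarrow>
     (\<lambda>(v, w, T). (bdry_differential M N \<phi> v, bdry_differential M N \<phi> w, T)) ` lens_Omega' M
       = lens_Omega' N \<and>
     (\<forall>p\<in>bdry M. \<forall>q\<in>bdry M. mfd_dist N (\<phi> p) (\<phi> q) = mfd_dist M p q)"

section \<open>Boundary normal coordinates and jets\<close>

text \<open>Arbitrary charts of the smooth structure of \<open>\<partial>M\<close>, not only those coming from the atlas.\<close>

definition bdry_chart :: "'p riem_mfd \<Rightarrow> 'p chart \<Rightarrow> bool" where
  "bdry_chart M b \<longleftrightarrow> (let V = fst b; \<psi> = snd b; m = mfd_dim M - 1 in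
     openin (subtopology (mfd_top M) (bdry M)) V \<and>
     openin (Euclidean_space m) (\<psi> ` V) \<and>
     homeomorphic_map (subtopology (mfd_top M) V) (subtopology (Euclidean_space m) (\<psi> ` V)) \<psi> \<and>
     (\<forall>c\<in>mfd_atlas M. \<forall>k<m.
        smooth_fun_on m (chart_overlap c b) (\<lambda>x. transition c b x k) \<and>
        smooth_fun_on m (chart_overlap b c) (\<lambda>x. transition b c x k)))"

definition closest_bdry_point :: "'p riem_mfd \<Rightarrow> 'p \<Rightarrow> 'p \<Rightarrow> bool" where
  "closest_bdry_point M p q \<longleftrightarrow> q \<in> bdry M \<and>
     (\<forall>q'\<in>bdry M. q' \<noteq> q \<longrightarrow> mfd_dist M p q < mfd_dist M p q')"

definition bdry_foot :: "'p riem_mfd \<Rightarrow> 'p \<Rightarrow> 'p" where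
  "bdry_foot M p = (THE q. closest_bdry_point M p q)"

text \<open>
  The points with a unique closest boundary point that lies in the domain of the chart \<open>b\<close>. Boundary
  normal coordinates are injective on this set, and by compactness form a chart near \<open>\<partial>M\<close>; only
  the germ at \<open>\<partial>M\<close> is used in the jets.
\<close>

definition bnc_dom :: "'p riem_mfd \<Rightarrow> 'p chart \<Rightarrow> 'p set" where
  "bnc_dom M b = {p \<in> topspace (mfd_top M). \<exists>q\<in>fst b. closest_bdry_point M p q}"

definition bnc :: "'p riem_mfd \<Rightarrow> 'p chart \<Rightarrow> 'p \<Rightarrow> nat \<Rightarrow> real" where
  "bnc M b p = (snd b (bdry_foot M p))(mfd_dim M - 1 := mfd_dist M p (bdry_foot M p))"

definition bnc_chart :: "'p riem_mfd \<Rightarrow> 'p chart \<Rightarrow> 'p chart" where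
  "bnc_chart M b = (bnc_dom M b, bnc M b)"

definition bnc_metric :: "'p riem_mfd \<Rightarrow> 'p chart \<Rightarrow> nat \<Rightarrow> nat \<Rightarrow> (nat \<Rightarrow> real) \<Rightarrow> real" where
  "bnc_metric M b i j y =
     (let e = bnc_chart M b; c = chart_at M (chart_inv e y); n = mfd_dim M in
      \<Sum>k<n. \<Sum>l<n. transition_jac e c k i y * transition_jac e c l j y *
        mfd_metric M c k l (transition e c y))"

text \<open>
  The \<open>r\<close>-th derivative in the normal coordinate, one-sided at the boundary, evaluated at the boundary
  point with coordinates \<open>x \<in> \<real>\<^sup>n\<^sup>-\<^sup>1\<close>.
\<close>

definition bdry_jet ::
    "'p riem_mfd \<Rightarrow> 'p chart \<Rightarrow> nat \<Rightarrow> nat \<Rightarrow> nat \<Rightarrow> (nat \<Rightarrow> real) \<Rightarrow> real" where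
  "bdry_jet M b r i j x =
     ((\<lambda>f s. vector_derivative f (at s within {0..})) ^^ r)
       (\<lambda>s. bnc_metric M b i j (x(mfd_dim M - 1 := s))) 0"

definition push_chart :: "('p \<Rightarrow> 'q) \<Rightarrow> 'p chart \<Rightarrow> 'q chart" where
  "push_chart \<phi> b = (\<phi> ` fst b, snd b \<circ> inv_into (fst b) \<phi>)"

definition bdry_jets_differ :: "'p riem_mfd \<Rightarrow> 'q riem_mfd \<Rightarrow> ('p \<Rightarrow> 'q) \<Rightarrow> bool" where
  "bdry_jets_differ M N \<phi> \<longleftrightarrow>
     (\<exists>b r i j x. bdry_chart M b \<and> i < mfd_dim M \<and> j < mfd_dim M \<and> x \<in> snd b ` fst b \<and>
        bdry_jet M b r i j x \<noteq> bdry_jet N (push_chart \<phi> b) r i j x)"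

end

theory Submission
  imports Defs
begin

text \<open>
  Both manifolds are cylinders \<open>S\<^sup>1 \<times> [0, 4\<pi>]\<close> with the metric \<open>dr\<^sup>2 + G(r) d\<theta>\<^sup>2\<close>, where
  \<open>G(r) = 1 + sin\<^sup>2(k r)\<close> with \<open>k = 1\<close> and \<open>k = 2\<close> respectively, and \<open>\<phi>\<close> is the identity. By Clairaut's relation
  \<open>p = G \<theta>'\<close> is constant along a geodesic, and unit speed gives \<open>r'\<^sup>2 = 1 - p\<^sup>2/G\<close>. Since \<open>G \<ge> 1\<close> with
  equality on the boundary, a geodesic that starts inwards has \<open>\<bar>p\<bar> < 1\<close> and crosses to the other end
  circle in time \<open>\<integral> (1 - p\<^sup>2/G)\<^sup>-\<^sup>1\<^sup>/\<^sup>2 dr\<close>, rotating by the angle \<open>\<integral> p/G (1 - p\<^sup>2/G)\<^sup>-\<^sup>1\<^sup>/\<^sup>2 dr\<close>. Integrals over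
  \<open>[0, 4\<pi>]\<close> of functions of \<open>G\<close> do not depend on \<open>k\<close>, by periodicity, so neither do these data. The
  boundary distance is the angle for points on the same end circle, and otherwise the length of a geodesic with
  \<open>0 \<le> p \<le> 1/2\<close>; the lower bounds come from the calibrations \<open>p d\<theta> \<plusminus> (1 - p\<^sup>2/G)\<^sup>1\<^sup>/\<^sup>2 dr\<close>. Finally
  \<open>(\<theta>, r)\<close> are boundary normal coordinates near \<open>r = 0\<close>, where the second derivative of \<open>g\<^sub>\<theta>\<^sub>\<theta> = G\<close> is \<open>2k\<^sup>2\<close>.
\<close>

section \<open>The cylinder and its atlas\<close>

text \<open>Lens data see the profile only through integrals of functions of \<open>G\<close> over
  the whole height, that is, through the distribution of the values of \<open>G\<close>. Doubling
  the frequency rearranges these values without changing their distribution, yet it changes the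
  Taylor coefficients at the ends. For this to work every geodesic entering from the boundary must
  cross the whole cylinder, since one that turned back would depend on a part of the profile only.
  Hence the ends are placed at the minimum of \<open>G\<close>. Distances are the second obstacle:
  minimisers may run along the boundary, so they are not found among the inward geodesics and no
  existence theorem for them is used. Each distance between boundary points is instead pinned
  between the length of an explicit curve and the integral of a closed form of norm 1 that attains
  this length on it. The form with \<open>p = 1\<close> serves the end circles, the one with
  \<open>p = 0\<close> the vertical segments.\<close>

text \<open>
  The cylinder sits in \<open>\<real>\<^sup>3\<close> as the set of all \<open>pt z r\<close> with \<open>\<bar>z\<bar> = 1\<close>. In the chart \<open>ch \<alpha> s\<close> the first
  coordinate is the angle measured from \<open>\<alpha>\<close>, and the second one is the distance \<open>ht s r\<close> to the end circle
  \<open>r = 0\<close> (if \<open>s\<close>) or \<open>r = hgt\<close> (if not \<open>s\<close>). For a profile \<open>G\<close> that is symmetric under \<open>r \<mapsto> hgt - r\<close>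
  the metric has the same components in all these charts.
\<close>

definition hgt :: real where "hgt = 4 * pi"

definition ht :: "bool \<Rightarrow> real \<Rightarrow> real" where "ht s r = (if s then r else hgt - r)"

text \<open>The derivative of \<open>ht s\<close>, hence the sign that height components of vectors
  acquire in the chart \<open>ch \<alpha> s\<close>.\<close>

definition sg :: "bool \<Rightarrow> real" where "sg s = (if s then 1 else -1)"

definition pt :: "complex \<Rightarrow> real \<Rightarrow> nat \<Rightarrow> real" where
  "pt z r = (\<lambda>i. if i = 0 then Re z else if i = 1 then Im z else if i = 2 then r else 0)"

definition zc :: "(nat \<Rightarrow> real) \<Rightarrow> complex" where "zc p = Complex (p 0) (p 1)"

definition cyl :: "(nat \<Rightarrow> real) set" where
  "cyl = (\<lambda>(z, r). pt z r) ` (sphere 0 1 \<times> {0..hgt})"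

definition ang :: "real \<Rightarrow> complex \<Rightarrow> real" where "ang \<alpha> z = Arg (z * cis (- \<alpha>))"

text \<open>Two sets are removed: the segment opposite to \<alpha>, where the angle jumps, and the
  end circle far from the chart. So each chart meets only one end circle, and there its height
  coordinate is 0, as boundary charts require.\<close>

definition cdom :: "real \<Rightarrow> bool \<Rightarrow> (nat \<Rightarrow> real) set" where
  "cdom \<alpha> s = {p \<in> cyl. ang \<alpha> (zc p) < pi \<and> ht s (p 2) < hgt}"

definition coord :: "real \<Rightarrow> bool \<Rightarrow> (nat \<Rightarrow> real) \<Rightarrow> nat \<Rightarrow> real" where
  "coord \<alpha> s p = (\<lambda>i. if i = 0 then ang \<alpha> (zc p) else if i = 1 then ht s (p 2) else 0)"

definition ch :: "real \<Rightarrow> bool \<Rightarrow> (nat \<Rightarrow> real) chart" where "ch \<alpha> s = (cdom \<alpha> s, coord \<alpha> s)"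

definition hbox :: "(nat \<Rightarrow> real) set" where
  "hbox = {x. - pi < x 0 \<and> x 0 < pi \<and> 0 \<le> x 1 \<and> x 1 < hgt \<and> (\<forall>i\<ge>2. x i = 0)}"

text \<open>The inverse of \<open>coord \<alpha> s\<close>, by a formula that makes sense and is
  continuous on all sequences, also outside \<open>hbox\<close>.\<close>

definition unco :: "real \<Rightarrow> bool \<Rightarrow> (nat \<Rightarrow> real) \<Rightarrow> nat \<Rightarrow> real" where
  "unco \<alpha> s x = pt (cis (\<alpha> + x 0)) (ht s (x 1))"

definition rev_metric ::
    "(real \<Rightarrow> real) \<Rightarrow> (nat \<Rightarrow> real) chart \<Rightarrow> nat \<Rightarrow> nat \<Rightarrow> (nat \<Rightarrow> real) \<Rightarrow> real" where
  "rev_metric G c i j x = (if i = j then if i = 0 then G (x 1) else 1 else 0)"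

definition rev_mfd :: "(real \<Rightarrow> real) \<Rightarrow> (nat \<Rightarrow> real) riem_mfd" where
  "rev_mfd G = \<lparr>mfd_top = top_of_set cyl, mfd_dim = 2, mfd_atlas = {ch \<alpha> s |\<alpha> s. True},
     mfd_metric = rev_metric G\<rparr>"

lemma rev_mfd_simps [simp]:
  "mfd_top (rev_mfd G) = top_of_set cyl" "mfd_dim (rev_mfd G) = 2"
  "mfd_atlas (rev_mfd G) = {ch \<alpha> s |\<alpha> s. True}" "mfd_metric (rev_mfd G) = rev_metric G"
  by (simp_all add: rev_mfd_def)

lemma ch_simps [simp]: "fst (ch \<alpha> s) = cdom \<alpha> s" "snd (ch \<alpha> s) = coord \<alpha> s"
  by (simp_all add: ch_def)

lemma hgt_pos [simp]: "0 < hgt" "0 \<le> hgt"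
  by (simp_all add: hgt_def)

lemma ht_simps [simp]: "ht s (ht s r) = r" "ht True r = r" "ht False r = hgt - r"
  by (simp_all add: ht_def)

lemma sg_simps [simp]: "sg s * sg s = 1" "sg s * (sg s * x) = x" "sg True = 1" "sg False = -1"
  by (simp_all add: sg_def)

lemma pt_simps [simp]: "zc (pt z r) = z" "pt z r 2 = r" "pt z r (Suc (Suc 0)) = r"
  by (simp_all add: zc_def pt_def)

lemma pt_inject [simp]: "pt z r = pt z' r' \<longleftrightarrow> z = z' \<and> r = r'"
  by (metis pt_simps(1,2))

lemma sum_less_2: "(\<Sum>i<2. f i) = f 0 + f (1::nat)" for f :: "nat \<Rightarrow> real"
  by (simp add: numeral_2_eq_2)

lemma pt_in_cyl [simp]: "pt z r \<in> cyl \<longleftrightarrow> cmod z = 1 \<and> 0 \<le> r \<and> r \<le> hgt"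
  by (auto simp: cyl_def)

lemma cylE:
  assumes "p \<in> cyl"
  obtains t r where "p = pt (cis t) r" "0 \<le> r" "r \<le> hgt"
proof -
  from assms obtain z r where p: "p = pt z r" "cmod z = 1" "0 \<le> r" "r \<le> hgt"
    by (auto simp: cyl_def)
  have "z = cis (Arg z)"
    using cis_Arg[of z] p(2) by (cases "z = 0") (auto simp: sgn_div_norm)
  with p that show ?thesis by metis
qed

lemma ang_cis_add [simp]: "- pi < t \<Longrightarrow> t \<le> pi \<Longrightarrow> ang \<alpha> (cis (\<alpha> + t)) = t"
  by (simp add: ang_def cis_mult Arg_cis)

lemma ang_bounds: "- pi < ang \<alpha> z" "ang \<alpha> z \<le> pi"
  using Arg_bounded by (auto simp: ang_def)

lemma cis_add_ang:
  assumes "cmod z = 1"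
  shows "cis (\<alpha> + ang \<alpha> z) = z"
proof -
  have n: "cmod (z * cis (- \<alpha>)) = 1"
    using assms by (simp add: norm_mult)
  then have "z * cis (- \<alpha>) \<noteq> 0" by (metis norm_zero zero_neq_one)
  then have "cis (ang \<alpha> z) = z * cis (- \<alpha>)"
    unfolding ang_def using n by (simp add: cis_Arg sgn_div_norm)
  then have "cis \<alpha> * cis (ang \<alpha> z) = z * (cis \<alpha> * cis (- \<alpha>))" by simp
  then show ?thesis by (simp add: cis_mult)
qed

text \<open>The value \<open>pi\<close> of the angle belongs to a single point of the circle. In
  this form the cut of a chart is visibly closed, although \<open>ang\<close> is discontinuous along
  it.\<close>

lemma ang_less_pi_iff:
  assumes "cmod z = 1"
  shows "ang \<alpha> z < pi \<longleftrightarrow> z \<noteq> - cis \<alpha>"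
proof -
  have "ang \<alpha> z = pi \<longleftrightarrow> z = - cis \<alpha>"
  proof
    assume "ang \<alpha> z = pi"
    then show "z = - cis \<alpha>" using cis_add_ang[OF assms, of \<alpha>] by (simp add: cis_mult[symmetric])
  next
    assume "z = - cis \<alpha>"
    then have "z = cis (\<alpha> + pi)" by (simp add: cis_mult[symmetric])
    then show "ang \<alpha> z = pi" by simp
  qed
  with ang_bounds[of \<alpha> z] show ?thesis by linarith
qed

lemma cyl_props:
  assumes "p \<in> cyl"
  shows "cmod (zc p) = 1" "0 \<le> p 2" "p 2 \<le> hgt" "pt (zc p) (p 2) = p"
  using assms by (auto elim!: cylE)

lemma ht_bounds [simp]:
  "0 \<le> ht s r \<longleftrightarrow> (if s then 0 \<le> r else r \<le> hgt)" "ht s r \<le> hgt \<longleftrightarrow> (if s then r \<le> hgt else 0 \<le> r)"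
  by (auto simp: ht_def)

lemma cdom_subset: "cdom \<alpha> s \<subseteq> cyl"
  by (auto simp: cdom_def)

lemma unco_in_cdom: "x \<in> hbox \<Longrightarrow> unco \<alpha> s x \<in> cdom \<alpha> s"
  by (auto simp: hbox_def cdom_def unco_def)

lemma coord_unco: "x \<in> hbox \<Longrightarrow> coord \<alpha> s (unco \<alpha> s x) = x"
  by (force simp: hbox_def coord_def unco_def fun_eq_iff)

lemma coord_in_hbox: "p \<in> cdom \<alpha> s \<Longrightarrow> coord \<alpha> s p \<in> hbox"
  by (auto simp: hbox_def cdom_def coord_def ang_bounds elim!: cylE)

lemma unco_coord: "p \<in> cdom \<alpha> s \<Longrightarrow> unco \<alpha> s (coord \<alpha> s p) = p"
  by (simp add: unco_def coord_def cdom_def cyl_props cis_add_ang)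

lemma coord_image: "coord \<alpha> s ` cdom \<alpha> s = hbox"
  using coord_in_hbox coord_unco unco_in_cdom by (metis (no_types, opaque_lifting) image_eqI subset_antisym subsetI image_subset_iff)

lemma inj_on_coord: "inj_on (coord \<alpha> s) (cdom \<alpha> s)"
  by (metis inj_onI unco_coord)

section \<open>Topology of the cylinder and of its charts\<close>

lemma continuous_on_app [continuous_intros]: "continuous_on S (\<lambda>x. x i)" for S :: "(nat \<Rightarrow> real) set"
  by (rule continuous_on_subset[OF continuous_on_product_coordinates]) simp

lemma continuous_on_zc [continuous_intros]: "continuous_on S zc"
  unfolding zc_def Complex_eq
  by (rule continuous_on_add continuous_on_mult continuous_on_of_real continuous_on_const
      continuous_on_app)+

lemma continuous_on_pt [continuous_intros]:
  assumes "continuous_on S f" "continuous_on S g"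
  shows "continuous_on S (\<lambda>x. pt (f x) (g x))"
  unfolding pt_def
proof (intro continuous_on_coordinatewise_then_product)
  fix i :: nat
  show "continuous_on S (\<lambda>x. if i = 0 then Re (f x) else if i = 1 then Im (f x) else if i = 2 then g x else 0)"
    using assms by (cases "i = 0"; cases "i = 1"; cases "i = 2")
      (simp_all add: continuous_on_Re continuous_on_Im)
qed

lemma continuous_on_ht [continuous_intros]:
  "continuous_on S g \<Longrightarrow> continuous_on S (\<lambda>x. ht s (g x))"
  by (cases s) (simp_all add: continuous_on_diff)

lemma compact_cyl: "compact cyl"
  unfolding cyl_def split_def
  by (intro compact_continuous_image compact_Times continuous_on_pt continuous_on_fst
      continuous_on_snd continuous_on_id compact_sphere compact_Icc)

lemma connected_cyl: "connected cyl"
  unfolding cyl_def split_def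
  by (intro connected_continuous_image connected_Times connected_sphere continuous_on_pt
      continuous_on_fst continuous_on_snd continuous_on_id connected_Icc) simp

lemma openin_cdom: "openin (top_of_set cyl) (cdom \<alpha> s)"
proof -
  have "cdom \<alpha> s = cyl \<inter> ({p. zc p \<noteq> - cis \<alpha>} \<inter> {p. ht s (p 2) < hgt})"
    by (auto simp: cdom_def ang_less_pi_iff cyl_props)
  moreover have "open {p. zc p \<noteq> - cis \<alpha>}"
    by (rule open_Collect_neq[OF continuous_on_zc continuous_on_const])
  moreover have "open {p. ht s (p (2::nat)) < hgt}"
    by (rule open_Collect_less) (rule continuous_on_ht continuous_on_app continuous_on_const)+
  ultimately show ?thesis
    by (simp only: openin_open_Int open_Int)
qed

lemma continuous_on_coord: "continuous_on (cdom \<alpha> s) (coord \<alpha> s)"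
  unfolding coord_def
proof (intro continuous_on_coordinatewise_then_product)
  fix i :: nat
  have "continuous_on (cdom \<alpha> s) (\<lambda>p. ang \<alpha> (zc p))"
    unfolding ang_def
  proof (rule continuous_on_compose2[of "- \<real>\<^sub>\<le>\<^sub>0" Arg])
    show "continuous_on (- \<real>\<^sub>\<le>\<^sub>0) Arg"
      by (simp add: continuous_at_Arg continuous_at_imp_continuous_on)
    show "continuous_on (cdom \<alpha> s) (\<lambda>p. zc p * cis (- \<alpha>))"
      by (intro continuous_on_mult continuous_on_zc continuous_on_const)
    \<comment> \<open>On the unit circle the cut of \<open>Arg\<close> consists of -1 alone, where
      the angle is \<open>pi\<close>.\<close>
    show "(\<lambda>p. zc p * cis (- \<alpha>)) ` cdom \<alpha> s \<subseteq> - \<real>\<^sub>\<le>\<^sub>0"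
    proof clarify
      fix p assume p: "p \<in> cdom \<alpha> s" and np: "zc p * cis (- \<alpha>) \<in> \<real>\<^sub>\<le>\<^sub>0"
      have "cmod (zc p * cis (- \<alpha>)) = 1"
        using p by (simp add: cdom_def cyl_props norm_mult)
      then have "zc p * cis (- \<alpha>) \<noteq> 0" by (metis norm_zero zero_neq_one)
      with np have "Arg (zc p * cis (- \<alpha>)) = pi"
        unfolding Arg_eq_pi complex_nonpos_Reals_iff complex_eq_iff by force
      with p show False by (simp add: cdom_def ang_def)
    qed
  qed
  then show "continuous_on (cdom \<alpha> s) (\<lambda>x. if i = 0 then ang \<alpha> (zc x) else if i = 1 then ht s (x 2) else 0)"
    by (cases "i = 0"; cases "i = 1") (simp_all add: continuous_on_ht continuous_on_app)
qed

lemma continuous_on_unco: "continuous_on S (unco \<alpha> s)"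
  unfolding unco_def by (intro continuous_on_pt continuous_on_ht continuous_on_cis continuous_on_add
      continuous_on_const continuous_on_app)

lemma half_space_2: "half_space 2 = top_of_set {x. 0 \<le> x 1 \<and> (\<forall>i\<ge>2. x i = 0)}"
  by (simp add: half_space_def Euclidean_space_def euclidean_product_topology subtopology_subtopology)
    (rule arg_cong[where f = top_of_set], auto)

lemma Euclidean_space_1: "Euclidean_space (Suc 0) = top_of_set {x. \<forall>i\<ge>1. x i = 0}"
  by (simp add: Euclidean_space_def euclidean_product_topology)

lemma openin_hbox: "openin (half_space 2) hbox"
proof -
  have *: "hbox = {x. 0 \<le> x 1 \<and> (\<forall>i\<ge>2. x i = 0)} \<inter>
      ({x. - pi < x 0} \<inter> {x. x 0 < pi} \<inter> {x. x 1 < hgt})"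
    by (auto simp: hbox_def)
  have o: "open {x. - pi < x (0::nat)}" "open {x. x (0::nat) < pi}" "open {x. x (1::nat) < hgt}"
    by (rule open_Collect_less continuous_on_app continuous_on_const)+
  show ?thesis
    unfolding half_space_2 * by (rule openin_open_Int) (rule open_Int o)+
qed

lemma homeomorphic_map_coord:
  "homeomorphic_map (top_of_set (cdom \<alpha> s)) (top_of_set hbox) (coord \<alpha> s)"
  unfolding homeomorphic_map_maps homeomorphic_maps_def
  by (rule exI[of _ "unco \<alpha> s"])
    (auto simp: continuous_on_coord continuous_on_unco coord_unco unco_coord unco_in_cdom coord_in_hbox)

text \<open>Covers also boundary normal charts and charts of the boundary, which are not in the atlas.\<close>

definition subchart :: "real \<Rightarrow> bool \<Rightarrow> (nat \<Rightarrow> real) chart \<Rightarrow> bool" where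
  "subchart \<alpha> s e \<longleftrightarrow> fst e \<subseteq> cdom \<alpha> s \<and> (\<forall>p\<in>fst e. snd e p = coord \<alpha> s p)"

lemma subchart_ch [simp]: "subchart \<alpha> s (ch \<alpha> s)"
  by (simp add: subchart_def)

lemma subchart_image:
  assumes "subchart \<alpha> s e" "W \<subseteq> fst e"
  shows "snd e ` W = {x \<in> hbox. unco \<alpha> s x \<in> W}"
proof -
  have "snd e ` W = coord \<alpha> s ` W"
    using assms by (auto simp: subchart_def subset_iff)
  also have "\<dots> = {x \<in> hbox. unco \<alpha> s x \<in> W}"
    using assms coord_in_hbox unco_coord coord_unco unfolding subchart_def
    by (auto simp: subset_iff image_iff) metis+
  finally show ?thesis .
qed

lemma chart_inv_subchart:
  assumes "subchart \<alpha> s e" "x \<in> hbox" "unco \<alpha> s x \<in> fst e"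
  shows "chart_inv e x = unco \<alpha> s x"
proof -
  have "inj_on (snd e) (fst e)"
    using assms(1) inj_on_coord[of \<alpha> s] unfolding subchart_def inj_on_def subset_iff by metis
  moreover have "snd e (unco \<alpha> s x) = x"
    using assms by (simp add: subchart_def coord_unco)
  ultimately show ?thesis
    unfolding chart_inv_def using assms(3) inv_into_f_f by fastforce
qed

section \<open>Transition maps and their Jacobians\<close>

lemma coord_of_unco:
  "coord \<beta> t (unco \<alpha> s x) =
    (\<lambda>i. if i = 0 then ang \<beta> (cis (\<alpha> + x 0)) else if i = 1 then ht t (ht s (x 1)) else 0)"
  unfolding coord_def unco_def by (intro ext) simp

lemma transition_subchart:
  assumes "subchart \<alpha> s e" "x \<in> chart_overlap e d"
  shows "transition e d x = snd d (unco \<alpha> s x)"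
proof -
  have "x \<in> hbox" "unco \<alpha> s x \<in> fst e"
    using assms(2) subchart_image[OF assms(1), of "fst e \<inter> fst d"] by (auto simp: chart_overlap_def)
  then show ?thesis by (simp add: transition_def chart_inv_subchart[OF assms(1)])
qed

text \<open>Changing the reference angle shifts the angle by a constant. The overlap of two charts
  usually has two components, on which the constants differ by \<open>2 * pi\<close>, so only a
  local statement is possible.\<close>

lemma ang_cis_local:
  assumes "ang \<beta> (cis (\<alpha> + a)) < pi"
  shows "\<exists>\<epsilon>>0. \<forall>u. \<bar>u - a\<bar> < \<epsilon> \<longrightarrow> ang \<beta> (cis (\<alpha> + u)) = ang \<beta> (cis (\<alpha> + a)) + (u - a)"
proof -
  obtain b where b: "b = ang \<beta> (cis (\<alpha> + a))" by blast
  then have bounds: "- pi < b" "b < pi" using assms ang_bounds(1)[of \<beta>] by blast+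
  have cb: "cis (\<beta> + b) = cis (\<alpha> + a)" unfolding b by (rule cis_add_ang) simp
  have "ang \<beta> (cis (\<alpha> + u)) = b + (u - a)" if "\<bar>u - a\<bar> < pi - b" "\<bar>u - a\<bar> < b + pi" for u
  proof -
    have "cis (\<alpha> + u) = cis (\<alpha> + a) * cis (u - a)" by (simp add: cis_mult)
    also have "\<dots> = cis (\<beta> + (b + (u - a)))" by (simp add: cb[symmetric] cis_mult add.assoc)
    finally have "ang \<beta> (cis (\<alpha> + u)) = ang \<beta> (cis (\<beta> + (b + (u - a))))" by (rule arg_cong)
    also have "\<dots> = b + (u - a)" by (rule ang_cis_add) (use that in linarith)+
    finally show ?thesis .
  qed
  then show ?thesis
    unfolding b[symmetric] using bounds by (intro exI[of _ "min (pi - b) (b + pi)"]) simp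
qed

lemma ht_ht: "ht t (ht s r) = (if s = t then 0 else hgt) + sg s * sg t * r"
  by (auto simp: ht_def sg_def)

text \<open>The derivative within \<open>S\<close> is already unique if \<open>S\<close> contains a
  piece to the right of \<open>x i\<close>. Relatively open sets of the half-space contain such a
  piece at every point, so interior and boundary points need no separate treatment.\<close>

lemma partial_deriv_eqI:
  assumes g: "(g has_real_derivative D) (at (x i))" and \<epsilon>: "0 < \<epsilon>"
    and S: "\<And>u. x i \<le> u \<Longrightarrow> u < x i + \<epsilon> \<Longrightarrow> x(i := u) \<in> S"
    and f: "\<And>u. \<bar>u - x i\<bar> < \<epsilon> \<Longrightarrow> x(i := u) \<in> S \<Longrightarrow> f (x(i := u)) = g u"
  shows "partial_deriv S i f x = D"
proof -
  let ?T = "{u. x(i := u) \<in> S}"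
  have T: "{x i..<x i + \<epsilon>} \<subseteq> ?T" using S by auto
  have "x i islimpt {x i..<x i + \<epsilon>}" using \<epsilon> by (simp add: islimpt_Ico)
  then have "x i islimpt ?T" using T islimpt_subset by blast
  then have nt: "at (x i) within ?T \<noteq> bot" by (simp add: trivial_limit_within)
  have "(g has_vector_derivative D) (at (x i) within ?T)"
    using g has_real_derivative_iff_has_vector_derivative has_vector_derivative_at_within by blast
  then have "((\<lambda>u. f (x(i := u))) has_vector_derivative D) (at (x i) within ?T)"
    by (rule has_vector_derivative_transform_within[OF _ \<epsilon>])
      (use S[of "x i"] \<epsilon> f in \<open>auto simp: dist_real_def\<close>)
  then show ?thesis
    unfolding partial_deriv_def using nt by (rule vector_derivative_within[rotated])
qed

lemma right_open:
  fixes x :: "nat \<Rightarrow> real"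
  assumes "openin (top_of_set B) S" "x \<in> S"
    and "\<exists>\<epsilon>>0. \<forall>u. x i \<le> u \<and> u < x i + \<epsilon> \<longrightarrow> x(i := u) \<in> B"
  shows "\<exists>\<epsilon>>0. \<forall>u. x i \<le> u \<and> u < x i + \<epsilon> \<longrightarrow> x(i := u) \<in> S"
proof -
  obtain U where U: "open U" "S = B \<inter> U" using assms(1) by (auto simp: openin_open)
  have "continuous_on UNIV (\<lambda>u. (x(i := u)) j)" for j
    by (cases "j = i") simp_all
  then have "continuous_on UNIV (\<lambda>u. x(i := u))"
    by (rule continuous_on_coordinatewise_then_product)
  then have "open ((\<lambda>u. x(i := u)) -` U)" using U(1) by (simp add: open_vimage)
  moreover have "x i \<in> (\<lambda>u. x(i := u)) -` U" using assms(2) U by simp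
  ultimately obtain \<delta> where \<delta>: "\<delta> > 0" "\<And>u. \<bar>u - x i\<bar> < \<delta> \<Longrightarrow> x(i := u) \<in> U"
    unfolding open_dist by (auto simp: dist_real_def)
  obtain \<epsilon> where \<epsilon>: "\<epsilon> > 0" "\<And>u. x i \<le> u \<Longrightarrow> u < x i + \<epsilon> \<Longrightarrow> x(i := u) \<in> B"
    using assms(3) by auto
  have "\<forall>u. x i \<le> u \<and> u < x i + min \<delta> \<epsilon> \<longrightarrow> x(i := u) \<in> S"
    using \<delta> \<epsilon> U by auto
  with \<delta> \<epsilon> show ?thesis by (intro exI[of _ "min \<delta> \<epsilon>"]) simp
qed

lemma hbox_right_open:
  assumes "x \<in> hbox" "i < 2"
  shows "\<exists>\<epsilon>>0. \<forall>u. x i \<le> u \<and> u < x i + \<epsilon> \<longrightarrow> x(i := u) \<in> hbox"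
  using assms
  by (intro exI[of _ "(if i = 0 then pi else hgt) - x i"]) (auto simp: hbox_def less_2_cases_iff)

lemma openin_subchart_image:
  assumes "subchart \<alpha> s e" "openin (top_of_set cyl) W" "W \<subseteq> fst e"
  shows "openin (top_of_set hbox) (snd e ` W)"
proof -
  have "openin (top_of_set hbox) (hbox \<inter> unco \<alpha> s -` W)"
    using unco_in_cdom cdom_subset
    by (intro continuous_openin_preimage[OF continuous_on_unco _ assms(2)]) blast
  moreover have "hbox \<inter> unco \<alpha> s -` W = snd e ` W"
    using subchart_image[OF assms(1,3)] by auto
  ultimately show ?thesis by simp
qed

lemma transition_local:
  assumes "x \<in> hbox" "unco \<alpha> s x \<in> cdom \<beta> t"
  shows "\<exists>\<epsilon>>0. \<forall>y. \<bar>y 0 - x 0\<bar> < \<epsilon> \<longrightarrow>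
    coord \<beta> t (unco \<alpha> s y) 0 = coord \<beta> t (unco \<alpha> s x) 0 + (y 0 - x 0)"
proof -
  have "ang \<beta> (cis (\<alpha> + x 0)) < pi" using assms by (simp add: cdom_def unco_def)
  from ang_cis_local[OF this] show ?thesis unfolding coord_of_unco by auto
qed

text \<open>Locally a transition translates the angle and translates or reflects the height, hence
  the constant diagonal Jacobian. Allowing \<open>e\<close> outside the atlas makes this available
  for boundary normal coordinates.\<close>

lemma transition_jac_subchart:
  assumes e: "subchart \<alpha> s e" "openin (top_of_set cyl) (fst e)"
    and x: "x \<in> chart_overlap e (ch \<beta> t)" and "k < 2" "i < 2"
  shows "transition_jac e (ch \<beta> t) k i x = (if k \<noteq> i then 0 else if k = 0 then 1 else sg s * sg t)"
proof -
  let ?S = "chart_overlap e (ch \<beta> t)"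
  let ?j = "if k \<noteq> i then 0 else if k = 0 then 1 else sg s * sg t"
  have S: "?S = {x \<in> hbox. unco \<alpha> s x \<in> fst e \<inter> cdom \<beta> t}"
    unfolding chart_overlap_def using subchart_image[OF e(1)] by simp
  have "openin (top_of_set hbox) ?S"
    unfolding chart_overlap_def
    by (rule openin_subchart_image[OF e(1)]) (use e(2) openin_cdom in auto)
  from right_open[OF this x hbox_right_open] x \<open>i < 2\<close> obtain \<epsilon>
    where \<epsilon>: "\<epsilon> > 0" "\<And>u. x i \<le> u \<Longrightarrow> u < x i + \<epsilon> \<Longrightarrow> x(i := u) \<in> ?S"
    unfolding S by blast
  obtain \<delta> where \<delta>: "\<delta> > 0" "\<And>y. \<bar>y 0 - x 0\<bar> < \<delta> \<Longrightarrow>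
    coord \<beta> t (unco \<alpha> s y) 0 = coord \<beta> t (unco \<alpha> s x) 0 + (y 0 - x 0)"
    using transition_local[of x \<alpha> s \<beta> t] x S by auto
  have "coord \<beta> t (unco \<alpha> s (x(i := u))) k = coord \<beta> t (unco \<alpha> s x) k + ?j * (u - x i)"
    if "\<bar>u - x i\<bar> < \<delta>" for u
  proof (cases "k = 0")
    case True
    then show ?thesis using \<delta>(2)[of "x(i := u)"] that \<delta>(1) by (cases "i = 0") auto
  next
    case False
    then have "k = 1" using \<open>k < 2\<close> by simp
    then show ?thesis by (auto simp: coord_of_unco ht_ht algebra_simps)
  qed
  then have f: "transition e (ch \<beta> t) (x(i := u)) k = coord \<beta> t (unco \<alpha> s x) k + ?j * (u - x i)"
    if "\<bar>u - x i\<bar> < min \<delta> \<epsilon>" "x(i := u) \<in> ?S" for u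
    using transition_subchart[OF e(1) that(2)] that(1) by simp
  define g where "g = (\<lambda>u. coord \<beta> t (unco \<alpha> s x) k + ?j * (u - x i))"
  have g: "(g has_real_derivative ?j) (at (x i))"
    unfolding g_def by (auto intro!: derivative_eq_intros)
  show ?thesis
    unfolding transition_jac_def
    by (rule partial_deriv_eqI[where \<epsilon> = "min \<delta> \<epsilon>" and g = g])
      (use \<epsilon> \<delta>(1) f g in \<open>auto simp: g_def\<close>)
qed

section \<open>Analyticity of the transitions and of the metric\<close>

text \<open>Every function that occurs is, near each point, a function of one coordinate
  \<open>x j\<close>. Its series in one variable becomes a series over multi-indices supported on
  the multiples of the unit vector in direction \<open>j\<close>.\<close>

lemma real_analytic_on_coordI:
  assumes j: "j < 2"
    and f: "\<And>a. a \<in> S \<Longrightarrow> \<exists>r>0. \<exists>c. \<forall>x\<in>S. \<bar>x 0 - a 0\<bar> < r \<longrightarrow> \<bar>x 1 - a 1\<bar> < r \<longrightarrow>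
      ((\<lambda>n. c n * (x j - a j) ^ n) has_sum f x) (UNIV :: nat set)"
  shows "real_analytic_on 2 S f"
  unfolding real_analytic_on_def
proof
  fix a assume "a \<in> S"
  from f[OF this] obtain r c where r: "r > 0" and
    c: "\<And>x. x \<in> S \<Longrightarrow> \<bar>x 0 - a 0\<bar> < r \<Longrightarrow> \<bar>x 1 - a 1\<bar> < r \<Longrightarrow>
      ((\<lambda>n. c n * (x j - a j) ^ n) has_sum f x) UNIV" by blast
  \<comment> \<open>As the dimension is 2, \<open>1 - j\<close> is the index of the other
    coordinate.\<close>
  define coef where "coef = (\<lambda>\<alpha>::nat \<Rightarrow> nat. if \<alpha> (1 - j) = 0 then c (\<alpha> j) else 0)"
  define h where "h = (\<lambda>n i. if i = j then n else 0 :: nat)"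
  have "inj h"
  proof (rule injI)
    fix m n assume "h m = h n"
    from fun_cong[OF this, of j] show "m = n" by (simp add: h_def)
  qed
  have "((\<lambda>\<alpha>. coef \<alpha> * (\<Prod>i<2. (x i - a i) ^ \<alpha> i)) has_sum f x) {\<alpha>. \<forall>i\<ge>2. \<alpha> i = 0}"
    if x: "x \<in> S" "\<forall>i<2. \<bar>x i - a i\<bar> < r" for x
  proof -
    let ?F = "\<lambda>\<alpha>. coef \<alpha> * (\<Prod>i<2. (x i - a i) ^ \<alpha> i)"
    have Fh: "?F (h n) = c n * (x j - a j) ^ n" for n
    proof -
      have "j = 0 \<or> j = 1" using j by linarith
      then show ?thesis by (auto simp: coef_def h_def numeral_2_eq_2)
    qed
    have "((\<lambda>n. c n * (x j - a j) ^ n) has_sum f x) UNIV" using c x by simp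
    then have "((?F \<circ> h) has_sum f x) UNIV" by (simp add: o_def Fh)
    then have "(?F has_sum f x) (range h)" using has_sum_reindex[OF \<open>inj h\<close>] by blast
    \<comment> \<open>Multi-indices outside \<open>range h\<close> involve the other coordinate and
      have coefficient 0.\<close>
    moreover have "(?F has_sum f x) (range h) \<longleftrightarrow> (?F has_sum f x) {\<alpha>. \<forall>i\<ge>2. \<alpha> i = 0}"
    proof (rule has_sum_cong_neutral)
      fix \<alpha> assume \<alpha>: "\<alpha> \<in> {\<alpha>. \<forall>i\<ge>2. \<alpha> i = 0} - range h"
      have "\<alpha> (1 - j) \<noteq> 0"
      proof
        assume "\<alpha> (1 - j) = 0"
        have "\<alpha> i = h (\<alpha> j) i" for i
        proof (cases "i = j")
          case False
          then have "i = 1 - j \<or> 2 \<le> i" using j by linarith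
          then show ?thesis using False \<alpha> \<open>\<alpha> (1 - j) = 0\<close> by (auto simp: h_def)
        qed (simp add: h_def)
        then have "\<alpha> = h (\<alpha> j)" by (rule ext)
        with \<alpha> show False by blast
      qed
      then show "?F \<alpha> = 0" by (simp add: coef_def)
    next
      fix \<alpha> assume "\<alpha> \<in> range h - {\<alpha>. \<forall>i\<ge>2. \<alpha> i = 0}"
      then show "?F \<alpha> = 0" using j by (auto simp: h_def)
    qed simp
    ultimately show ?thesis by simp
  qed
  with r show "\<exists>r>0. \<exists>coef. \<forall>x\<in>S. (\<forall>i<2. \<bar>x i - a i\<bar> < r) \<longrightarrow>
    ((\<lambda>\<alpha>. coef \<alpha> * (\<Prod>i<2. (x i - a i) ^ \<alpha> i)) has_sum f x) {\<alpha>. \<forall>i\<ge>2. \<alpha> i = 0}" by blast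
qed

lemma has_sum_affine:
  "((\<lambda>n. (if n = 0 then a else if n = 1 then b else 0) * h ^ n) has_sum (a + b * h)) (UNIV :: nat set)"
  for a b h :: real
  by (rule has_sum_finite_neutralI[of "{0, 1}"]) auto

lemma transition_analytic:
  assumes "k < 2"
  shows "real_analytic_on 2 (chart_overlap (ch \<alpha> s) (ch \<beta> t))
    (\<lambda>x. transition (ch \<alpha> s) (ch \<beta> t) x k)"
proof (rule real_analytic_on_coordI[OF assms])
  let ?S = "chart_overlap (ch \<alpha> s) (ch \<beta> t)"
  fix a assume a: "a \<in> ?S"
  have S: "?S = {x \<in> hbox. unco \<alpha> s x \<in> cdom \<alpha> s \<inter> cdom \<beta> t}"
    using subchart_image[OF subchart_ch, of "cdom \<alpha> s \<inter> cdom \<beta> t"] by (simp add: chart_overlap_def)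
  have aS: "a \<in> hbox" "unco \<alpha> s a \<in> cdom \<beta> t" using a unfolding S by simp_all
  have tr: "transition (ch \<alpha> s) (ch \<beta> t) x k = coord \<beta> t (unco \<alpha> s x) k" if "x \<in> ?S" for x
    using transition_subchart[OF subchart_ch that] by simp
  obtain \<delta> where \<delta>: "\<delta> > 0" "\<And>y. \<bar>y 0 - a 0\<bar> < \<delta> \<Longrightarrow>
    coord \<beta> t (unco \<alpha> s y) 0 = coord \<beta> t (unco \<alpha> s a) 0 + (y 0 - a 0)"
    using transition_local[OF aS] by blast
  let ?b = "if k = 0 then 1 else sg s * sg t"
  have lin: "coord \<beta> t (unco \<alpha> s x) k = coord \<beta> t (unco \<alpha> s a) k + ?b * (x k - a k)"
    if "\<bar>x 0 - a 0\<bar> < \<delta>" for x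
  proof (cases "k = 0")
    case True
    then show ?thesis using \<delta>(2)[of x] that by simp
  next
    case False
    then have "k = 1" using \<open>k < 2\<close> by simp
    then show ?thesis by (auto simp: coord_of_unco ht_ht algebra_simps)
  qed
  have "((\<lambda>n. (if n = 0 then coord \<beta> t (unco \<alpha> s a) k else if n = 1 then ?b else 0) * (x k - a k) ^ n)
        has_sum transition (ch \<alpha> s) (ch \<beta> t) x k) UNIV"
    if "x \<in> ?S" "\<bar>x 0 - a 0\<bar> < \<delta>" for x
    unfolding tr[OF that(1)] lin[of x, OF that(2)] by (rule has_sum_affine)
  then show "\<exists>r>0. \<exists>c. \<forall>x\<in>?S. \<bar>x 0 - a 0\<bar> < r \<longrightarrow> \<bar>x 1 - a 1\<bar> < r \<longrightarrow>
      ((\<lambda>n. c n * (x k - a k) ^ n) has_sum transition (ch \<alpha> s) (ch \<beta> t) x k) UNIV"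
    by (intro exI[of _ \<delta>] conjI \<delta>(1)
        exI[of _ "\<lambda>n. if n = 0 then coord \<beta> t (unco \<alpha> s a) k else if n = 1 then ?b else 0"]
        ballI impI)
qed

lemma ball_atlas: "(\<forall>c\<in>{ch \<alpha> s |\<alpha> s. True}. P c) \<longleftrightarrow> (\<forall>\<alpha> s. P (ch \<alpha> s))"
  by blast

lemma cyl_covered: "(\<Union>c\<in>{ch \<alpha> s |\<alpha> s. True}. fst c) = cyl"
proof
  show "(\<Union>c\<in>{ch \<alpha> s |\<alpha> s. True}. fst c) \<subseteq> cyl"
    using cdom_subset by fastforce
  show "cyl \<subseteq> (\<Union>c\<in>{ch \<alpha> s |\<alpha> s. True}. fst c)"
  proof
    fix p assume "p \<in> cyl"
  then obtain t r where p: "p = pt (cis t) r" "0 \<le> r" "r \<le> hgt" by (rule cylE)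
  have "ang t (cis (t + 0)) < pi" by (subst ang_cis_add) auto
  \<comment> \<open>The chart is centred at the angle of \<open>p\<close>. It is of bottom type
    unless \<open>p\<close> lies on the top circle, which bottom charts omit.\<close>
  then have "p \<in> cdom t (r < hgt)"
    using p \<open>p \<in> cyl\<close> hgt_pos(1) by (simp add: cdom_def ht_def)
  then show "p \<in> (\<Union>c\<in>{ch \<alpha> s |\<alpha> s. True}. fst c)" using ch_simps(1) by blast
  qed
qed

lemma rev_mfd_analytic: "analytic_mfd_with_boundary (rev_mfd G)"
proof -
  have "homeomorphic_map (top_of_set (cdom \<alpha> s)) (top_of_set hbox) (coord \<alpha> s)" for \<alpha> s
    by (rule homeomorphic_map_coord)
  moreover have "subtopology (top_of_set cyl) (cdom \<alpha> s) = top_of_set (cdom \<alpha> s)" for \<alpha> s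
    using cdom_subset by (simp add: subtopology_subtopology Int_absorb1)
  moreover have "hbox \<subseteq> {x. 0 \<le> x 1 \<and> (\<forall>i\<ge>2. x i = 0)}" by (auto simp: hbox_def)
  then have "subtopology (half_space 2) hbox = top_of_set hbox"
    unfolding half_space_2 by (simp add: subtopology_subtopology Int_absorb1)
  moreover have "Hausdorff_space (top_of_set cyl)"
    by (simp add: Hausdorff_space_subtopology)
  ultimately show ?thesis
    unfolding analytic_mfd_with_boundary_def rev_mfd_simps ball_atlas ch_simps coord_image
      topspace_euclidean_subtopology
    by (intro conjI allI impI transition_analytic openin_cdom openin_hbox cyl_covered) simp_all
qed

lemma transition_jac_ch:
  assumes "p \<in> cdom \<alpha> s" "p \<in> cdom \<beta> t" "k < 2" "i < 2"
  shows "transition_jac (ch \<alpha> s) (ch \<beta> t) k i (coord \<alpha> s p) =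
    (if k \<noteq> i then 0 else if k = 0 then 1 else sg s * sg t)"
  by (rule transition_jac_subchart[OF subchart_ch])
    (use assms openin_cdom in \<open>auto simp: chart_overlap_def\<close>)

text \<open>\<open>G_ge_1\<close> and \<open>G_0\<close> put the ends at the minimum of the profile,
  and \<open>G_sym\<close> makes the charts from both ends interchangeable. The power series
  converge for every \<open>h\<close>, so that any radius serves in the proof of
  analyticity.\<close>

locale profile =
  fixes G G' :: "real \<Rightarrow> real"
  assumes G_deriv: "\<And>x. (G has_real_derivative G' x) (at x)"
    and G_ge_1: "\<And>x. 1 \<le> G x" and G_0: "G 0 = 1" and G_sym: "\<And>x. G (hgt - x) = G x"
    and G_analytic: "\<And>a. \<exists>c. \<forall>h. ((\<lambda>n. c n * h ^ n) has_sum G (a + h)) (UNIV :: nat set)"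
begin

lemma G_ht [simp]: "G (ht s r) = G r"
  by (cases s) (simp_all add: G_sym)

lemma metric_analytic: "analytic_metric (rev_mfd G)"
proof -
  have 1: "real_analytic_on 2 hbox (rev_metric G c i j)" if "i < 2" "j < 2" for c i j
  proof (cases "i = 0 \<and> j = 0")
    case True
    show ?thesis
    proof (rule real_analytic_on_coordI[of 1])
      fix a :: "nat \<Rightarrow> real" assume "a \<in> hbox"
      obtain c' where "\<And>h. ((\<lambda>n. c' n * h ^ n) has_sum G (a 1 + h)) UNIV" using G_analytic by blast
      from this[of "_ - a 1"] have "((\<lambda>n. c' n * (x 1 - a 1) ^ n) has_sum rev_metric G c i j x) UNIV" for x
        using True by (simp add: rev_metric_def)
      then show "\<exists>r>0. \<exists>c'. \<forall>x\<in>hbox. \<bar>x 0 - a 0\<bar> < r \<longrightarrow> \<bar>x 1 - a 1\<bar> < r \<longrightarrow>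
        ((\<lambda>n. c' n * (x 1 - a 1) ^ n) has_sum rev_metric G c i j x) UNIV"
        by (intro exI[of _ 1] conjI exI[of _ c'] ballI impI) simp_all
    qed simp
  next
    case False
    then have *: "rev_metric G c i j x = (if i = j then 1 else 0)" for x
      using that by (auto simp: rev_metric_def)
    show ?thesis
    proof (rule real_analytic_on_coordI[of 1])
      fix a :: "nat \<Rightarrow> real"
      let ?c = "if i = j then 1 else 0 :: real"
      have "((\<lambda>n. (if n = 0 then ?c else if n = 1 then 0 else 0) * h ^ n) has_sum ?c) UNIV" for h :: real
        using has_sum_affine[of ?c 0 h] by simp
      then show "\<exists>r>0. \<exists>c'. \<forall>x\<in>hbox. \<bar>x 0 - a 0\<bar> < r \<longrightarrow> \<bar>x 1 - a 1\<bar> < r \<longrightarrow>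
        ((\<lambda>n. c' n * (x 1 - a 1) ^ n) has_sum rev_metric G c i j x) UNIV"
        unfolding * by (intro exI[of _ 1] conjI ballI impI
            exI[of _ "\<lambda>n. if n = 0 then ?c else if n = 1 then 0 else 0"]) simp_all
    qed simp
  qed
  have 2: "0 < (\<Sum>i<2. \<Sum>j<2. rev_metric G c i j x * v i * v j)" if "\<exists>i<2. v i \<noteq> 0" for c x v
  proof -
    have "0 \<le> G (x 1) * (v 0 * v 0)" "v 0 \<noteq> 0 \<Longrightarrow> 0 < G (x 1) * (v 0 * v 0)"
      using G_ge_1[of "x 1"] by (auto simp: zero_less_mult_iff zero_le_mult_iff linorder_neq_iff)
    moreover have "0 \<le> v 1 * v 1" "v 1 \<noteq> 0 \<Longrightarrow> 0 < v 1 * v 1"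
      by (auto simp: zero_less_mult_iff linorder_neq_iff)
    moreover have "v 0 \<noteq> 0 \<or> v 1 \<noteq> 0" using that less_2_cases by auto
    ultimately have "0 < G (x 1) * (v 0 * v 0) + v 1 * v 1" by linarith
    then show ?thesis by (simp add: sum_less_2 rev_metric_def mult.assoc)
  qed
  have 3: "rev_metric G (ch \<alpha> s) i j x = (\<Sum>k<2. \<Sum>l<2.
      transition_jac (ch \<alpha> s) (ch \<beta> t) k i x * transition_jac (ch \<alpha> s) (ch \<beta> t) l j x *
      rev_metric G (ch \<beta> t) k l (transition (ch \<alpha> s) (ch \<beta> t) x))"
    if x: "x \<in> chart_overlap (ch \<alpha> s) (ch \<beta> t)" and ij: "i < 2" "j < 2" for x \<alpha> s \<beta> t i j
    using ij unfolding transition_subchart[OF subchart_ch x]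
    by (auto simp: sum_less_2 less_2_cases_iff transition_jac_subchart[OF subchart_ch _ x] openin_cdom
        rev_metric_def coord_of_unco sg_def)
  have 4: "rev_metric G c i j x = rev_metric G c j i x" for c i j x
    by (simp add: rev_metric_def)
  show ?thesis
    unfolding analytic_metric_def Let_def rev_mfd_simps ball_atlas ch_simps coord_image
  proof (intro conjI allI impI ballI)
    fix \<alpha> s \<beta> t x and i j :: nat
    assume "x \<in> chart_overlap (ch \<alpha> s) (ch \<beta> t)" "i < 2" "j < 2"
    then show "rev_metric G (ch \<alpha> s) i j x = (\<Sum>k<2. \<Sum>l<2.
      transition_jac (ch \<alpha> s) (ch \<beta> t) k i x * transition_jac (ch \<alpha> s) (ch \<beta> t) l j x *
      rev_metric G (ch \<beta> t) k l (transition (ch \<alpha> s) (ch \<beta> t) x))" by (rule 3)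
  qed (use 1 2 4 in blast)+
qed

lemma compact_analytic: "compact_analytic_riem_mfd (rev_mfd G)"
  using compact_cyl connected_cyl
  by (simp add: compact_analytic_riem_mfd_def rev_mfd_analytic metric_analytic
      compact_space_subtopology connected_space_subtopology)

end

section \<open>Tangent vectors and curves\<close>

lemma bex_atlas: "(\<exists>c\<in>{ch \<alpha> s |\<alpha> s. True}. P c) \<longleftrightarrow> (\<exists>\<alpha> s. P (ch \<alpha> s))"
  by blast

lemma hgt_nonzero [simp]: "hgt \<noteq> 0" "0 \<noteq> hgt"
  using hgt_pos(1) by linarith+

lemma bdry_rev_mfd: "bdry (rev_mfd G) = {p \<in> cyl. p 2 = 0 \<or> p 2 = hgt}"
proof (intro equalityI subsetI)
  fix p assume "p \<in> bdry (rev_mfd G)"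
  then obtain \<alpha> s where p: "p \<in> cdom \<alpha> s" "coord \<alpha> s p 1 = 0"
    unfolding bdry_def rev_mfd_simps bex_atlas by auto
  then show "p \<in> {p \<in> cyl. p 2 = 0 \<or> p 2 = hgt}"
    using cdom_subset by (cases s) (auto simp: coord_def)
next
  fix p assume p: "p \<in> {p \<in> cyl. p 2 = 0 \<or> p 2 = hgt}"
  then obtain c where c: "c \<in> {ch \<alpha> s |\<alpha> s. True}" "p \<in> fst c"
    using cyl_covered by (metis (no_types, lifting) UN_iff mem_Collect_eq)
  then obtain \<alpha> s where c': "c = ch \<alpha> s" "p \<in> cdom \<alpha> s" by auto
  then have "coord \<alpha> s p 1 = 0"
    using p by (cases s) (auto simp: coord_def cdom_def)
  with c'(2) show "p \<in> bdry (rev_mfd G)"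
    unfolding bdry_def rev_mfd_simps bex_atlas by auto
qed

text \<open>A chart omits the end circle far from it, so all charts around a boundary point orient
  the height in the same way.\<close>

lemma bdry_same_side:
  assumes "p \<in> bdry (rev_mfd G)" "p \<in> cdom \<alpha> s"
  shows "s \<longleftrightarrow> p 2 = 0"
  using assms by (cases s) (auto simp: cdom_def bdry_rev_mfd)

lemma chart_at_rev_mfd:
  assumes "p \<in> cyl"
  obtains \<alpha> s where "chart_at (rev_mfd G) p = ch \<alpha> s" "p \<in> cdom \<alpha> s"
proof -
  obtain c where "c \<in> {ch \<alpha> s |\<alpha> s. True}" "p \<in> fst c"
    using cyl_covered assms by (metis (no_types, lifting) UN_iff)
  then have "chart_at (rev_mfd G) p \<in> {ch \<alpha> s |\<alpha> s. True} \<and> p \<in> fst (chart_at (rev_mfd G) p)"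
    unfolding chart_at_def rev_mfd_simps by (intro someI[of "\<lambda>c. c \<in> {ch \<alpha> s |\<alpha> s. True} \<and> p \<in> fst c" c]) simp
  then show thesis using that by auto
qed

text \<open>\<open>b\<close> is the component of \<open>v\<close> with respect to \<open>r\<close>; a chart with \<open>\<not> s\<close> reverses its sign.\<close>

definition vec_at :: "(nat \<Rightarrow> real) \<Rightarrow> (nat \<Rightarrow> real) tvec \<Rightarrow> real \<Rightarrow> real \<Rightarrow> bool" where
  "vec_at p v w b \<longleftrightarrow> (\<forall>c. \<not> ((\<exists>\<alpha> s. c = ch \<alpha> s) \<and> p \<in> fst c) \<longrightarrow> v c = (\<lambda>_. 0)) \<and>
    (\<forall>\<alpha> s. p \<in> cdom \<alpha> s \<longrightarrow> v (ch \<alpha> s) 0 = w \<and> v (ch \<alpha> s) 1 = sg s * b \<and> (\<forall>k\<ge>2. v (ch \<alpha> s) k = 0))"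

lemma vec_at_outside:
  assumes "vec_at p v w b" "\<not> ((\<exists>\<alpha> s. c = ch \<alpha> s) \<and> p \<in> fst c)"
  shows "v c = (\<lambda>_. 0)"
  using assms(1)[unfolded vec_at_def, THEN conjunct1, THEN spec[of _ c]] assms(2) by (rule mp)

lemma vec_atD:
  assumes "vec_at p v w b" "p \<in> cdom \<alpha> s"
  shows "v (ch \<alpha> s) 0 = w" "v (ch \<alpha> s) 1 = sg s * b" "2 \<le> k \<Longrightarrow> v (ch \<alpha> s) k = 0"
  using assms(1)[unfolded vec_at_def, THEN conjunct2, THEN spec[of _ \<alpha>], THEN spec[of _ s]] assms(2)
  by simp_all

definition tangential :: "(nat \<Rightarrow> real) \<Rightarrow> real \<Rightarrow> (nat \<Rightarrow> real) tvec" where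
  "tangential p w = (\<lambda>c k. if (\<exists>\<alpha> s. c = ch \<alpha> s) \<and> p \<in> fst c \<and> k = 0 then w else 0)"

text \<open>Component 1 in all charts, whatever their orientation. This is a tangent vector at
  boundary points, where the charts agree on the orientation.\<close>

definition normal :: "(nat \<Rightarrow> real) \<Rightarrow> (nat \<Rightarrow> real) tvec" where
  "normal p = (\<lambda>c k. if (\<exists>\<alpha> s. c = ch \<alpha> s) \<and> p \<in> fst c \<and> k = 1 then 1 else 0)"

lemma vec_at_tangential: "vec_at p (tangential p w) w 0"
  by (auto simp: vec_at_def tangential_def)

lemma vec_at_normal:
  assumes "p \<in> bdry (rev_mfd G)"
  shows "vec_at p (normal p) 0 (sg (p 2 = 0))"
  using bdry_same_side[OF assms] by (auto simp: vec_at_def normal_def)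

lemma vec_at_unique:
  assumes "vec_at p v w b" "vec_at p v' w b"
  shows "v = v'"
proof (intro ext)
  fix c k
  show "v c k = v' c k"
  proof (cases "(\<exists>\<alpha> s. c = ch \<alpha> s) \<and> p \<in> fst c")
    case True
    then obtain \<alpha> s where c: "c = ch \<alpha> s" "p \<in> cdom \<alpha> s" by auto
    consider "k = 0" | "k = 1" | "2 \<le> k" by linarith
    then show ?thesis using assms[THEN vec_atD(1), OF c(2)] assms[THEN vec_atD(2), OF c(2)]
        assms[THEN vec_atD(3), OF c(2)] c(1) by cases simp_all
  next
    case False
    have "v c = (\<lambda>_. 0)" "v' c = (\<lambda>_. 0)" by (rule assms[THEN vec_at_outside, OF False])+
    then show ?thesis by simp
  qed
qed

context profile begin

lemma ginner_vec_at:
  assumes "p \<in> cyl" "vec_at p v w b" "vec_at p v' w' b'"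
  shows "ginner (rev_mfd G) p v v' = G (p 2) * w * w' + b * b'"
proof -
  obtain \<alpha> s where c: "chart_at (rev_mfd G) p = ch \<alpha> s" "p \<in> cdom \<alpha> s"
    using chart_at_rev_mfd[OF assms(1)] .
  have "v (ch \<alpha> s) 0 = w" "v' (ch \<alpha> s) 0 = w'" "v (ch \<alpha> s) 1 = sg s * b" "v' (ch \<alpha> s) 1 = sg s * b'"
    using vec_atD[OF assms(2) c(2)] vec_atD[OF assms(3) c(2)] by simp_all
  then show ?thesis
    by (simp add: ginner_def c sum_less_2 rev_metric_def coord_def sg_def)
qed

lemma tangent_space_rev_mfd:
  "v \<in> tangent_space (rev_mfd G) p \<longleftrightarrow>
    (\<forall>c. \<not> ((\<exists>\<alpha> s. c = ch \<alpha> s) \<and> p \<in> fst c) \<longrightarrow> v c = (\<lambda>_. 0)) \<and>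
    (\<forall>c k. 2 \<le> k \<longrightarrow> v c k = 0) \<and>
    (\<forall>\<alpha> s \<beta> t. p \<in> cdom \<alpha> s \<inter> cdom \<beta> t \<longrightarrow> (\<forall>k<2. v (ch \<beta> t) k =
      (\<Sum>i<2. transition_jac (ch \<alpha> s) (ch \<beta> t) k i (coord \<alpha> s p) * v (ch \<alpha> s) i)))"
  unfolding tangent_space_def rev_mfd_simps mem_Collect_eq ball_atlas ch_simps by simp

text \<open>The Jacobians are diagonal with entries 1 and \<open>sg s * sg t\<close>. As the signs
  square to 1, the numbers \<open>w\<close> and \<open>b\<close> read off in one chart are right in
  all others.\<close>

lemma tangent_space_vec_at:
  assumes "p \<in> cyl"
  shows "v \<in> tangent_space (rev_mfd G) p \<longleftrightarrow> (\<exists>w b. vec_at p v w b)"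
proof
  assume v: "v \<in> tangent_space (rev_mfd G) p"
  obtain \<alpha> s where c: "p \<in> cdom \<alpha> s"
    using chart_at_rev_mfd[OF assms] .
  have tr: "v (ch \<beta> t) k = (\<Sum>i<2. transition_jac (ch \<alpha> s) (ch \<beta> t) k i (coord \<alpha> s p) * v (ch \<alpha> s) i)"
    if "p \<in> cdom \<beta> t" "k < 2" for \<beta> t k
    using v c that unfolding tangent_space_rev_mfd by simp
  have "v (ch \<beta> t) 0 = v (ch \<alpha> s) 0" "v (ch \<beta> t) 1 = sg t * (sg s * v (ch \<alpha> s) 1)"
    if "p \<in> cdom \<beta> t" for \<beta> t
    using tr[OF that, of 0] tr[OF that, of 1] transition_jac_ch[OF c that]
    by (simp_all add: sum_less_2)
  moreover have "v c = (\<lambda>_. 0)" if "\<not> ((\<exists>\<alpha> s. c = ch \<alpha> s) \<and> p \<in> fst c)" for c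
    using v[unfolded tangent_space_rev_mfd, THEN conjunct1, THEN spec[of _ c]] that by (rule mp)
  moreover have "v c k = 0" if "2 \<le> k" for c k
    using v[unfolded tangent_space_rev_mfd, THEN conjunct2, THEN conjunct1, THEN spec[of _ c]] that
    by simp
  ultimately have "vec_at p v (v (ch \<alpha> s) 0) (sg s * v (ch \<alpha> s) 1)"
    unfolding vec_at_def by (intro conjI allI impI) assumption+
  then show "\<exists>w b. vec_at p v w b" by blast
next
  assume "\<exists>w b. vec_at p v w b"
  then obtain w b where v: "vec_at p v w b" by blast
  have 1: "v c = (\<lambda>_. 0)" if "\<not> ((\<exists>\<alpha> s. c = ch \<alpha> s) \<and> p \<in> fst c)" for c
    using vec_at_outside[OF v that] .
  have 2: "v c k = 0" if "2 \<le> k" for c k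
  proof (cases "(\<exists>\<alpha> s. c = ch \<alpha> s) \<and> p \<in> fst c")
    case True
    then obtain \<alpha> s where "c = ch \<alpha> s" "p \<in> cdom \<alpha> s" by auto
    then show ?thesis using vec_atD(3)[OF v] that by simp
  next
    case False
    then show ?thesis by (simp only: 1[OF False])
  qed
  have 3: "v (ch \<beta> t) k = (\<Sum>i<2. transition_jac (ch \<alpha> s) (ch \<beta> t) k i (coord \<alpha> s p) * v (ch \<alpha> s) i)"
    if "p \<in> cdom \<alpha> s" "p \<in> cdom \<beta> t" "k < 2" for \<alpha> s \<beta> t k
  proof -
    have "v (ch \<alpha> s) 0 = w" "v (ch \<alpha> s) 1 = sg s * b" "v (ch \<beta> t) 0 = w" "v (ch \<beta> t) 1 = sg t * b"
      using vec_atD[OF v that(1)] vec_atD[OF v that(2)] by simp_all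
    then show ?thesis
      using that less_2_cases[OF that(3)] by (auto simp: sum_less_2 transition_jac_ch)
  qed
  show "v \<in> tangent_space (rev_mfd G) p"
    unfolding tangent_space_rev_mfd using 1 2 3 by (intro conjI allI impI; (elim IntE)?) assumption+
qed

lemma bdry_tangent_space_eq:
  assumes "p \<in> bdry (rev_mfd G)"
  shows "bdry_tangent_space (rev_mfd G) p = range (tangential p)"
proof -
  have p: "p \<in> cyl" using assms by (simp add: bdry_rev_mfd)
  obtain \<alpha> s where c: "p \<in> cdom \<alpha> s" using chart_at_rev_mfd[OF p] .
  show ?thesis
  proof (intro equalityI subsetI)
    fix v assume v: "v \<in> bdry_tangent_space (rev_mfd G) p"
    then have "v \<in> tangent_space (rev_mfd G) p" by (simp add: bdry_tangent_space_def)
    then obtain w b where wb: "vec_at p v w b" using tangent_space_vec_at[OF p] by blast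
    have "v (ch \<alpha> s) 1 = 0"
      using v c unfolding bdry_tangent_space_def rev_mfd_simps ball_atlas by simp
    then have "b = 0" using vec_atD(2)[OF wb c] by (simp add: sg_def split: if_splits)
    then have "v = tangential p w" using vec_at_unique[OF _ vec_at_tangential] wb by simp
    then show "v \<in> range (tangential p)" by simp
  next
    fix v assume "v \<in> range (tangential p)"
    then obtain w where v: "v = tangential p w" by blast
    have "v \<in> tangent_space (rev_mfd G) p"
      using vec_at_tangential v tangent_space_vec_at[OF p] by blast
    then show "v \<in> bdry_tangent_space (rev_mfd G) p"
      by (simp add: bdry_tangent_space_def v tangential_def)
  qed
qed

lemma inward_normal_eq:
  assumes "p \<in> bdry (rev_mfd G)"
  shows "inward_normal (rev_mfd G) p = normal p"
  unfolding inward_normal_def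
proof (rule the_equality)
  have p: "p \<in> cyl" using assms by (simp_all add: bdry_rev_mfd)
  note n = vec_at_normal[OF assms]
  have "normal p \<in> tangent_space (rev_mfd G) p"
    using n tangent_space_vec_at[OF p] by blast
  moreover have "ginner (rev_mfd G) p (normal p) w = 0" if "w \<in> bdry_tangent_space (rev_mfd G) p" for w
    using that ginner_vec_at[OF p n vec_at_tangential] by (auto simp: bdry_tangent_space_eq[OF assms])
  moreover have "ginner (rev_mfd G) p (normal p) (normal p) = 1"
    using ginner_vec_at[OF p n n] by simp
  moreover have "0 < normal p c (mfd_dim (rev_mfd G) - 1)"
    if "c \<in> mfd_atlas (rev_mfd G)" "p \<in> fst c" for c
    using that by (auto simp: normal_def)
  ultimately show "normal p \<in> tangent_space (rev_mfd G) p \<and>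
    (\<forall>w\<in>bdry_tangent_space (rev_mfd G) p. ginner (rev_mfd G) p (normal p) w = 0) \<and>
    ginner (rev_mfd G) p (normal p) (normal p) = 1 \<and>
    (\<forall>c\<in>mfd_atlas (rev_mfd G). p \<in> fst c \<longrightarrow> 0 < normal p c (mfd_dim (rev_mfd G) - 1))"
    by simp
next
  have p: "p \<in> cyl" using assms by (simp_all add: bdry_rev_mfd)
  fix v assume v: "v \<in> tangent_space (rev_mfd G) p \<and>
    (\<forall>w\<in>bdry_tangent_space (rev_mfd G) p. ginner (rev_mfd G) p v w = 0) \<and>
    ginner (rev_mfd G) p v v = 1 \<and>
    (\<forall>c\<in>mfd_atlas (rev_mfd G). p \<in> fst c \<longrightarrow> 0 < v c (mfd_dim (rev_mfd G) - 1))"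
  then obtain w b where wb: "vec_at p v w b" using tangent_space_vec_at[OF p] by blast
  \<comment> \<open>Orthogonality to one nonzero tangent vector of the circle removes the angular
    part; unit length and the sign then fix the normal part.\<close>
  have "ginner (rev_mfd G) p v (tangential p 1) = 0"
    using v bdry_tangent_space_eq[OF assms] by blast
  then have w: "w = 0" using ginner_vec_at[OF p wb vec_at_tangential] G_ge_1[of "p 2"] by simp
  then have "b * b = 1" using v ginner_vec_at[OF p wb wb] by simp
  moreover obtain \<alpha> s where c: "p \<in> cdom \<alpha> s" using chart_at_rev_mfd[OF p] .
  have "0 < v (ch \<alpha> s) 1" using v c unfolding rev_mfd_simps ball_atlas by simp
  then have "0 < sg s * b" using vec_atD(2)[OF wb c] by simp
  ultimately have "b = sg s" by (auto simp: sg_def square_eq_1_iff split: if_splits)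
  then have "b = sg (p 2 = 0)" using bdry_same_side[OF assms c] by simp
  then show "v = normal p" using vec_at_unique[OF _ vec_at_normal[OF assms]] wb w by simp
qed

lemma bdry_proj_vec_at:
  assumes "p \<in> bdry (rev_mfd G)" "vec_at p v w b"
  shows "bdry_proj (rev_mfd G) (p, v) = (p, tangential p w)"
proof -
  have p: "p \<in> cyl" using assms by (simp_all add: bdry_rev_mfd)
  have i: "ginner (rev_mfd G) p v (normal p) = b * sg (p 2 = 0)"
    using ginner_vec_at[OF p assms(2) vec_at_normal[OF assms(1)]] by simp
  have "v c k - b * sg (p 2 = 0) * normal p c k = tangential p w c k" for c k
  proof (cases "(\<exists>\<alpha> s. c = ch \<alpha> s) \<and> p \<in> fst c")
    case True
    then obtain \<alpha> s where c: "c = ch \<alpha> s" "p \<in> cdom \<alpha> s" by auto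
    consider "k = 0" | "k = 1" | "2 \<le> k" by linarith
    then show ?thesis
      using vec_atD[OF assms(2) c(2)] c bdry_same_side[OF assms(1) c(2)]
      by cases (auto simp: normal_def tangential_def)
  next
    case False
    moreover have "v c = (\<lambda>_. 0)" using vec_at_outside[OF assms(2) False] .
    ultimately show ?thesis by (auto simp: normal_def tangential_def)
  qed
  then show ?thesis
    by (simp add: bdry_proj_def inward_normal_eq[OF assms(1)] i)
qed

end

section \<open>Lifts of curves to the strip covering the cylinder\<close>

text \<open>The function \<theta> is a real-valued angle along the curve, which does not jump at the
  cuts of the charts; \<open>w\<close> and \<open>v\<close> are the angular and the height velocity,
  one-sided at the ends of an interval. Total rotation, including full turns, is visible only in
  such a lift.\<close>

definition lifted ::
    "real set \<Rightarrow> (real \<Rightarrow> nat \<Rightarrow> real) \<Rightarrow> (real \<Rightarrow> real) \<Rightarrow> (real \<Rightarrow> real) \<Rightarrow> (real \<Rightarrow> real) \<Rightarrow> (real \<Rightarrow> real) \<Rightarrow> bool"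
  where "lifted I \<gamma> \<theta> r w v \<longleftrightarrow> (\<forall>t\<in>I. \<gamma> t = pt (cis (\<theta> t)) (r t) \<and> 0 \<le> r t \<and> r t \<le> hgt \<and>
    (\<theta> has_real_derivative w t) (at t within I) \<and> (r has_real_derivative v t) (at t within I))"

lemma liftedD:
  assumes "lifted I \<gamma> \<theta> r w v" "t \<in> I"
  shows "\<gamma> t = pt (cis (\<theta> t)) (r t)" "0 \<le> r t" "r t \<le> hgt"
    "(\<theta> has_real_derivative w t) (at t within I)" "(r has_real_derivative v t) (at t within I)"
  using assms by (auto simp: lifted_def)

lemma lifted_cont:
  assumes "lifted I \<gamma> \<theta> r w v"
  shows "continuous_on I \<theta>" "continuous_on I r" "continuous_on I \<gamma>" "\<gamma> \<in> I \<rightarrow> cyl"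
proof -
  show t: "continuous_on I \<theta>" and r: "continuous_on I r"
    using liftedD[OF assms] DERIV_continuous_on by blast+
  have "continuous_on I (\<lambda>t. pt (cis (\<theta> t)) (r t))"
    by (rule continuous_on_pt[OF continuous_on_cis[OF t] r])
  then show "continuous_on I \<gamma>"
    using liftedD(1)[OF assms] by (simp cong: continuous_on_cong)
  show "\<gamma> \<in> I \<rightarrow> cyl" using liftedD[OF assms] by simp
qed

text \<open>Chart domains are open, so near \<open>t\<close> a continuous curve stays in the chart.
  The derivatives within chart times, in which velocities are defined, thus become comparable
  between charts.\<close>

lemma at_chart_times:
  assumes "continuous_on I \<gamma>" "\<gamma> \<in> I \<rightarrow> cyl" "t \<in> chart_times I \<gamma> (ch \<alpha> s)"
  shows "at t within chart_times I \<gamma> (ch \<alpha> s) = at t within I"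
proof -
  have "openin (top_of_set I) (I \<inter> \<gamma> -` cdom \<alpha> s)"
    by (rule continuous_openin_preimage[OF assms(1,2) openin_cdom])
  then obtain T where T: "open T" "I \<inter> \<gamma> -` cdom \<alpha> s = I \<inter> T" by (auto simp: openin_open)
  have ct: "chart_times I \<gamma> (ch \<alpha> s) = I \<inter> T"
    using T(2) by (auto simp: chart_times_def)
  then have "t \<in> T" using assms(3) by blast
  then show ?thesis
    unfolding ct by (rule at_within_nhd[OF _ T(1)]) blast
qed

lemma deriv_within_Icc_unique:
  assumes "a < b" "t \<in> {a..b}" "(f has_real_derivative D) (at t within {a..b})"
    "(f has_real_derivative E) (at t within {a..b})"
  shows "D = E"
proof -
  note vd = vector_derivative_within_closed_interval[OF assms(1,2), of f]
  have "vector_derivative f (at t within {a..b}) = D"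
    using assms(3) unfolding has_real_derivative_iff_has_vector_derivative by (rule vd)
  moreover have "vector_derivative f (at t within {a..b}) = E"
    using assms(4) unfolding has_real_derivative_iff_has_vector_derivative by (rule vd)
  ultimately show ?thesis by simp
qed

lemma ang_cis_deriv:
  assumes "ang \<beta> (cis (\<alpha> + a)) < pi"
  shows "((\<lambda>u. ang \<beta> (cis (\<alpha> + u))) has_real_derivative 1) (at a)"
proof -
  obtain \<epsilon> where \<epsilon>: "\<epsilon> > 0"
    "\<And>u. \<bar>u - a\<bar> < \<epsilon> \<Longrightarrow> ang \<beta> (cis (\<alpha> + u)) = ang \<beta> (cis (\<alpha> + a)) + (u - a)"
    using ang_cis_local[OF assms] by blast
  have "((\<lambda>u. ang \<beta> (cis (\<alpha> + a)) + (u - a)) has_real_derivative 1) (at a)"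
    by (auto intro!: derivative_eq_intros)
  then show ?thesis
    by (rule has_field_derivative_transform_within[OF _ \<epsilon>(1)])
      (simp, rule \<epsilon>(2)[symmetric], simp add: dist_real_def)
qed

lemma ht_deriv:
  assumes "(r has_real_derivative v) F"
  shows "((\<lambda>u. ht s (r u)) has_real_derivative sg s * v) F"
  using assms by (cases s) (auto intro!: derivative_eq_intros simp: ht_def sg_def)

lemma coord_lifted_deriv:
  assumes l: "lifted I \<gamma> \<theta> r w v" and t: "t \<in> I" "\<gamma> t \<in> cdom \<alpha> s"
  shows "((\<lambda>u. coord \<alpha> s (\<gamma> u) 0) has_real_derivative w t) (at t within I)"
    and "((\<lambda>u. coord \<alpha> s (\<gamma> u) 1) has_real_derivative sg s * v t) (at t within I)"
proof -
  note L = liftedD[OF l]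
  have "ang \<alpha> (cis (0 + \<theta> t)) < pi" using t L by (simp add: cdom_def)
  from DERIV_chain'[OF L(4)[OF t(1)] ang_cis_deriv[OF this]]
  have "((\<lambda>u. ang \<alpha> (cis (\<theta> u))) has_real_derivative w t) (at t within I)" by simp
  then show "((\<lambda>u. coord \<alpha> s (\<gamma> u) 0) has_real_derivative w t) (at t within I)"
    by (rule has_field_derivative_transform_within[OF _ zero_less_one t(1)])
      (simp add: coord_def L(1))
  show "((\<lambda>u. coord \<alpha> s (\<gamma> u) 1) has_real_derivative sg s * v t) (at t within I)"
    by (rule has_field_derivative_transform_within[OF ht_deriv[OF L(5)[OF t(1)]] zero_less_one t(1)])
      (simp add: coord_def L(1))
qed

lemma velocity_lifted:
  assumes l: "lifted {a..b} \<gamma> \<theta> r w v" and ab: "a < b" and t: "t \<in> {a..b}"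
  shows "vec_at (\<gamma> t) (velocity (rev_mfd G) {a..b} \<gamma> t) (w t) (v t)"
proof -
  have *: "velocity (rev_mfd G) {a..b} \<gamma> t (ch \<alpha> s) 0 = w t \<and>
      velocity (rev_mfd G) {a..b} \<gamma> t (ch \<alpha> s) 1 = sg s * v t"
    if "\<gamma> t \<in> cdom \<alpha> s" for \<alpha> s
  proof -
    have "t \<in> chart_times {a..b} \<gamma> (ch \<alpha> s)" using t that by (simp add: chart_times_def)
    note at = at_chart_times[OF lifted_cont(3,4)[OF l] this]
    show ?thesis
      using that vector_derivative_within_closed_interval[OF ab t
          coord_lifted_deriv(1)[OF l t that, unfolded has_real_derivative_iff_has_vector_derivative]]
        vector_derivative_within_closed_interval[OF ab t
          coord_lifted_deriv(2)[OF l t that, unfolded has_real_derivative_iff_has_vector_derivative]]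
      by (auto simp: velocity_def at)
  qed
  show ?thesis
    unfolding vec_at_def
  proof (intro conjI allI impI)
    fix c assume "\<not> ((\<exists>\<alpha> s. c = ch \<alpha> s) \<and> \<gamma> t \<in> fst c)"
    then show "velocity (rev_mfd G) {a..b} \<gamma> t c = (\<lambda>_. 0)"
      unfolding velocity_def rev_mfd_simps by (intro ext if_not_P) blast
  qed (use * in \<open>simp_all add: velocity_def\<close>)
qed

lemma (in profile) speed_lifted:
  assumes "lifted {a..b} \<gamma> \<theta> r w v" "a < b" "t \<in> {a..b}"
  shows "speed (rev_mfd G) {a..b} \<gamma> t = sqrt (G (r t) * (w t)\<^sup>2 + (v t)\<^sup>2)"
proof -
  have "\<gamma> t \<in> cyl" using lifted_cont(4)[OF assms(1)] assms(3) by auto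
  from ginner_vec_at[OF this velocity_lifted[OF assms] velocity_lifted[OF assms]]
  show ?thesis
    unfolding speed_def using liftedD(1)[OF assms(1,3)] by (simp add: power2_eq_square mult.assoc)
qed

lemma C1_curve_lifted:
  assumes l: "lifted I \<gamma> \<theta> r w v" and c: "continuous_on I w" "continuous_on I v"
  shows "C1_curve_on (rev_mfd G) I \<gamma>"
proof -
  have "\<exists>V. continuous_on (chart_times I \<gamma> (ch \<alpha> s)) V \<and> (\<forall>t\<in>chart_times I \<gamma> (ch \<alpha> s).
      ((\<lambda>u. coord \<alpha> s (\<gamma> u) k) has_real_derivative V t) (at t within chart_times I \<gamma> (ch \<alpha> s)))"
    if "k < 2" for \<alpha> s k
  proof -
    let ?T = "chart_times I \<gamma> (ch \<alpha> s)"
    have T: "?T \<subseteq> I" "\<And>t. t \<in> ?T \<Longrightarrow> \<gamma> t \<in> cdom \<alpha> s" by (auto simp: chart_times_def)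
    have d: "((\<lambda>u. coord \<alpha> s (\<gamma> u) 0) has_real_derivative w t) (at t within ?T)"
      "((\<lambda>u. coord \<alpha> s (\<gamma> u) 1) has_real_derivative sg s * v t) (at t within ?T)" if "t \<in> ?T" for t
      using coord_lifted_deriv[OF l, of t \<alpha> s] that T has_field_derivative_subset[OF _ T(1)] by blast+
    have "continuous_on ?T w" "continuous_on ?T (\<lambda>t. sg s * v t)"
      using c T(1) by (auto intro!: continuous_intros continuous_on_subset[of I _ ?T])
    with d less_2_cases[OF that] show ?thesis by auto
  qed
  then show ?thesis
    unfolding C1_curve_on_def rev_mfd_simps ball_atlas
    using lifted_cont(3,4)[OF l] by simp
qed

lemma coord_components:
  "coord \<alpha> s p 0 = ang \<alpha> (zc p)" "coord \<alpha> s p 1 = ht s (p 2)"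
  by (simp_all add: coord_def)

text \<open>Transitions translate the angle locally, so all charts see the same angular velocity.
  This makes one velocity function along the whole curve possible.\<close>

lemma chart_curve_angle_deriv:
  assumes c: "continuous_on I \<gamma>" "\<gamma> \<in> I \<rightarrow> cyl" and t: "t \<in> I" "\<gamma> t \<in> cdom \<alpha> s" "\<gamma> t \<in> cdom \<beta> s'"
    and f: "((\<lambda>u. coord \<alpha> s (\<gamma> u) 0) has_real_derivative D) (at t within I)"
  shows "((\<lambda>u. coord \<beta> s' (\<gamma> u) 0) has_real_derivative D) (at t within I)"
proof -
  have z: "cis (\<alpha> + coord \<alpha> s (\<gamma> u) 0) = zc (\<gamma> u)" if "u \<in> I" for u
    unfolding coord_components using c(2) that by (intro cis_add_ang cyl_props(1)) blast
  have "ang \<beta> (cis (\<alpha> + coord \<alpha> s (\<gamma> t) 0)) < pi"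
    unfolding z[OF t(1)] using t(3) by (simp add: cdom_def)
  from DERIV_chain'[OF f ang_cis_deriv[OF this]]
  have "((\<lambda>u. ang \<beta> (cis (\<alpha> + coord \<alpha> s (\<gamma> u) 0))) has_real_derivative D) (at t within I)" by simp
  then show ?thesis
    by (rule has_field_derivative_transform_within[OF _ zero_less_one t(1)])
      (simp only: z, simp only: coord_components)
qed

lemma chart_curve_height_deriv:
  assumes "((\<lambda>u. coord \<alpha> s (\<gamma> u) 1) has_real_derivative D) (at t within I)"
  shows "((\<lambda>u. \<gamma> u 2) has_real_derivative sg s * D) (at t within I)"
  using ht_deriv[OF assms, of s] unfolding coord_components by simp

text \<open>A continuous angle is obtained by integrating the angular velocity, on which all charts
  agree. The hypothesis \<open>V\<close> is the common part of what C1 curves and geodesics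
  provide.\<close>

lemma chart_curve_lift:
  assumes ab: "a < b" and c: "continuous_on {a..b} \<gamma>" "\<gamma> \<in> {a..b} \<rightarrow> cyl"
    and V: "\<And>\<alpha> s. \<exists>V. \<forall>k<2. continuous_on (chart_times {a..b} \<gamma> (ch \<alpha> s)) (V k) \<and>
      (\<forall>t\<in>chart_times {a..b} \<gamma> (ch \<alpha> s). ((\<lambda>u. coord \<alpha> s (\<gamma> u) k) has_real_derivative V k t)
        (at t within chart_times {a..b} \<gamma> (ch \<alpha> s)))"
  obtains \<theta> r w v where "lifted {a..b} \<gamma> \<theta> r w v" "continuous_on {a..b} w" "continuous_on {a..b} v"
proof -
  let ?I = "{a..b}"
  let ?T = "\<lambda>\<alpha> s. chart_times {a..b} \<gamma> (ch \<alpha> s)"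
  define V where "V \<alpha> s = (SOME V. \<forall>k<2. continuous_on (?T \<alpha> s) (V k) \<and>
      (\<forall>t\<in>?T \<alpha> s. ((\<lambda>u. coord \<alpha> s (\<gamma> u) k) has_real_derivative V k t) (at t within ?T \<alpha> s)))" for \<alpha> s
  have V': "\<forall>k<2. continuous_on (?T \<alpha> s) (V \<alpha> s k) \<and> (\<forall>t\<in>?T \<alpha> s.
      ((\<lambda>u. coord \<alpha> s (\<gamma> u) k) has_real_derivative V \<alpha> s k t) (at t within ?T \<alpha> s))" for \<alpha> s
    unfolding V_def by (rule someI_ex[OF V])
  have V: "continuous_on (?T \<alpha> s) (V \<alpha> s k)"
    "t \<in> ?T \<alpha> s \<Longrightarrow> ((\<lambda>u. coord \<alpha> s (\<gamma> u) k) has_real_derivative V \<alpha> s k t) (at t within ?T \<alpha> s)"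
    if "k < 2" for \<alpha> s k t
    using V'[of \<alpha> s] that by simp_all
  have at: "at t within ?T \<alpha> s = at t within ?I" if "t \<in> ?T \<alpha> s" for t \<alpha> s
    by (rule at_chart_times[OF c that])
  have VI: "((\<lambda>u. coord \<alpha> s (\<gamma> u) k) has_real_derivative V \<alpha> s k t) (at t within ?I)"
    if "k < 2" "t \<in> ?T \<alpha> s" for k t \<alpha> s
    using V(2)[OF that] unfolding at[OF that(2)] .
  have T: "t \<in> ?T \<alpha> s \<longleftrightarrow> t \<in> ?I \<and> \<gamma> t \<in> cdom \<alpha> s" for t \<alpha> s
    by (simp add: chart_times_def)
  have chart: "\<exists>\<alpha> s. t \<in> ?T \<alpha> s" if "t \<in> ?I" for t
  proof -
    have "\<gamma> t \<in> cyl" using c(2) that by blast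
    then obtain \<alpha> s where "\<gamma> t \<in> cdom \<alpha> s" by (rule chart_at_rev_mfd)
    with that show ?thesis unfolding T by blast
  qed
  define w where "w t = (SOME D. \<forall>\<alpha> s. \<gamma> t \<in> cdom \<alpha> s \<longrightarrow>
    ((\<lambda>u. coord \<alpha> s (\<gamma> u) 0) has_real_derivative D) (at t within ?I))" for t
  have w: "((\<lambda>u. coord \<alpha> s (\<gamma> u) 0) has_real_derivative w t) (at t within ?I)"
    if "t \<in> ?T \<alpha> s" for \<alpha> s t
  proof -
    have tI: "t \<in> ?I" "\<gamma> t \<in> cdom \<alpha> s" using that T by simp_all
    have d: "((\<lambda>u. coord \<alpha> s (\<gamma> u) 0) has_real_derivative V \<alpha> s 0 t) (at t within ?I)"
      by (rule VI[OF _ that]) simp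
    have "\<exists>D. \<forall>\<beta> s'. \<gamma> t \<in> cdom \<beta> s' \<longrightarrow>
        ((\<lambda>u. coord \<beta> s' (\<gamma> u) 0) has_real_derivative D) (at t within ?I)"
      by (rule exI[of _ "V \<alpha> s 0 t"], intro allI impI, rule chart_curve_angle_deriv[OF c tI _ d])
    then have "\<forall>\<beta> s'. \<gamma> t \<in> cdom \<beta> s' \<longrightarrow>
        ((\<lambda>u. coord \<beta> s' (\<gamma> u) 0) has_real_derivative w t) (at t within ?I)"
      unfolding w_def by (rule someI_ex)
    with tI show ?thesis by blast
  qed
  define v where "v t = vector_derivative (\<lambda>u. \<gamma> u 2) (at t within ?I)" for t
  have r: "((\<lambda>u. \<gamma> u 2) has_real_derivative sg s * V \<alpha> s 1 t) (at t within ?I)"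
    if "t \<in> ?T \<alpha> s" for \<alpha> s t
    by (rule chart_curve_height_deriv[of \<alpha> s], rule VI[OF _ that]) simp
  have vV: "v t = sg s * V \<alpha> s 1 t" if "t \<in> ?T \<alpha> s" for \<alpha> s t
    unfolding v_def using r[OF that] that T
    by (intro vector_derivative_within_closed_interval[OF ab])
      (simp_all add: has_real_derivative_iff_has_vector_derivative)
  have wV: "w t = V \<alpha> s 0 t" if "t \<in> ?T \<alpha> s" for \<alpha> s t
  proof -
    have "t \<in> ?I" using that T by simp
    then show ?thesis
      by (rule deriv_within_Icc_unique[OF ab _ w[OF that]]) (rule VI[OF _ that], simp)
  qed
  \<comment> \<open>Continuity is local, and each time has a relatively open set of chart times
    around it on which \<open>f\<close> is a known continuous function.\<close>
  have cont: "continuous_on ?I f"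
    if loc: "\<And>\<alpha> s. \<exists>g. continuous_on (?T \<alpha> s) g \<and> (\<forall>t\<in>?T \<alpha> s. f t = g t)" for f :: "real \<Rightarrow> real"
    unfolding continuous_on_def
  proof
    fix t assume "t \<in> ?I"
    then obtain \<alpha> s where t: "t \<in> ?T \<alpha> s" using chart by blast
    obtain g where g: "continuous_on (?T \<alpha> s) g" "\<forall>t\<in>?T \<alpha> s. f t = g t" using loc[of \<alpha> s] by (elim exE conjE)
    then have "continuous_on (?T \<alpha> s) f" by (intro continuous_on_eq[OF g(1)]) simp
    then have "(f \<longlongrightarrow> f t) (at t within ?T \<alpha> s)"
      using t unfolding continuous_on_def by (rule bspec)
    then show "(f \<longlongrightarrow> f t) (at t within ?I)" unfolding at[OF t] .
  qed
  have cw: "continuous_on ?I w"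
  proof (rule cont)
    fix \<alpha> s
    show "\<exists>g. continuous_on (?T \<alpha> s) g \<and> (\<forall>t\<in>?T \<alpha> s. w t = g t)"
      by (rule exI[of _ "V \<alpha> s 0"]) (simp add: V(1) wV)
  qed
  have cv: "continuous_on ?I v"
  proof (rule cont)
    fix \<alpha> s
    show "\<exists>g. continuous_on (?T \<alpha> s) g \<and> (\<forall>t\<in>?T \<alpha> s. v t = g t)"
      by (rule exI[of _ "\<lambda>t. sg s * V \<alpha> s 1 t"]) (simp add: continuous_on_mult_left V(1) vV)
  qed
  define \<Theta> where "\<Theta> t = integral {a..t} w" for t
  have \<Theta>: "(\<Theta> has_real_derivative w t) (at t within ?I)" if "t \<in> ?I" for t
    unfolding \<Theta>_def by (rule integral_has_real_derivative[OF cw that])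
  \<comment> \<open>In any chart the argument of this product is the angle minus the integral of its
    derivative. So the product is constant, and \<open>\<Theta>\<close> is the angle up to an
    additive constant.\<close>
  have "((\<lambda>t. zc (\<gamma> t) * cis (- \<Theta> t)) has_derivative (\<lambda>h. 0)) (at t within ?I)" if t: "t \<in> ?I" for t
  proof -
    obtain \<alpha> s where s: "t \<in> ?T \<alpha> s" using chart t by blast
    have eq: "zc (\<gamma> u) * cis (- \<Theta> u) = cis (\<alpha> + coord \<alpha> s (\<gamma> u) 0 - \<Theta> u)" if "u \<in> ?I" for u
    proof -
      have "zc (\<gamma> u) = cis (\<alpha> + coord \<alpha> s (\<gamma> u) 0)"
        unfolding coord_components using c(2) that by (intro cis_add_ang[symmetric] cyl_props(1)) blast
      then show ?thesis by (simp add: cis_mult)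
    qed
    have "((\<lambda>u. \<alpha> + coord \<alpha> s (\<gamma> u) 0 - \<Theta> u) has_real_derivative 0) (at t within ?I)"
      using w[OF s] \<Theta>[OF t] by (auto intro!: derivative_eq_intros)
    then have "((\<lambda>u. \<alpha> + coord \<alpha> s (\<gamma> u) 0 - \<Theta> u) has_derivative (\<lambda>h. 0)) (at t within ?I)"
      unfolding has_field_derivative_def by (rule has_derivative_eq_rhs) auto
    then have "((\<lambda>u. cis (\<alpha> + coord \<alpha> s (\<gamma> u) 0 - \<Theta> u)) has_derivative (\<lambda>h. 0)) (at t within ?I)"
      by (rule has_derivative_eq_rhs[OF has_derivative_cis]) simp
    then show ?thesis
      by (rule has_derivative_transform_within[OF _ zero_less_one t]) (simp only: eq)
  qed
  from has_derivative_zero_constant[OF convex_real_interval(5) this]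
  obtain k where k: "\<And>t. t \<in> ?I \<Longrightarrow> zc (\<gamma> t) * cis (- \<Theta> t) = k" by blast
  have "\<gamma> a \<in> cyl" using c(2) ab by auto
  then obtain \<theta>0 r0 where "\<gamma> a = pt (cis \<theta>0) r0" by (rule cylE)
  then have k0: "k = cis \<theta>0" using k[of a] ab by (simp add: \<Theta>_def)
  have z: "zc (\<gamma> t) = cis (\<theta>0 + \<Theta> t)" if "t \<in> ?I" for t
  proof -
    have "zc (\<gamma> t) = zc (\<gamma> t) * (cis (- \<Theta> t) * cis (\<Theta> t))" by (simp add: cis_mult)
    also have "\<dots> = k * cis (\<Theta> t)" using k[OF that] by (simp add: mult.assoc[symmetric])
    finally show ?thesis by (simp add: k0 cis_mult)
  qed
  have "lifted ?I \<gamma> (\<lambda>t. \<theta>0 + \<Theta> t) (\<lambda>t. \<gamma> t 2) w v"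
    unfolding lifted_def
  proof (intro ballI conjI)
    fix t assume t: "t \<in> ?I"
    then have "\<gamma> t \<in> cyl" using c(2) by blast
    from cyl_props[OF this]
    show "\<gamma> t = pt (cis (\<theta>0 + \<Theta> t)) (\<gamma> t 2)" "0 \<le> \<gamma> t 2" "\<gamma> t 2 \<le> hgt"
      by (simp_all add: z[OF t, symmetric])
    show "((\<lambda>t. \<theta>0 + \<Theta> t) has_real_derivative w t) (at t within ?I)"
      using \<Theta>[OF t] by (auto intro!: derivative_eq_intros)
    obtain \<alpha> s where s: "t \<in> ?T \<alpha> s" using chart t by blast
    show "((\<lambda>t. \<gamma> t 2) has_real_derivative v t) (at t within ?I)"
      using r[OF s] vV[OF s] by simp
  qed
  from that[OF this cw cv] show thesis .
qed

lemma C1_curve_lift: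
  assumes "C1_curve_on (rev_mfd G) {a..b} \<gamma>" "a < b"
  obtains \<theta> r w v where "lifted {a..b} \<gamma> \<theta> r w v" "continuous_on {a..b} w" "continuous_on {a..b} v"
proof (rule chart_curve_lift[OF assms(2)])
  have c: "continuous_map (top_of_set {a..b}) (top_of_set cyl) \<gamma>"
    and V: "\<And>\<alpha> s. \<forall>k<2. \<exists>V. continuous_on (chart_times {a..b} \<gamma> (ch \<alpha> s)) V \<and>
      (\<forall>t\<in>chart_times {a..b} \<gamma> (ch \<alpha> s). ((\<lambda>u. coord \<alpha> s (\<gamma> u) k) has_real_derivative V t)
        (at t within chart_times {a..b} \<gamma> (ch \<alpha> s)))"
    using assms(1) unfolding C1_curve_on_def rev_mfd_simps ball_atlas ch_simps by simp_all
  from c show "continuous_on {a..b} \<gamma>" "\<gamma> \<in> {a..b} \<rightarrow> cyl" by simp_all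
  fix \<alpha> s
  show "\<exists>V. \<forall>k<2. continuous_on (chart_times {a..b} \<gamma> (ch \<alpha> s)) (V k) \<and>
      (\<forall>t\<in>chart_times {a..b} \<gamma> (ch \<alpha> s). ((\<lambda>u. coord \<alpha> s (\<gamma> u) k) has_real_derivative V k t)
        (at t within chart_times {a..b} \<gamma> (ch \<alpha> s)))"
    using V[of \<alpha> s] by (rule choice_iff'[THEN iffD1])
qed (rule that)

section \<open>Distances\<close>

text \<open>
  \<open>qf G p\<close> is \<open>dr/dt\<close> along a rising geodesic with Clairaut constant \<open>p\<close>; on its way from height \<open>0\<close> to \<open>r\<close> it
  has length \<open>Af G p r\<close> and rotates by the angle \<open>Bf G p r\<close>.
\<close>

definition qf :: "(real \<Rightarrow> real) \<Rightarrow> real \<Rightarrow> real \<Rightarrow> real" where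
  "qf G p x = sqrt (1 - p\<^sup>2 / G x)"

definition Qf :: "(real \<Rightarrow> real) \<Rightarrow> real \<Rightarrow> real \<Rightarrow> real" where
  "Qf G p r = integral {0..r} (qf G p)"

definition Af :: "(real \<Rightarrow> real) \<Rightarrow> real \<Rightarrow> real \<Rightarrow> real" where
  "Af G p r = integral {0..r} (\<lambda>x. 1 / qf G p x)"

definition Bf :: "(real \<Rightarrow> real) \<Rightarrow> real \<Rightarrow> real \<Rightarrow> real" where
  "Bf G p r = integral {0..r} (\<lambda>x. p / (G x * qf G p x))"

text \<open>For unit complex numbers, the length of the shorter arc between them.\<close>

definition adist :: "complex \<Rightarrow> complex \<Rightarrow> real" where
  "adist z z' = \<bar>Arg (z' / z)\<bar>"

lemma abs_Arg_cis_le: "\<bar>Arg (cis t)\<bar> \<le> \<bar>t\<bar>"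
proof (cases "- pi < t \<and> t \<le> pi")
  case True
  then show ?thesis by (simp add: Arg_cis)
next
  case False
  then have "pi \<le> \<bar>t\<bar>" by linarith
  then show ?thesis using Arg_bounded[of "cis t"] by linarith
qed

text \<open>Velocities are derivatives within the interval on which the curve is considered. Inside
  a subinterval the choice makes no difference, but at its ends it may, since a piecewise C1 curve
  can have corners there.\<close>

lemma speed_subinterval:
  assumes "{a..b} \<subseteq> {c..d}" "a < t" "t < b"
  shows "speed M {c..d} \<gamma> t = speed M {a..b} \<gamma> t"
proof -
  have eq: "at t within chart_times {c..d} \<gamma> e = at t within chart_times {a..b} \<gamma> e" for e
    by (rule at_within_nhd[of _ "{a<..<b}"]) (use assms in \<open>auto simp: chart_times_def\<close>)
  have "velocity M {c..d} \<gamma> t = velocity M {a..b} \<gamma> t"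
    unfolding velocity_def eq by (rule refl)
  then show ?thesis by (simp add: speed_def)
qed

section \<open>Lower bounds for lengths by calibration\<close>

context profile begin

lemma G_pos [simp]: "0 < G x" "G x \<noteq> 0"
  using G_ge_1[of x] by linarith+

lemma continuous_on_G [continuous_intros]: "continuous_on S G"
  by (meson DERIV_continuous_on G_deriv has_field_derivative_at_within)

lemma p2_G:
  "0 \<le> p\<^sup>2 / G x" "\<bar>p\<bar> \<le> 1 \<Longrightarrow> p\<^sup>2 / G x \<le> 1" "\<bar>p\<bar> < 1 \<Longrightarrow> p\<^sup>2 / G x < 1"
proof -
  show "0 \<le> p\<^sup>2 / G x" by (simp add: less_imp_le)
  show "p\<^sup>2 / G x \<le> 1" if "\<bar>p\<bar> \<le> 1"
    using that abs_square_le_1[of p] G_ge_1[of x] by (simp add: divide_le_eq)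
  show "p\<^sup>2 / G x < 1" if "\<bar>p\<bar> < 1"
    using that abs_square_less_1[of p] G_ge_1[of x] by (simp add: divide_less_eq)
qed

lemma qf_bounds: "qf G p x \<le> 1" "\<bar>p\<bar> < 1 \<Longrightarrow> 0 < qf G p x" "\<bar>p\<bar> \<le> 1 \<Longrightarrow> 0 \<le> qf G p x"
  using p2_G[of p x] by (simp_all add: qf_def)

lemma qf_square: "\<bar>p\<bar> \<le> 1 \<Longrightarrow> (qf G p x)\<^sup>2 = 1 - p\<^sup>2 / G x"
  using p2_G[of p x] by (simp add: qf_def)

lemma G_qf_square: "\<bar>p\<bar> \<le> 1 \<Longrightarrow> G x * (qf G p x)\<^sup>2 = G x - p\<^sup>2"
  by (simp add: qf_square field_simps)

lemma qf_ht [simp]: "qf G p (ht s x) = qf G p x"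
  by (simp add: qf_def)

lemma continuous_on_qf [continuous_intros]: "continuous_on S (qf G p)"
  unfolding qf_def by (intro continuous_intros) simp

lemma Qf_deriv:
  "r \<in> {0..hgt} \<Longrightarrow> (Qf G p has_real_derivative qf G p r) (at r within {0..hgt})"
  unfolding Qf_def[abs_def] by (rule integral_has_real_derivative[OF continuous_on_qf])

lemma continuous_on_Af:
  assumes "\<bar>p\<bar> < 1" shows "continuous_on S (\<lambda>x. 1 / qf G p x)"
proof -
  have "qf G p x \<noteq> 0" for x using qf_bounds(2)[OF assms, of x] by simp
  then show ?thesis by (intro continuous_intros) simp
qed

lemma continuous_on_Bf:
  assumes "\<bar>p\<bar> < 1" shows "continuous_on S (\<lambda>x. p / (G x * qf G p x))"
proof -
  have "qf G p x \<noteq> 0" for x using qf_bounds(2)[OF assms, of x] by simp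
  then show ?thesis by (intro continuous_intros) simp
qed

lemma Af_deriv:
  "\<bar>p\<bar> < 1 \<Longrightarrow> r \<in> {0..hgt} \<Longrightarrow> (Af G p has_real_derivative 1 / qf G p r) (at r within {0..hgt})"
  unfolding Af_def[abs_def] by (rule integral_has_real_derivative[OF continuous_on_Af])

lemma Bf_deriv:
  "\<bar>p\<bar> < 1 \<Longrightarrow> r \<in> {0..hgt} \<Longrightarrow> (Bf G p has_real_derivative p / (G r * qf G p r)) (at r within {0..hgt})"
  unfolding Bf_def[abs_def] by (rule integral_has_real_derivative[OF continuous_on_Bf])

text \<open>Pointwise this is \<open>1 - qf^2 = p^2 / G\<close>, divided by \<open>qf\<close>. The
  right-hand side is the integral of the calibrating form along the geodesic and the left-hand side
  its length, so the lower bound from the calibration is sharp.\<close>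

lemma Af_eq:
  assumes "\<bar>p\<bar> < 1"
  shows "Af G p r = p * Bf G p r + Qf G p r"
proof -
  have "1 / qf G p x = p * (p / (G x * qf G p x)) + qf G p x" for x
  proof -
    have "0 < qf G p x" by (rule qf_bounds(2)[OF assms])
    moreover have "G x * (qf G p x)\<^sup>2 = G x - p\<^sup>2" using assms by (intro G_qf_square) simp
    ultimately show ?thesis by (simp add: field_simps power2_eq_square)
  qed
  then have "Af G p r = integral {0..r} (\<lambda>x. p * (p / (G x * qf G p x)) + qf G p x)"
    unfolding Af_def by presburger
  also have "\<dots> = p * Bf G p r + Qf G p r"
    unfolding Bf_def Qf_def
    by (subst integral_add)
      (intro integrable_continuous_real continuous_on_mult_left continuous_on_Bf[OF assms]
        continuous_on_qf, intro integrable_continuous_real continuous_on_qf, simp only: integral_mult_right)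
  finally show ?thesis .
qed

text \<open>The form \<open>p d\<theta> + \<sigma> qf dr\<close> has norm \<open>1\<close>, so it calibrates the geodesics with Clairaut constant \<open>p\<close>.\<close>

lemma calibration:
  assumes "\<bar>p\<bar> \<le> 1"
  shows "p * w + qf G p x * v \<le> sqrt (G x * w\<^sup>2 + v\<^sup>2)"
proof (rule real_le_rsqrt)
  \<comment> \<open>The deficit in the Cauchy-Schwarz inequality, multiplied by \<open>G x\<close>,
    is a perfect square.\<close>
  have "G x * (G x * w\<^sup>2 + v\<^sup>2 - (p * w + qf G p x * v)\<^sup>2) = (G x * qf G p x * w - p * v)\<^sup>2"
    using G_qf_square[OF assms, of x] by algebra
  then have "0 \<le> G x * (G x * w\<^sup>2 + v\<^sup>2 - (p * w + qf G p x * v)\<^sup>2)" by simp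
  then show "(p * w + qf G p x * v)\<^sup>2 \<le> G x * w\<^sup>2 + v\<^sup>2"
    using mult_le_cancel_left_pos[OF G_pos(1)[of x], of 0] by simp
qed

text \<open>On the strip the form has the primitive
  \<open>p * \<theta> + \<sigma> * Qf G p r\<close>, so its integral along a curve depends only on
  the ends of the lift. The sign \<open>\<sigma>\<close> serves curves going up and curves going
  down.\<close>

lemma piece_bound:
  assumes l: "lifted {a..b} \<gamma> \<theta> r w v" "continuous_on {a..b} w" "continuous_on {a..b} v"
    and ab: "a < b" and p: "\<bar>p\<bar> \<le> 1" and \<sigma>: "\<bar>\<sigma>\<bar> = 1"
  shows "speed (rev_mfd G) {a..b} \<gamma> integrable_on {a..b}"
    and "p * (\<theta> b - \<theta> a) + \<sigma> * (Qf G p (r b) - Qf G p (r a)) \<le> integral {a..b} (speed (rev_mfd G) {a..b} \<gamma>)"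
proof -
  let ?f = "\<lambda>t. sqrt (G (r t) * (w t)\<^sup>2 + (v t)\<^sup>2)"
  have cr: "continuous_on {a..b} (\<lambda>t. G (r t))"
    by (rule continuous_on_compose2[OF continuous_on_G[of UNIV] lifted_cont(2)[OF l(1)]]) simp
  have "continuous_on {a..b} ?f" by (intro continuous_intros cr l(2,3))
  then have f: "?f integrable_on {a..b}" by (rule integrable_continuous_real)
  have sp: "?f t = speed (rev_mfd G) {a..b} \<gamma> t" if "t \<in> {a..b}" for t
    using speed_lifted[OF l(1) ab that] by simp
  show int: "speed (rev_mfd G) {a..b} \<gamma> integrable_on {a..b}"
    by (rule integrable_eq[OF f sp])
  have d: "((\<lambda>t. p * \<theta> t + \<sigma> * Qf G p (r t)) has_real_derivative p * w t + \<sigma> * (qf G p (r t) * v t))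
      (at t within {a..b})" if t: "t \<in> {a..b}" for t
  proof -
    have "r ` {a..b} \<subseteq> {0..hgt}" using liftedD(2,3)[OF l(1)] by auto
    then have "(Qf G p has_real_derivative qf G p (r t)) (at (r t) within r ` {a..b})"
      using Qf_deriv[of "r t" p] t has_field_derivative_subset by blast
    then have "(Qf G p \<circ> r has_real_derivative qf G p (r t) * v t) (at t within {a..b})"
      using liftedD(5)[OF l(1) t] by (rule DERIV_image_chain)
    then show ?thesis
      using liftedD(4)[OF l(1) t] unfolding o_def by (auto intro!: derivative_eq_intros)
  qed
  have "((\<lambda>t. p * w t + \<sigma> * (qf G p (r t) * v t)) has_integral
      (p * \<theta> b + \<sigma> * Qf G p (r b)) - (p * \<theta> a + \<sigma> * Qf G p (r a))) {a..b}"
    by (rule fundamental_theorem_of_calculus)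
      (use ab d in \<open>simp_all add: has_real_derivative_iff_has_vector_derivative[symmetric]\<close>)
  moreover have "(speed (rev_mfd G) {a..b} \<gamma> has_integral integral {a..b} (speed (rev_mfd G) {a..b} \<gamma>)) {a..b}"
    using int by (rule integrable_integral)
  ultimately have "(p * \<theta> b + \<sigma> * Qf G p (r b)) - (p * \<theta> a + \<sigma> * Qf G p (r a))
      \<le> integral {a..b} (speed (rev_mfd G) {a..b} \<gamma>)"
  proof (rule has_integral_le)
    fix t assume t: "t \<in> {a..b}"
    have "\<sigma>\<^sup>2 = 1" using \<sigma> by (metis power2_abs one_power2)
    then have "(\<sigma> * v t)\<^sup>2 = (v t)\<^sup>2" by (simp add: power_mult_distrib)
    then show "p * w t + \<sigma> * (qf G p (r t) * v t) \<le> speed (rev_mfd G) {a..b} \<gamma> t"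
      using calibration[OF p, of "w t" "r t" "\<sigma> * v t"] unfolding sp[OF t, symmetric]
      by (simp add: mult.left_commute)
  qed
  then show "p * (\<theta> b - \<theta> a) + \<sigma> * (Qf G p (r b) - Qf G p (r a)) \<le> integral {a..b} (speed (rev_mfd G) {a..b} \<gamma>)"
    by (simp add: algebra_simps)
qed

text \<open>The total rotation belongs to the curve and is obtained before \<open>p\<close> and
  \<open>\<sigma>\<close> are chosen, so that bounds with different signs refer to the same angle
  and can be combined.\<close>

lemma length_lower_lift:
  assumes "piecewise_C1_curve (rev_mfd G) \<gamma>"
  obtains \<theta> where "zc (\<gamma> 1) = zc (\<gamma> 0) * cis \<theta>"
    "\<forall>p \<sigma>. \<bar>p\<bar> \<le> 1 \<longrightarrow> \<bar>\<sigma>\<bar> = 1 \<longrightarrow>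
      p * \<theta> + \<sigma> * (Qf G p (\<gamma> 1 2) - Qf G p (\<gamma> 0 2)) \<le> curve_length (rev_mfd G) \<gamma>"
proof -
  let ?s = "speed (rev_mfd G) {0..1} \<gamma>"
  obtain m and t :: "nat \<Rightarrow> real" where t: "t 0 = 0" "t m = 1" "\<And>i. i < m \<Longrightarrow> t i < t (Suc i)"
    "\<And>i. i < m \<Longrightarrow> C1_curve_on (rev_mfd G) {t i..t (Suc i)} \<gamma>"
    using assms unfolding piecewise_C1_curve_def by auto
  have t0: "0 \<le> t i" if "i \<le> m" for i
    using that by (induction i) (use t in \<open>simp_all add: less_eq_Suc_le order.trans[OF _ less_imp_le]\<close>)
  have t1: "t i \<le> 1" if "i \<le> m" for i
    using that
  proof (induction rule: inc_induct)
    case (step n)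
    then show ?case using t(3)[of n] by linarith
  qed (simp add: t(2))
  \<comment> \<open>Integrability and the bound are proved together along the break points, because
    additivity of the integral needs integrability on the initial part.\<close>
  have "?s integrable_on {0..t i} \<and> (\<exists>\<theta>. zc (\<gamma> (t i)) = zc (\<gamma> 0) * cis \<theta> \<and>
      (\<forall>p \<sigma>. \<bar>p\<bar> \<le> 1 \<longrightarrow> \<bar>\<sigma>\<bar> = 1 \<longrightarrow>
        p * \<theta> + \<sigma> * (Qf G p (\<gamma> (t i) 2) - Qf G p (\<gamma> 0 2)) \<le> integral {0..t i} ?s))" if "i \<le> m" for i
    using that
  proof (induction i)
    case 0
    show ?case using integrable_on_refl[of ?s 0] by (auto simp: t(1) intro!: exI[of _ 0])
  next
    case (Suc i)
    let ?a = "t i" and ?b = "t (Suc i)"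
    have i: "i < m" using Suc.prems by simp
    obtain \<theta> where int: "?s integrable_on {0..?a}" and \<theta>: "zc (\<gamma> ?a) = zc (\<gamma> 0) * cis \<theta>"
      "\<And>p \<sigma>. \<bar>p\<bar> \<le> 1 \<Longrightarrow> \<bar>\<sigma>\<bar> = 1 \<Longrightarrow>
        p * \<theta> + \<sigma> * (Qf G p (\<gamma> ?a 2) - Qf G p (\<gamma> 0 2)) \<le> integral {0..?a} ?s"
      using Suc i by auto
    note ab = t(3)[OF i]
    obtain th r w v where l: "lifted {?a..?b} \<gamma> th r w v" "continuous_on {?a..?b} w" "continuous_on {?a..?b} v"
      using t(4)[OF i] ab by (rule C1_curve_lift)
    have sub: "{?a..?b} \<subseteq> {0..1}" using t0[of i] t1[of "Suc i"] i by simp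
    \<comment> \<open>At the break points the two speeds may differ; two points do not affect the
      integral.\<close>
    have sp: "?s u = speed (rev_mfd G) {?a..?b} \<gamma> u" if "u \<in> {?a..?b} - {?a, ?b}" for u
      using that by (intro speed_subinterval[OF sub]) auto
    note pb = piece_bound[OF l ab]
    have int2: "?s integrable_on {?a..?b}"
      \<comment> \<open>The values 0 and 1 for \<open>p\<close> and \<open>\<sigma>\<close> are an
        arbitrary admissible choice.\<close>
      by (rule integrable_spike_finite[of "{?a, ?b}", OF _ sp pb(1)[of 0 1]]) simp_all
    have eq2: "integral {?a..?b} ?s = integral {?a..?b} (speed (rev_mfd G) {?a..?b} \<gamma>)"
      by (rule integral_spike[of "{?a, ?b}"]) (use sp in auto)
    have a0: "0 \<le> ?a" "?a \<le> ?b" using t0[of i] i ab by simp_all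
    have int3: "?s integrable_on {0..?b}" by (rule Henstock_Kurzweil_Integration.integrable_combine[OF a0 int int2])
    have sum: "integral {0..?b} ?s = integral {0..?a} ?s + integral {?a..?b} (speed (rev_mfd G) {?a..?b} \<gamma>)"
      using Henstock_Kurzweil_Integration.integral_combine[OF a0 int3] eq2 by simp
    have ga: "\<gamma> ?a = pt (cis (th ?a)) (r ?a)" and gb: "\<gamma> ?b = pt (cis (th ?b)) (r ?b)"
      using liftedD(1)[OF l(1)] ab by simp_all
    have "zc (\<gamma> ?b) = zc (\<gamma> 0) * cis (\<theta> + (th ?b - th ?a))"
    proof -
      have "zc (\<gamma> ?b) = cis (th ?a) * cis (th ?b - th ?a)" by (simp add: gb cis_mult)
      also have "cis (th ?a) = zc (\<gamma> 0) * cis \<theta>" using \<theta>(1) ga by simp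
      finally show ?thesis by (simp add: cis_mult mult.assoc)
    qed
    moreover have "p * (\<theta> + (th ?b - th ?a)) + \<sigma> * (Qf G p (\<gamma> ?b 2) - Qf G p (\<gamma> 0 2)) \<le> integral {0..?b} ?s"
      if "\<bar>p\<bar> \<le> 1" "\<bar>\<sigma>\<bar> = 1" for p \<sigma>
      using \<theta>(2)[OF that] pb(2)[OF that] unfolding sum by (simp add: ga gb algebra_simps)
    ultimately show ?case using int3 by (intro conjI exI[of _ "\<theta> + (th ?b - th ?a)"]) simp_all
  qed
  from this[of m] t(2) show thesis
    using that unfolding curve_length_def by auto
qed

text \<open>The four choices of signs for \<open>p\<close> and \<open>\<sigma>\<close> on one lift
  produce both absolute values, as \<open>Qf\<close> is even in \<open>p\<close>. The rotation of a
  lift is at least the angular distance, with \<open>p \<ge> 0\<close> as its weight.\<close>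

lemma length_lower:
  assumes "piecewise_C1_curve (rev_mfd G) \<gamma>" "0 \<le> p" "p \<le> 1" "zc (\<gamma> 0) \<noteq> 0"
  shows "p * adist (zc (\<gamma> 0)) (zc (\<gamma> 1)) + \<bar>Qf G p (\<gamma> 1 2) - Qf G p (\<gamma> 0 2)\<bar>
    \<le> curve_length (rev_mfd G) \<gamma>"
proof -
  obtain \<theta> where \<theta>: "zc (\<gamma> 1) = zc (\<gamma> 0) * cis \<theta>"
    "\<forall>p \<sigma>. \<bar>p\<bar> \<le> 1 \<longrightarrow> \<bar>\<sigma>\<bar> = 1 \<longrightarrow>
      p * \<theta> + \<sigma> * (Qf G p (\<gamma> 1 2) - Qf G p (\<gamma> 0 2)) \<le> curve_length (rev_mfd G) \<gamma>"
    using length_lower_lift[OF assms(1)] .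
  have "adist (zc (\<gamma> 0)) (zc (\<gamma> 1)) \<le> \<bar>\<theta>\<bar>"
    using abs_Arg_cis_le[of \<theta>] assms(4) by (simp add: adist_def \<theta>(1))
  then have a: "p * adist (zc (\<gamma> 0)) (zc (\<gamma> 1)) \<le> p * \<bar>\<theta>\<bar>" using assms(2) by (rule mult_left_mono)
  have Q: "Qf G (- p) = Qf G p" by (simp add: Qf_def fun_eq_iff qf_def[abs_def])
  have p: "\<bar>p\<bar> \<le> 1" "\<bar>-p\<bar> \<le> 1" using assms by simp_all
  let ?d = "Qf G p (\<gamma> 1 2) - Qf G p (\<gamma> 0 2)"
  have b: "p * \<theta> + 1 * ?d \<le> curve_length (rev_mfd G) \<gamma>" "p * \<theta> + (-1) * ?d \<le> curve_length (rev_mfd G) \<gamma>"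
    "(-p) * \<theta> + 1 * ?d \<le> curve_length (rev_mfd G) \<gamma>" "(-p) * \<theta> + (-1) * ?d \<le> curve_length (rev_mfd G) \<gamma>"
    using \<theta>(2)[rule_format, OF p(1), of 1] \<theta>(2)[rule_format, OF p(1), of "-1"]
      \<theta>(2)[rule_format, OF p(2), of 1] \<theta>(2)[rule_format, OF p(2), of "-1"]
    unfolding Q by simp_all
  have "p * \<bar>\<theta>\<bar> + \<bar>?d\<bar> \<le> curve_length (rev_mfd G) \<gamma>"
    using b by (cases "0 \<le> \<theta>"; cases "0 \<le> ?d") simp_all
  with a show ?thesis by linarith
qed

section \<open>Distances from explicit curves\<close>

lemma lifted_piecewise_C1:
  assumes "lifted {0..1} \<gamma> \<theta> r w v" "continuous_on {0..1} w" "continuous_on {0..1} v"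
  shows "piecewise_C1_curve (rev_mfd G) \<gamma>"
    "curve_length (rev_mfd G) \<gamma> = integral {0..1} (\<lambda>t. sqrt (G (r t) * (w t)\<^sup>2 + (v t)\<^sup>2))"
proof -
  have "C1_curve_on (rev_mfd G) {0..1} \<gamma>" by (rule C1_curve_lifted[OF assms])
  then show "piecewise_C1_curve (rev_mfd G) \<gamma>"
    unfolding piecewise_C1_curve_def using lifted_cont(3,4)[OF assms(1)]
    \<comment> \<open>A single piece: the partition \<open>real\<close> takes the values 0 and 1 at
      the indices 0 and 1.\<close>
    by (intro conjI exI[of _ "1::nat"] exI[of _ real]) simp_all
  show "curve_length (rev_mfd G) \<gamma> = integral {0..1} (\<lambda>t. sqrt (G (r t) * (w t)\<^sup>2 + (v t)\<^sup>2))"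
    unfolding curve_length_def by (intro integral_cong speed_lifted[OF assms(1)]) simp_all
qed

abbreviation lengths :: "(nat \<Rightarrow> real) \<Rightarrow> (nat \<Rightarrow> real) \<Rightarrow> real set" where
  "lengths P P' \<equiv> {curve_length (rev_mfd G) \<gamma> |\<gamma>. piecewise_C1_curve (rev_mfd G) \<gamma> \<and> \<gamma> 0 = P \<and> \<gamma> 1 = P'}"

lemma lengths_bound:
  assumes "P \<in> cyl" "0 \<le> p" "p \<le> 1" "x \<in> lengths P P'"
  shows "p * adist (zc P) (zc P') + \<bar>Qf G p (P' 2) - Qf G p (P 2)\<bar> \<le> x"
proof -
  have "zc P \<noteq> 0" using cyl_props(1)[OF assms(1)] by auto
  then show ?thesis using length_lower[OF _ assms(2,3)] assms(4) by auto
qed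

lemma dist_le:
  assumes "P \<in> cyl" "lifted {0..1} \<gamma> \<theta> r w v" "continuous_on {0..1} w" "continuous_on {0..1} v"
    "\<gamma> 0 = P" "\<gamma> 1 = P'"
  shows "mfd_dist (rev_mfd G) P P' \<le> integral {0..1} (\<lambda>t. sqrt (G (r t) * (w t)\<^sup>2 + (v t)\<^sup>2))"
proof -
  note l = lifted_piecewise_C1[OF assms(2-4)]
  have "bdd_below (lengths P P')"
  proof (rule bdd_belowI)
    fix x assume "x \<in> lengths P P'"
    \<comment> \<open>With \<open>p = 0\<close> the lower bound is an absolute value, hence
      nonnegative.\<close>
    from lengths_bound[OF assms(1) _ _ this, of 0]
    show "0 \<le> x" by simp
  qed
  moreover have "curve_length (rev_mfd G) \<gamma> \<in> lengths P P'" using l(1) assms(5,6) by blast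
  ultimately show ?thesis unfolding mfd_dist_def l(2)[symmetric] by (rule cInf_lower[rotated])
qed

lemma straight_lifted:
  assumes "0 \<le> r" "r \<le> hgt" "0 \<le> r'" "r' \<le> hgt"
  shows "lifted {0..1} (\<lambda>t. pt (cis (a + t * d)) (r + t * (r' - r))) (\<lambda>t. a + t * d) (\<lambda>t. r + t * (r' - r))
    (\<lambda>_. d) (\<lambda>_. r' - r)"
  unfolding lifted_def
proof (intro ballI conjI)
  fix t :: real assume t: "t \<in> {0..1}"
  have e: "r + t * (r' - r) = (1 - t) * r + t * r'" by (simp add: algebra_simps)
  show "0 \<le> r + t * (r' - r)" unfolding e using t assms by simp
  show "r + t * (r' - r) \<le> hgt" unfolding e using t assms by (intro convex_bound_le) simp_all
qed (auto intro!: derivative_eq_intros)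

lemma cis_Arg_div:
  assumes "P \<in> cyl" "P' \<in> cyl" "zc P = cis a"
  shows "P' = pt (cis (a + Arg (zc P' / zc P))) (P' 2)"
proof -
  have n: "cmod (zc P' / zc P) = 1" using assms cyl_props(1) by (simp add: norm_divide)
  then have "zc P' / zc P \<noteq> 0" by (metis norm_zero zero_neq_one)
  then have "cis (Arg (zc P' / zc P)) = zc P' / zc P" using n by (simp add: cis_Arg sgn_div_norm)
  then have "cis (a + Arg (zc P' / zc P)) = zc P'" by (simp add: cis_mult[symmetric] assms(3))
  then show ?thesis using cyl_props(4)[OF assms(2)] by simp
qed

text \<open>The test curve is straight in the coordinates \<open>(\<theta>, r)\<close>. It is
  minimal when horizontal on an end circle or vertical; in all cases it shows that the infimum
  defining the distance is not over the empty set.\<close>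

lemma dist_straight_le:
  assumes "P \<in> cyl" "P' \<in> cyl"
  shows "mfd_dist (rev_mfd G) P P' \<le> integral {0..1} (\<lambda>t. sqrt (G (P 2 + t * (P' 2 - P 2)) *
      (adist (zc P) (zc P'))\<^sup>2 + (P' 2 - P 2)\<^sup>2))" "lengths P P' \<noteq> {}"
proof -
  obtain a r where P: "P = pt (cis a) r" using assms(1) by (rule cylE)
  let ?d = "Arg (zc P' / zc P)"
  let ?\<gamma> = "\<lambda>t. pt (cis (a + t * ?d)) (P 2 + t * (P' 2 - P 2))"
  have l: "lifted {0..1} ?\<gamma> (\<lambda>t. a + t * ?d) (\<lambda>t. P 2 + t * (P' 2 - P 2)) (\<lambda>_. ?d) (\<lambda>_. P' 2 - P 2)"
    using cyl_props[OF assms(1)] cyl_props[OF assms(2)] by (intro straight_lifted)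
  have "?\<gamma> 0 = P" by (simp add: P)
  moreover have "?\<gamma> 1 = P'" using cis_Arg_div[OF assms, of a] by (simp add: P)
  ultimately show "mfd_dist (rev_mfd G) P P' \<le> integral {0..1} (\<lambda>t. sqrt (G (P 2 + t * (P' 2 - P 2)) *
      (adist (zc P) (zc P'))\<^sup>2 + (P' 2 - P 2)\<^sup>2))"
    using dist_le[OF assms(1) l] by (simp add: adist_def)
  have "curve_length (rev_mfd G) ?\<gamma> \<in> lengths P P'"
    unfolding mem_Collect_eq
    by (intro exI[of _ ?\<gamma>] conjI refl lifted_piecewise_C1(1)[OF l])
      (simp_all add: \<open>?\<gamma> 0 = P\<close>[simplified] \<open>?\<gamma> 1 = P'\<close>[simplified])
  then show "lengths P P' \<noteq> {}" by blast
qed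

lemma dist_ge:
  assumes "P \<in> cyl" "P' \<in> cyl" "0 \<le> p" "p \<le> 1"
  shows "p * adist (zc P) (zc P') + \<bar>Qf G p (P' 2) - Qf G p (P 2)\<bar> \<le> mfd_dist (rev_mfd G) P P'"
  unfolding mfd_dist_def
  by (rule cInf_greatest[OF dist_straight_le(2)[OF assms(1,2)] lengths_bound[OF assms(1,3,4)]])

text \<open>On an end circle \<open>G = 1\<close>, so the length of an arc is its angle. The form
  with \<open>p = 1\<close> shows that a detour through the interior, where
  \<open>G \<ge> 1\<close>, is not shorter.\<close>

lemma dist_same_side:
  assumes "P \<in> bdry (rev_mfd G)" "P' \<in> bdry (rev_mfd G)" "P 2 = P' 2"
  shows "mfd_dist (rev_mfd G) P P' = adist (zc P) (zc P')"
proof -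
  have c: "P \<in> cyl" "P' \<in> cyl" and "P 2 = 0 \<or> P 2 = hgt" using assms by (simp_all add: bdry_rev_mfd)
  then have "G (P 2) = 1" using G_0 G_sym[of 0] by auto
  then have "mfd_dist (rev_mfd G) P P' \<le> adist (zc P) (zc P')"
    using dist_straight_le(1)[OF c] assms(3) by (simp add: adist_def)
  moreover have "adist (zc P) (zc P') \<le> mfd_dist (rev_mfd G) P P'"
    using dist_ge[OF c, of 1] assms(3) by simp
  ultimately show ?thesis by simp
qed

lemma Qf_0 [simp]: "0 \<le> r \<Longrightarrow> Qf G 0 r = r"
proof -
  have "qf G 0 = (\<lambda>_. 1)" by (simp add: qf_def fun_eq_iff)
  then show "0 \<le> r \<Longrightarrow> Qf G 0 r = r" by (simp add: Qf_def)
qed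

text \<open>The calibration with \<open>p = 0\<close> is the form \<open>dr\<close>, whose integral
  is the difference of heights.\<close>

lemma dist_vertical:
  assumes "P \<in> cyl" "P' \<in> cyl" "zc P = zc P'"
  shows "mfd_dist (rev_mfd G) P P' = \<bar>P' 2 - P 2\<bar>"
proof -
  have "zc P' \<noteq> 0" using cyl_props(1)[OF assms(2)] by auto
  then have "adist (zc P) (zc P') = 0" by (simp add: adist_def assms(3))
  then show ?thesis
    using dist_straight_le(1)[OF assms(1,2)] dist_ge[OF assms(1,2), of 0] cyl_props(2)[OF assms(1)]
      cyl_props(2)[OF assms(2)] by simp
qed

lemma dist_ge_height:
  assumes "P \<in> cyl" "P' \<in> cyl"
  shows "\<bar>P' 2 - P 2\<bar> \<le> mfd_dist (rev_mfd G) P P'"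
  using dist_ge[OF assms, of 0] cyl_props(2)[OF assms(1)] cyl_props(2)[OF assms(2)] by simp

text \<open>The geodesic with Clairaut constant \<open>p\<close>, parametrised proportionally to
  height: its length stays the same and \<open>Af\<close> need not be inverted. The flag
  \<open>s\<close> chooses the starting end, and \<open>e\<close>, used with the values 1 and -1,
  the sense of rotation.\<close>

lemma ray_lifted:
  assumes p: "\<bar>p\<bar> < 1"
  shows "lifted {0..1} (\<lambda>t. pt (cis (a + e * Bf G p (hgt * t))) (ht s (hgt * t)))
    (\<lambda>t. a + e * Bf G p (hgt * t)) (\<lambda>t. ht s (hgt * t))
    (\<lambda>t. e * (p / (G (hgt * t) * qf G p (hgt * t)) * hgt)) (\<lambda>_. sg s * hgt)"
  unfolding lifted_def
proof (intro ballI conjI)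
  fix t :: real assume t: "t \<in> {0..1}"
  have b: "0 \<le> hgt * t" "hgt * t \<le> hgt" using t by (simp_all add: mult_left_le)
  show "0 \<le> ht s (hgt * t)" "ht s (hgt * t) \<le> hgt" using b by (cases s; simp)+
  have im: "(\<lambda>t. hgt * t) ` {0..1} \<subseteq> {0..hgt}" by (auto simp: mult_left_le)
  have h: "((\<lambda>t. hgt * t) has_real_derivative hgt) (at t within {0..1})"
    by (auto intro!: derivative_eq_intros)
  have "(Bf G p has_real_derivative p / (G (hgt * t) * qf G p (hgt * t))) (at (hgt * t) within (\<lambda>t. hgt * t) ` {0..1})"
    using Bf_deriv[OF p, of "hgt * t"] b by (intro has_field_derivative_subset[OF _ im]) simp
  from DERIV_image_chain[OF this h]
  have "((\<lambda>t. Bf G p (hgt * t)) has_real_derivative p / (G (hgt * t) * qf G p (hgt * t)) * hgt) (at t within {0..1})"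
    by (simp add: o_def)
  from DERIV_add[OF DERIV_const DERIV_cmult[OF this]]
  show "((\<lambda>t. a + e * Bf G p (hgt * t)) has_real_derivative e * (p / (G (hgt * t) * qf G p (hgt * t)) * hgt))
      (at t within {0..1})" by simp
  show "((\<lambda>t. ht s (hgt * t)) has_real_derivative sg s * hgt) (at t within {0..1})"
    by (rule ht_deriv[OF h])
qed simp

text \<open>The geodesic with constant \<open>p\<close> joins the two points and has length
  \<open>Af G p hgt\<close>; by \<open>Af_eq\<close> the form with the same \<open>p\<close> bounds
  all other curves below by this number.\<close>

lemma dist_opposite:
  assumes P: "P \<in> cyl" "P' \<in> cyl" "P 2 = ht s 0" "P' 2 = ht s hgt"
    and p: "0 \<le> p" "p < 1" and B: "Bf G p hgt = adist (zc P) (zc P')"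
  shows "mfd_dist (rev_mfd G) P P' = Af G p hgt"
proof (rule antisym)
  have p': "\<bar>p\<bar> < 1" using p by simp
  have "\<bar>Qf G p (P' 2) - Qf G p (P 2)\<bar> = \<bar>Qf G p hgt\<bar>"
    unfolding P(3,4) by (cases s) (simp_all add: Qf_def)
  then show "Af G p hgt \<le> mfd_dist (rev_mfd G) P P'"
    using dist_ge[OF P(1,2), of p] p Af_eq[OF p', of hgt, unfolded B] by simp
  obtain a r where a: "P = pt (cis a) r" using P(1) by (rule cylE)
  \<comment> \<open>Rotation along the shorter arc.\<close>
  define e where "e = (if 0 \<le> Arg (zc P' / zc P) then 1 else - 1 :: real)"
  have e: "e * e = 1" "e * adist (zc P) (zc P') = Arg (zc P' / zc P)"
    by (simp_all add: e_def adist_def)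
  let ?\<gamma> = "\<lambda>t. pt (cis (a + e * Bf G p (hgt * t))) (ht s (hgt * t))"
  let ?w = "\<lambda>t. e * (p / (G (hgt * t) * qf G p (hgt * t)) * hgt)"
  have "continuous_on {0..1} (\<lambda>t. p / (G (hgt * t) * qf G p (hgt * t)))"
    by (rule continuous_on_compose2[OF continuous_on_Bf[OF p', of UNIV]]) (simp_all add: continuous_on_mult_left)
  then have cw: "continuous_on {0..1} ?w" by (intro continuous_on_mult_left continuous_on_mult_right)
  have "?\<gamma> 0 = P" using a P(3) by (simp add: Bf_def)
  moreover have "?\<gamma> 1 = pt (cis (a + Arg (zc P' / zc P))) (P' 2)" by (simp add: B e(2) P(4))
  then have "?\<gamma> 1 = P'" using cis_Arg_div[OF P(1,2), of a] by (simp add: a)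
  ultimately have "mfd_dist (rev_mfd G) P P' \<le> integral {0..1} (\<lambda>t. sqrt (G (ht s (hgt * t)) * (?w t)\<^sup>2 + (sg s * hgt)\<^sup>2))"
    by (intro dist_le[OF P(1) ray_lifted[OF p'] cw]) simp_all
  \<comment> \<open>A unit-speed geodesic climbs at the rate \<open>qf\<close>, so per unit of
    height its length is \<open>1 / qf\<close>. Algebraically this is
    \<open>p^2 / (G * qf^2) + 1 = 1 / qf^2\<close>.\<close>
  also have "(\<lambda>t. sqrt (G (ht s (hgt * t)) * (?w t)\<^sup>2 + (sg s * hgt)\<^sup>2)) = (\<lambda>t. hgt * (1 / qf G p (hgt * t)))"
  proof
    fix t
    let ?x = "hgt * t"
    have q: "0 < qf G p ?x" by (rule qf_bounds(2)[OF p'])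
    have Gq: "G ?x * (qf G p ?x)\<^sup>2 = G ?x - p\<^sup>2" using p' by (intro G_qf_square) simp
    have "(?w t)\<^sup>2 = (p / (G ?x * qf G p ?x) * hgt)\<^sup>2"
    proof -
      have "(e * X)\<^sup>2 = X\<^sup>2" for X using e(1) by (simp add: power_mult_distrib power2_eq_square[of e])
      then show ?thesis .
    qed
    moreover have "(sg s * hgt)\<^sup>2 = hgt\<^sup>2" by (simp add: power_mult_distrib power2_eq_square[of "sg s"])
    moreover have "G ?x * (p / (G ?x * qf G p ?x) * hgt)\<^sup>2 + hgt\<^sup>2 = (hgt * (1 / qf G p ?x))\<^sup>2"
    proof -
      have "G ?x * (p / (G ?x * qf G p ?x))\<^sup>2 + 1 = (1 / qf G p ?x)\<^sup>2"
        using q Gq by (simp add: field_simps power2_eq_square)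
      moreover have "g * (X * h)\<^sup>2 + h\<^sup>2 = (h * Y)\<^sup>2" if "g * X\<^sup>2 + 1 = Y\<^sup>2" for g X Y h :: real
        using that by algebra
      ultimately show ?thesis by blast
    qed
    ultimately show "sqrt (G (ht s ?x) * (?w t)\<^sup>2 + (sg s * hgt)\<^sup>2) = hgt * (1 / qf G p ?x)"
      using q by simp
  qed
  also have "integral {0..1} (\<lambda>t. hgt * (1 / qf G p (hgt * t))) = Af G p hgt"
  proof (rule integral_unique)
    have "((\<lambda>t. hgt * (1 / qf G p (hgt * t))) has_integral Af G p (hgt * 1) - Af G p (hgt * 0)) {0..1}"
    proof (rule fundamental_theorem_of_calculus)
      fix t :: real assume t: "t \<in> {0..1}"
      have im: "(\<lambda>t. hgt * t) ` {0..1} \<subseteq> {0..hgt}" by (auto simp: mult_left_le)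
      have h: "((\<lambda>t. hgt * t) has_real_derivative hgt) (at t within {0..1})"
        by (auto intro!: derivative_eq_intros)
      have "(Af G p has_real_derivative 1 / qf G p (hgt * t)) (at (hgt * t) within (\<lambda>t. hgt * t) ` {0..1})"
        using Af_deriv[OF p', of "hgt * t"] t by (intro has_field_derivative_subset[OF _ im]) (simp add: mult_left_le)
      from DERIV_image_chain[OF this h]
      show "((\<lambda>t. Af G p (hgt * t)) has_vector_derivative hgt * (1 / qf G p (hgt * t))) (at t within {0..1})"
        by (simp add: o_def has_real_derivative_iff_has_vector_derivative[symmetric] mult.commute)
    qed simp
    then show "((\<lambda>t. hgt * (1 / qf G p (hgt * t))) has_integral Af G p hgt) {0..1}"
      by (simp add: Af_def)
  qed
  finally show "mfd_dist (rev_mfd G) P P' \<le> Af G p hgt" .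
qed

end

section \<open>Geodesics and lens data\<close>

text \<open>The difference quotients of \<open>g\<close> are the reciprocals of those of
  \<open>f\<close>, and by continuity \<open>g z\<close> tends to \<open>g y\<close> within
  \<open>S\<close>. No interior point is involved, so the ends of an interval are covered.\<close>

lemma inverse_deriv_within:
  assumes f: "(f has_real_derivative D) (at (g y) within S)" "D \<noteq> 0"
    and g: "continuous_on U g" "g ` U \<subseteq> S" "y \<in> U" "\<And>z. z \<in> U \<Longrightarrow> f (g z) = z"
  shows "(g has_real_derivative 1 / D) (at y within U)"
proof -
  have "filterlim g (at (g y) within S) (at y within U)"
    unfolding filterlim_at
  proof
    show "(g \<longlongrightarrow> g y) (at y within U)" using g(1,3) by (simp add: continuous_on_def)
    have "g z \<in> S \<and> g z \<noteq> g y" if "z \<in> U" "z \<noteq> y" for z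
      using g(2) that g(4)[of z] g(4)[OF g(3)] by auto
    then show "\<forall>\<^sub>F z in at y within U. g z \<in> S \<and> g z \<noteq> g y"
      by (auto simp: eventually_at_filter)
  qed
  moreover have "((\<lambda>x. (f x - f (g y)) / (x - g y)) \<longlongrightarrow> D) (at (g y) within S)"
    using f(1) by (simp add: has_field_derivative_iff)
  ultimately have "((\<lambda>z. (f (g z) - f (g y)) / (g z - g y)) \<longlongrightarrow> D) (at y within U)"
    by (rule filterlim_compose[rotated])
  then have "((\<lambda>z. 1 / ((f (g z) - f (g y)) / (g z - g y))) \<longlongrightarrow> 1 / D) (at y within U)"
    using f(2) by (intro tendsto_intros)
  moreover have "\<forall>\<^sub>F z in at y within U. 1 / ((f (g z) - f (g y)) / (g z - g y)) = (g z - g y) / (z - y)"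
    using g(4) g(4)[OF g(3)] by (auto simp: eventually_at_filter)
  ultimately have "((\<lambda>z. (g z - g y) / (z - y)) \<longlongrightarrow> 1 / D) (at y within U)"
    by (rule Lim_transform_eventually)
  then show ?thesis by (simp add: has_field_derivative_iff)
qed

lemma continuous_pos_propagates:
  fixes f :: "real \<Rightarrow> real"
  assumes "continuous_on {a..b} f" "\<And>t. t \<in> {a..b} \<Longrightarrow> f t \<noteq> 0" "0 < f a" "t \<in> {a..b}"
  shows "0 < f t"
proof (rule ccontr)
  assume "\<not> 0 < f t"
  moreover have "continuous_on {a..t} f" using assms(1,4) by (intro continuous_on_subset[OF assms(1)]) auto
  ultimately obtain x where "a \<le> x" "x \<le> t" "f x = 0"
    using IVT2'[of f t 0 a] assms(3,4) by auto
  then show False using assms(2)[of x] assms(4) by simp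
qed

text \<open>The lens data in terms of the travel time \<open>A p\<close> and the rotation angle \<open>B p\<close> of the geodesics with
  Clairaut constant \<open>p\<close>. The projection of the velocity to the boundary has component \<open>p\<close> as \<open>G = 1\<close> there.\<close>

definition clairaut_lens ::
    "(real \<Rightarrow> real) \<Rightarrow> (real \<Rightarrow> real) \<Rightarrow>
      (((nat \<Rightarrow> real) \<times> (nat \<Rightarrow> real) tvec) \<times> ((nat \<Rightarrow> real) \<times> (nat \<Rightarrow> real) tvec) \<times> real) set" where
  "clairaut_lens A B = {((P, tangential P p), (P', tangential P' p), A p) |P P' p.
     \<exists>a s. \<bar>p\<bar> < 1 \<and> P = pt (cis a) (ht s 0) \<and> P' = pt (cis (a + B p)) (ht s hgt)}"

section \<open>From geodesics to Clairaut data\<close>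

context profile begin

lemma partial_deriv_rev_metric:
  assumes x: "x \<in> hbox" and i: "i < 2"
  shows "partial_deriv hbox i (rev_metric G c j k) x = (if i = 1 \<and> j = 0 \<and> k = 0 then G' (x 1) else 0)"
proof -
  obtain \<epsilon> where \<epsilon>: "\<epsilon> > 0" "\<And>u. x i \<le> u \<Longrightarrow> u < x i + \<epsilon> \<Longrightarrow> x(i := u) \<in> hbox"
    using hbox_right_open[OF x i] by auto
  define g where "g u = rev_metric G c j k (x(i := u))" for u
  have "(g has_real_derivative (if i = 1 \<and> j = 0 \<and> k = 0 then G' (x 1) else 0)) (at (x i))"
  proof (cases "i = 1 \<and> j = 0 \<and> k = 0")
    case True
    then have "g = G" by (simp add: g_def rev_metric_def fun_eq_iff)
    with True show ?thesis using G_deriv by simp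
  next
    case False
    then have "g = (\<lambda>_. g 0)" by (auto simp: g_def rev_metric_def fun_eq_iff)
    with False show ?thesis by (metis DERIV_const)
  qed
  then show ?thesis
    by (rule partial_deriv_eqI[where \<epsilon> = \<epsilon>]) (use \<epsilon> in \<open>simp_all add: g_def\<close>)
qed

text \<open>Along a curve, the expression for \<open>k = 0\<close> is the time derivative of
  \<open>G \<theta>'\<close>, whence Clairaut's relation. The one for \<open>k = 1\<close> is the
  radial acceleration minus the centrifugal term.\<close>

lemma geodesic_equation:
  assumes "x \<in> hbox" "k < 2"
  shows "(\<Sum>j<2. rev_metric G (ch \<alpha> s) k j x * A j) +
      (\<Sum>i<2. \<Sum>j<2. christoffel_lower (rev_mfd G) (ch \<alpha> s) i j k x * V i * V j) =
    (if k = 0 then G (x 1) * A 0 + G' (x 1) * V 0 * V 1 else A 1 - G' (x 1) / 2 * (V 0)\<^sup>2)"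
proof -
  have k: "k = 0 \<or> k = 1" using assms(2) by auto
  have c: "christoffel_lower (rev_mfd G) (ch \<alpha> s) i j k x =
      ((if i = 1 \<and> j = 0 \<and> k = 0 then G' (x 1) else 0) + (if j = 1 \<and> i = 0 \<and> k = 0 then G' (x 1) else 0) -
       (if k = 1 \<and> i = 0 \<and> j = 0 then G' (x 1) else 0)) / 2" if "i < 2" "j < 2" for i j
    using that assms by (simp add: christoffel_lower_def coord_image partial_deriv_rev_metric)
  show ?thesis
    using k by (auto simp: sum_less_2 c rev_metric_def power2_eq_square field_simps)
qed

lemma geodesic_on_rev_mfd:
  "geodesic_on (rev_mfd G) I \<gamma> \<longleftrightarrow> continuous_on I \<gamma> \<and> \<gamma> \<in> I \<rightarrow> cyl \<and>
    (\<forall>\<alpha> s. \<exists>V A. \<forall>t\<in>chart_times I \<gamma> (ch \<alpha> s). \<forall>k<2.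
      ((\<lambda>u. coord \<alpha> s (\<gamma> u) k) has_real_derivative V k t) (at t within chart_times I \<gamma> (ch \<alpha> s)) \<and>
      (V k has_real_derivative A k t) (at t within chart_times I \<gamma> (ch \<alpha> s)) \<and>
      (if k = 0 then G (\<gamma> t 2) * A 0 t + G' (ht s (\<gamma> t 2)) * V 0 t * V 1 t
       else A 1 t - G' (ht s (\<gamma> t 2)) / 2 * (V 0 t)\<^sup>2) = 0)"
proof -
  have e: "(\<Sum>j<2. rev_metric G (ch \<alpha> s) k j (coord \<alpha> s (\<gamma> t)) * A j t) +
      (\<Sum>i<2. \<Sum>j<2. christoffel_lower (rev_mfd G) (ch \<alpha> s) i j k (coord \<alpha> s (\<gamma> t)) * V i t * V j t) =
    (if k = 0 then G (\<gamma> t 2) * A 0 t + G' (ht s (\<gamma> t 2)) * V 0 t * V 1 t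
       else A 1 t - G' (ht s (\<gamma> t 2)) / 2 * (V 0 t)\<^sup>2)"
    if "t \<in> chart_times I \<gamma> (ch \<alpha> s)" "k < 2" for \<alpha> s t k V and A :: "nat \<Rightarrow> real \<Rightarrow> real"
  proof -
    have "coord \<alpha> s (\<gamma> t) \<in> hbox" using that(1) by (simp add: chart_times_def coord_in_hbox)
    from geodesic_equation[OF this that(2), of \<alpha> s "\<lambda>j. A j t" "\<lambda>j. V j t"]
    show ?thesis unfolding coord_components by simp
  qed
  show ?thesis
    unfolding geodesic_on_def Let_def rev_mfd_simps ball_atlas ch_simps
    by (simp add: e cong: conj_cong ball_cong)
qed

lemma G'_ht: "G' (ht s x) = sg s * G' x"
proof (cases s)
  case False
  have "((\<lambda>x. G (hgt - x)) has_real_derivative - G' (hgt - x)) (at x)"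
    by (rule DERIV_cong[OF DERIV_chain2[OF G_deriv]]) (auto intro!: derivative_eq_intros)
  then have "(G has_real_derivative - G' (hgt - x)) (at x)" by (simp add: G_sym)
  then have "- G' (hgt - x) = G' x" using G_deriv by (rule DERIV_unique)
  with False show ?thesis by simp
qed simp

lemma G_end: "r = 0 \<or> r = hgt \<Longrightarrow> G r = 1"
  using G_0 G_sym[of 0] by auto

text \<open>Since \<open>qf \<le> 1\<close>, climbing takes at least as much time as the height
  gained. So \<open>Af G p\<close> is injective, which lets time and height be exchanged.\<close>

lemma Af_increase:
  assumes "\<bar>p\<bar> < 1" "0 \<le> x" "x \<le> y"
  shows "y - x \<le> Af G p y - Af G p x"
proof -
  have int: "(\<lambda>x. 1 / qf G p x) integrable_on {a..b}" for a b
    by (rule integrable_continuous_real[OF continuous_on_Af[OF assms(1)]])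
  have "integral {x..y} (\<lambda>_. 1) \<le> integral {x..y} (\<lambda>x. 1 / qf G p x)"
    by (rule integral_le[OF integrable_const_ivl int]) (use qf_bounds[of p] assms(1) in simp_all)
  moreover have "Af G p x + integral {x..y} (\<lambda>x. 1 / qf G p x) = Af G p y"
    unfolding Af_def by (rule Henstock_Kurzweil_Integration.integral_combine[OF assms(2,3) int])
  ultimately show ?thesis using assms(3) by simp
qed

lemma Af_at_0 [simp]: "Af G p 0 = 0" and Bf_at_0 [simp]: "Bf G p 0 = 0"
  by (simp_all add: Af_def Bf_def)

lemma geodesic_lift:
  assumes "geodesic_on (rev_mfd G) {0..T} \<gamma>" "0 < T"
  obtains \<theta> r w v p where "lifted {0..T} \<gamma> \<theta> r w v" "continuous_on {0..T} v"
    "\<And>t. t \<in> {0..T} \<Longrightarrow> G (r t) * w t = p"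
proof -
  let ?I = "{0..T}"
  let ?T = "\<lambda>\<alpha> s. chart_times {0..T} \<gamma> (ch \<alpha> s)"
  have c: "continuous_on ?I \<gamma>" "\<gamma> \<in> ?I \<rightarrow> cyl"
    and g: "\<And>\<alpha> s. \<exists>V A. \<forall>t\<in>?T \<alpha> s. \<forall>k<2.
      ((\<lambda>u. coord \<alpha> s (\<gamma> u) k) has_real_derivative V k t) (at t within ?T \<alpha> s) \<and>
      (V k has_real_derivative A k t) (at t within ?T \<alpha> s) \<and>
      (if k = 0 then G (\<gamma> t 2) * A 0 t + G' (ht s (\<gamma> t 2)) * V 0 t * V 1 t
       else A 1 t - G' (ht s (\<gamma> t 2)) / 2 * (V 0 t)\<^sup>2) = 0"
    using assms(1) unfolding geodesic_on_rev_mfd by simp_all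
  have "\<exists>V. \<forall>k<2. continuous_on (?T \<alpha> s) (V k) \<and> (\<forall>t\<in>?T \<alpha> s.
      ((\<lambda>u. coord \<alpha> s (\<gamma> u) k) has_real_derivative V k t) (at t within ?T \<alpha> s))" for \<alpha> s
  proof -
    obtain V A where VA: "\<forall>t\<in>?T \<alpha> s. \<forall>k<2.
      ((\<lambda>u. coord \<alpha> s (\<gamma> u) k) has_real_derivative V k t) (at t within ?T \<alpha> s) \<and>
      (V k has_real_derivative A k t) (at t within ?T \<alpha> s) \<and>
      (if k = 0 then G (\<gamma> t 2) * A 0 t + G' (ht s (\<gamma> t 2)) * V 0 t * V 1 t
       else A 1 t - G' (ht s (\<gamma> t 2)) / 2 * (V 0 t)\<^sup>2) = 0"
      using g[of \<alpha> s] by (elim exE)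
    have "continuous_on (?T \<alpha> s) (V k)" if "k < 2" for k
      using VA that by (intro DERIV_continuous_on) blast
    with VA show ?thesis by (intro exI[of _ V]) simp
  qed
  from chart_curve_lift[OF assms(2) c this] obtain \<theta> r w v
    where l: "lifted ?I \<gamma> \<theta> r w v" "continuous_on ?I v" by metis
  have "((\<lambda>u. G (r u) * w u) has_real_derivative 0) (at t within ?I)" if t: "t \<in> ?I" for t
  proof -
    have "\<gamma> t \<in> cyl" using c(2) t by blast
    then obtain \<alpha> s where s: "\<gamma> t \<in> cdom \<alpha> s" by (rule chart_at_rev_mfd)
    obtain V A where VA: "\<forall>t\<in>?T \<alpha> s. \<forall>k<2.
      ((\<lambda>u. coord \<alpha> s (\<gamma> u) k) has_real_derivative V k t) (at t within ?T \<alpha> s) \<and>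
      (V k has_real_derivative A k t) (at t within ?T \<alpha> s) \<and>
      (if k = 0 then G (\<gamma> t 2) * A 0 t + G' (ht s (\<gamma> t 2)) * V 0 t * V 1 t
       else A 1 t - G' (ht s (\<gamma> t 2)) / 2 * (V 0 t)\<^sup>2) = 0"
      using g[of \<alpha> s] by (elim exE)
    have tT: "t \<in> ?T \<alpha> s" using t s by (simp add: chart_times_def)
    have at: "at u within ?T \<alpha> s = at u within ?I" if "u \<in> ?T \<alpha> s" for u
      by (rule at_chart_times[OF c that])
    have V: "w u = V 0 u" "sg s * v u = V 1 u" if u: "u \<in> ?T \<alpha> s" for u
    proof -
      have uI: "u \<in> ?I" "\<gamma> u \<in> cdom \<alpha> s" using u by (simp_all add: chart_times_def)
      show "w u = V 0 u" "sg s * v u = V 1 u"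
        using VA[rule_format, OF u, of 0] VA[rule_format, OF u, of 1] unfolding at[OF u]
        by (intro deriv_within_Icc_unique[OF assms(2) uI(1) coord_lifted_deriv(1)[OF l(1) uI]]
            deriv_within_Icc_unique[OF assms(2) uI(1) coord_lifted_deriv(2)[OF l(1) uI]]; simp)+
    qed
    have "(V 0 has_real_derivative A 0 t) (at t within ?T \<alpha> s)"
      using VA[rule_format, OF tT, of 0] by simp
    then have "(w has_real_derivative A 0 t) (at t within ?T \<alpha> s)"
      by (rule has_field_derivative_transform_within[OF _ zero_less_one tT]) (simp add: V)
    then have dw: "(w has_real_derivative A 0 t) (at t within ?I)" unfolding at[OF tT] .
    have dG: "((\<lambda>u. G (r u)) has_real_derivative G' (r t) * v t) (at t within ?I)"
      by (rule DERIV_chain2[OF G_deriv liftedD(5)[OF l(1) t]])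
    have r: "\<gamma> t 2 = r t" using liftedD(1)[OF l(1) t] by simp
    have "G (r t) * A 0 t + G' (ht s (r t)) * V 0 t * V 1 t = 0"
      using VA[rule_format, OF tT, of 0] by (simp add: r)
    \<comment> \<open>In a reversed chart both \<open>G'\<close> and the height velocity change
      sign, so the equation has the same form in all charts.\<close>
    then have "G (r t) * A 0 t + G' (r t) * v t * w t = 0"
      unfolding V[OF tT, symmetric] G'_ht by (simp add: mult_ac)
    then show ?thesis
      using DERIV_mult[OF dG dw] by (simp add: algebra_simps)
  qed
  then have "\<exists>p. \<forall>t\<in>?I. G (r t) * w t = p"
    by (intro has_field_derivative_zero_constant convex_real_interval(5))
  then obtain p where p: "\<forall>t\<in>?I. G (r t) * w t = p" by (elim exE)
  show thesis by (rule that[OF l]) (use p in simp)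
qed

text \<open>If \<open>\<bar>p\<bar> < 1\<close>, the height velocity satisfies
  \<open>v^2 = 1 - p^2 / G > 0\<close> and keeps its sign, so the geodesic never turns back. Then
  \<open>Af G p (\<rho> t) - t\<close> and \<open>\<theta> t - Bf G p (\<rho> t)\<close> are
  constant, and comparing both ends gives travel time and rotation.\<close>

lemma geodesic_traverse:
  assumes \<gamma>: "unit_speed_geodesic_on (rev_mfd G) {0..T} \<gamma>" "0 < T"
    and b: "\<gamma> 0 \<in> bdry (rev_mfd G)" "\<gamma> T \<in> bdry (rev_mfd G)"
    and n: "0 < ginner (rev_mfd G) (\<gamma> 0) (velocity (rev_mfd G) {0..T} \<gamma> 0) (inward_normal (rev_mfd G) (\<gamma> 0))"
  shows "(bdry_proj (rev_mfd G) (\<gamma> 0, velocity (rev_mfd G) {0..T} \<gamma> 0),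
      bdry_proj (rev_mfd G) (\<gamma> T, velocity (rev_mfd G) {0..T} \<gamma> T), T)
    \<in> clairaut_lens (\<lambda>p. Af G p hgt) (\<lambda>p. Bf G p hgt)"
proof -
  let ?I = "{0..T}"
  have I: "0 \<in> ?I" "T \<in> ?I" using \<gamma>(2) by simp_all
  obtain \<theta> r w v p where l: "lifted ?I \<gamma> \<theta> r w v" and cv: "continuous_on ?I v"
    and p: "\<And>t. t \<in> ?I \<Longrightarrow> G (r t) * w t = p"
    by (rule geodesic_lift[of T \<gamma>]) (use \<gamma> in \<open>simp_all add: unit_speed_geodesic_on_def\<close>)
  note L = liftedD[OF l]
  note vel = velocity_lifted[OF l \<gamma>(2), where G = G]
  have \<gamma>r: "\<gamma> t 2 = r t" "\<gamma> t \<in> cyl" if "t \<in> ?I" for t using L[OF that] by simp_all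
  have w: "w t = p / G (r t)" if "t \<in> ?I" for t
    using p[OF that] by (metis G_pos(2) nonzero_mult_div_cancel_left)
  have unit: "(v t)\<^sup>2 = 1 - p\<^sup>2 / G (r t)" if t: "t \<in> ?I" for t
  proof -
    have "G (r t) * w t * w t + v t * v t = 1"
      using \<gamma>(1) t ginner_vec_at[OF \<gamma>r(2)[OF t] vel[OF t] vel[OF t]] \<gamma>r(1)[OF t]
      unfolding unit_speed_geodesic_on_def by simp
    moreover have "G (r t) * w t * w t = p\<^sup>2 / G (r t)"
      by (simp add: w[OF t] power2_eq_square)
    ultimately show ?thesis by (simp add: power2_eq_square)
  qed
  have bdry: "r 0 = 0 \<or> r 0 = hgt" "r T = 0 \<or> r T = hgt"
    using b \<gamma>r[OF I(1)] \<gamma>r[OF I(2)] by (simp_all add: bdry_rev_mfd)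
  define s where "s \<longleftrightarrow> r 0 = 0"
  have "0 < v 0 * sg s"
    using n ginner_vec_at[OF \<gamma>r(2)[OF I(1)] vel[OF I(1)] vec_at_normal[OF b(1)]]
    unfolding inward_normal_eq[OF b(1)] \<gamma>r(1)[OF I(1)] s_def by simp
  then have v0: "0 < sg s * v 0" by (simp add: mult.commute)
  \<comment> \<open>An inward start means a nonzero height velocity; as \<open>G = 1\<close> at the
    ends, this amounts to \<open>\<bar>p\<bar> < 1\<close>.\<close>
  have "v 0 \<noteq> 0" using v0 by auto
  then have "0 < (v 0)\<^sup>2" by simp
  then have "p\<^sup>2 < 1" using unit[OF I(1)] G_end[OF bdry(1)] by simp
  then have p1: "\<bar>p\<bar> < 1" by (simp add: abs_square_less_1)
  have "v t \<noteq> 0" if "t \<in> ?I" for t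
    using unit[OF that] p2_G(3)[OF p1, of "r t"] by (metis less_irrefl right_minus_eq zero_eq_power2)
  then have vpos: "0 < sg s * v t" if "t \<in> ?I" for t
    using that by (intro continuous_pos_propagates[of 0 T "\<lambda>t. sg s * v t" t] continuous_on_mult_left cv v0)
      (auto simp: sg_def)
  \<comment> \<open>Height measured from the end circle where the geodesic starts, so that it
    increases whichever end this is.\<close>
  define \<rho> where "\<rho> t = ht s (r t)" for t
  have \<rho>I: "\<rho> t \<in> {0..hgt}" if "t \<in> ?I" for t
    using L(2,3)[OF that] by (cases s) (simp_all add: \<rho>_def)
  have r: "r t = ht s (\<rho> t)" for t by (simp add: \<rho>_def)
  have sv: "sg s * v t = qf G p (\<rho> t)" if "t \<in> ?I" for t
  proof -
    have "(sg s * v t)\<^sup>2 = (qf G p (\<rho> t))\<^sup>2"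
      using unit[OF that] p1 by (simp add: power_mult_distrib qf_square power2_eq_square[of "sg s"] r)
    then show ?thesis
      using vpos[OF that] qf_bounds(2)[OF p1, of "\<rho> t"] by (simp add: power2_eq_iff_nonneg)
  qed
  have d\<rho>: "(\<rho> has_real_derivative qf G p (\<rho> t)) (at t within ?I)" if "t \<in> ?I" for t
    using ht_deriv[OF L(5)[OF that], of s] sv[OF that] by (simp add: \<rho>_def[abs_def])
  have im: "\<rho> ` ?I \<subseteq> {0..hgt}" using \<rho>I by blast
  have qpos: "0 < qf G p x" for x by (rule qf_bounds(2)[OF p1])
  have dA: "((\<lambda>t. Af G p (\<rho> t) - t) has_real_derivative 0) (at t within ?I)"
    and dB: "((\<lambda>t. \<theta> t - Bf G p (\<rho> t)) has_real_derivative 0) (at t within ?I)" if t: "t \<in> ?I" for t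
  proof -
    have A: "(Af G p has_real_derivative 1 / qf G p (\<rho> t)) (at (\<rho> t) within \<rho> ` ?I)"
      by (rule has_field_derivative_subset[OF Af_deriv[OF p1 \<rho>I[OF t]] im])
    have B: "(Bf G p has_real_derivative p / (G (\<rho> t) * qf G p (\<rho> t))) (at (\<rho> t) within \<rho> ` ?I)"
      by (rule has_field_derivative_subset[OF Bf_deriv[OF p1 \<rho>I[OF t]] im])
    have "((\<lambda>t. Af G p (\<rho> t)) has_real_derivative 1) (at t within ?I)"
      using DERIV_image_chain[OF A d\<rho>[OF t]] qpos[of "\<rho> t"] by (simp add: o_def)
    from DERIV_diff[OF this DERIV_ident]
    show "((\<lambda>t. Af G p (\<rho> t) - t) has_real_derivative 0) (at t within ?I)" by simp
    have "((\<lambda>t. Bf G p (\<rho> t)) has_real_derivative w t) (at t within ?I)"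
      using DERIV_image_chain[OF B d\<rho>[OF t]] qpos[of "\<rho> t"] by (simp add: o_def w[OF t] r)
    from DERIV_diff[OF L(4)[OF t] this]
    show "((\<lambda>t. \<theta> t - Bf G p (\<rho> t)) has_real_derivative 0) (at t within ?I)" by simp
  qed
  have \<rho>0: "\<rho> 0 = 0" using bdry(1) by (auto simp: \<rho>_def s_def ht_def)
  obtain k where "\<And>t. t \<in> ?I \<Longrightarrow> Af G p (\<rho> t) - t = k"
    using has_field_derivative_zero_constant[OF convex_real_interval(5) dA] by blast
  from this[OF I(1)] this[OF I(2)] have AT: "Af G p (\<rho> T) = T" by (simp add: \<rho>0)
  obtain k where "\<And>t. t \<in> ?I \<Longrightarrow> \<theta> t - Bf G p (\<rho> t) = k"
    using has_field_derivative_zero_constant[OF convex_real_interval(5) dB] by blast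
  from this[OF I(1)] this[OF I(2)] have BT: "\<theta> T = \<theta> 0 + Bf G p (\<rho> T)" by (simp add: \<rho>0)
  \<comment> \<open>Travel time to height 0 is 0, but \<open>T > 0\<close>. Hence the geodesic is
    not back on its initial circle, and being on the boundary it has reached the other one.\<close>
  have "\<rho> T \<noteq> 0" using AT \<gamma>(2) by auto
  then have \<rho>T: "\<rho> T = hgt" using bdry(2) by (auto simp: \<rho>_def ht_def split: if_splits)
  have P0: "\<gamma> 0 = pt (cis (\<theta> 0)) (ht s 0)" using L(1)[OF I(1)] r[of 0] \<rho>0 by simp
  have PT: "\<gamma> T = pt (cis (\<theta> 0 + Bf G p hgt)) (ht s hgt)" using L(1)[OF I(2)] r[of T] BT \<rho>T by simp
  have w0: "w 0 = p" "w T = p"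
    using w[OF I(1)] w[OF I(2)] G_end[OF bdry(1)] G_end[OF bdry(2)] by simp_all
  have "bdry_proj (rev_mfd G) (\<gamma> 0, velocity (rev_mfd G) ?I \<gamma> 0) = (\<gamma> 0, tangential (\<gamma> 0) p)"
    "bdry_proj (rev_mfd G) (\<gamma> T, velocity (rev_mfd G) ?I \<gamma> T) = (\<gamma> T, tangential (\<gamma> T) p)"
    using bdry_proj_vec_at[OF b(1) vel[OF I(1)]] bdry_proj_vec_at[OF b(2) vel[OF I(2)]] w0 by simp_all
  moreover have "T = Af G p hgt" using AT \<rho>T by simp
  ultimately show ?thesis
    unfolding clairaut_lens_def mem_Collect_eq using p1 P0 PT
    by (intro exI[of _ "\<gamma> 0"] exI[of _ "\<gamma> T"] exI[of _ p] conjI exI[of _ "\<theta> 0"] exI[of _ s]) simp_all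
qed

lemma lens_Omega'_subset:
  "lens_Omega' (rev_mfd G) \<subseteq> clairaut_lens (\<lambda>p. Af G p hgt) (\<lambda>p. Bf G p hgt)"
proof
  fix x assume "x \<in> lens_Omega' (rev_mfd G)"
  then obtain \<gamma> T where \<gamma>: "0 < T" "unit_speed_geodesic_on (rev_mfd G) {0..T} \<gamma>"
    "\<gamma> 0 \<in> bdry (rev_mfd G)" "\<gamma> T \<in> bdry (rev_mfd G)"
    "0 < ginner (rev_mfd G) (\<gamma> 0) (velocity (rev_mfd G) {0..T} \<gamma> 0) (inward_normal (rev_mfd G) (\<gamma> 0))"
    and x: "x = (bdry_proj (rev_mfd G) (\<gamma> 0, velocity (rev_mfd G) {0..T} \<gamma> 0),
      bdry_proj (rev_mfd G) (\<gamma> T, velocity (rev_mfd G) {0..T} \<gamma> T), T)"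
    unfolding lens_Omega'_def lens_Omega_def by auto
  show "x \<in> clairaut_lens (\<lambda>p. Af G p hgt) (\<lambda>p. Bf G p hgt)"
    unfolding x by (rule geodesic_traverse[OF \<gamma>(2,1,3,4,5)])
qed

text \<open>Height as a function of time along a unit-speed geodesic is the inverse of travel time.
  This solves \<open>\<rho>' = qf G p \<rho>\<close> by quadrature, with one-sided derivatives at
  both ends.\<close>

lemma Af_inverse:
  assumes p: "\<bar>p\<bar> < 1"
  obtains \<rho> where "\<forall>t\<in>{0..Af G p hgt}. \<rho> t \<in> {0..hgt} \<and> Af G p (\<rho> t) = t"
    "\<forall>t\<in>{0..Af G p hgt}. (\<rho> has_real_derivative qf G p (\<rho> t)) (at t within {0..Af G p hgt})"
proof -
  let ?A = "Af G p"
  define \<rho> where "\<rho> = inv_into {0..hgt} ?A"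
  have c: "continuous_on {0..hgt} ?A" by (rule DERIV_continuous_on[OF Af_deriv[OF p]])
  have inj: "inj_on ?A {0..hgt}"
  proof (rule inj_onI)
    fix x y assume xy: "x \<in> {0..hgt}" "y \<in> {0..hgt}" and eq: "?A x = ?A y"
    have "x \<le> y \<Longrightarrow> y - x \<le> ?A y - ?A x" "y \<le> x \<Longrightarrow> x - y \<le> ?A x - ?A y"
      by (rule Af_increase[OF p]; use xy in simp)+
    then show "x = y" using eq by linarith
  qed
  have im: "?A ` {0..hgt} = {0..?A hgt}"
  proof (intro equalityI subsetI)
    fix y assume "y \<in> ?A ` {0..hgt}"
    then obtain x where "x \<in> {0..hgt}" "y = ?A x" by blast
    then show "y \<in> {0..?A hgt}"
      using Af_increase[OF p, of 0 x] Af_increase[OF p, of x hgt] by simp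
  next
    fix y assume y: "y \<in> {0..?A hgt}"
    have "\<exists>x\<ge>0. x \<le> hgt \<and> ?A x = y"
      by (rule IVT'[OF _ _ _ c]) (use y in simp_all)
    then obtain x where "0 \<le> x" "x \<le> hgt" "?A x = y" by (elim exE conjE)
    then show "y \<in> ?A ` {0..hgt}" by (intro image_eqI[of _ _ x]) simp_all
  qed
  have \<rho>: "\<rho> t \<in> {0..hgt}" "?A (\<rho> t) = t" if "t \<in> {0..?A hgt}" for t
    using that unfolding im[symmetric] \<rho>_def by (rule inv_into_into f_inv_into_f)+
  have "continuous_on (?A ` {0..hgt}) \<rho>"
    by (rule continuous_on_inv[OF c compact_Icc]) (use inj inv_into_f_f in \<open>simp add: \<rho>_def\<close>)
  then have c\<rho>: "continuous_on {0..?A hgt} \<rho>" unfolding im .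
  have "(\<rho> has_real_derivative qf G p (\<rho> t)) (at t within {0..?A hgt})" if t: "t \<in> {0..?A hgt}" for t
  proof -
    have "0 < qf G p (\<rho> t)" by (rule qf_bounds(2)[OF p])
    then have "(\<rho> has_real_derivative 1 / (1 / qf G p (\<rho> t))) (at t within {0..?A hgt})"
      by (intro inverse_deriv_within[OF Af_deriv[OF p \<rho>(1)[OF t]] _ c\<rho> _ t \<rho>(2)] image_subsetI \<rho>(1)) auto
    then show ?thesis by simp
  qed
  then show thesis by (intro that[of \<rho>] ballI conjI \<rho>)
qed

end

section \<open>From Clairaut data to geodesics\<close>

context profile begin

lemma Af_end_pos: "\<bar>p\<bar> < 1 \<Longrightarrow> 0 < Af G p hgt"
  using Af_increase[of p 0 hgt] less_le_trans[OF hgt_pos(1), of "Af G p hgt"] by simp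

lemma qf_deriv:
  assumes "\<bar>p\<bar> < 1"
  shows "(qf G p has_real_derivative p\<^sup>2 * G' x / (G x)\<^sup>2 / (2 * qf G p x)) (at x)"
proof -
  have "0 < 1 - p\<^sup>2 / G x" using p2_G(3)[OF assms, of x] by simp
  moreover have "((\<lambda>x. 1 - p\<^sup>2 / G x) has_real_derivative p\<^sup>2 * G' x / (G x)\<^sup>2) (at x)"
    by (auto intro!: derivative_eq_intros G_deriv simp: power2_eq_square)
  ultimately have "((\<lambda>x. sqrt (1 - p\<^sup>2 / G x)) has_real_derivative
      inverse (sqrt (1 - p\<^sup>2 / G x)) / 2 * (p\<^sup>2 * G' x / (G x)\<^sup>2)) (at x)"
    by (intro DERIV_chain2[OF DERIV_real_sqrt])
  then show ?thesis by (simp add: qf_def[abs_def] field_simps)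
qed

text \<open>The curve with height \<open>\<rho>\<close> from \<open>Af_inverse\<close> and angle
  \<open>Bf G p \<rho>\<close> satisfies the first-order equations of Clairaut; differentiating them
  once more gives the geodesic equation, also at both ends.\<close>

lemma lens_Omega'_superset:
  "clairaut_lens (\<lambda>p. Af G p hgt) (\<lambda>p. Bf G p hgt) \<subseteq> lens_Omega' (rev_mfd G)"
proof
  fix x assume "x \<in> clairaut_lens (\<lambda>p. Af G p hgt) (\<lambda>p. Bf G p hgt)"
  then obtain P P' p a s where x: "x = ((P, tangential P p), (P', tangential P' p), Af G p hgt)"
    and p: "\<bar>p\<bar> < 1" and P: "P = pt (cis a) (ht s 0)" and P': "P' = pt (cis (a + Bf G p hgt)) (ht s hgt)"
    unfolding clairaut_lens_def by auto
  let ?T = "Af G p hgt"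
  let ?I = "{0..?T}"
  have T: "0 < ?T" by (rule Af_end_pos[OF p])
  have I: "0 \<in> ?I" "?T \<in> ?I" using T by simp_all
  obtain \<rho> where \<rho>': "\<forall>t\<in>?I. \<rho> t \<in> {0..hgt} \<and> Af G p (\<rho> t) = t"
    and d\<rho>': "\<forall>t\<in>?I. (\<rho> has_real_derivative qf G p (\<rho> t)) (at t within ?I)"
    by (rule Af_inverse[OF p])
  note \<rho> = \<rho>'[THEN bspec] and d\<rho> = d\<rho>'[THEN bspec]
  have q: "0 < qf G p y" for y by (rule qf_bounds(2)[OF p])
  have \<rho>0: "\<rho> 0 = 0" using \<rho>[OF I(1)] Af_increase[OF p, of 0 "\<rho> 0"] by simp
  have \<rho>T: "\<rho> ?T = hgt" using \<rho>[OF I(2)] Af_increase[OF p, of "\<rho> ?T" hgt] by simp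
  define \<gamma> where "\<gamma> t = pt (cis (a + Bf G p (\<rho> t))) (ht s (\<rho> t))" for t
  define w where "w t = p / G (\<rho> t)" for t
  define v where "v t = sg s * qf G p (\<rho> t)" for t
  have l: "lifted ?I \<gamma> (\<lambda>t. a + Bf G p (\<rho> t)) (\<lambda>t. ht s (\<rho> t)) w v"
    unfolding lifted_def
  proof (intro ballI conjI)
    fix t assume t: "t \<in> ?I"
    show "\<gamma> t = pt (cis (a + Bf G p (\<rho> t))) (ht s (\<rho> t))" by (simp add: \<gamma>_def)
    show "0 \<le> ht s (\<rho> t)" "ht s (\<rho> t) \<le> hgt" using \<rho>[OF t] by simp_all
    show "((\<lambda>t. ht s (\<rho> t)) has_real_derivative v t) (at t within ?I)"
      unfolding v_def by (rule ht_deriv[OF d\<rho>[OF t]])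
    have "\<rho> ` ?I \<subseteq> {0..hgt}" using \<rho> by blast
    then have "(Bf G p has_real_derivative p / (G (\<rho> t) * qf G p (\<rho> t))) (at (\<rho> t) within \<rho> ` ?I)"
      using \<rho>[OF t] by (intro has_field_derivative_subset[OF Bf_deriv[OF p]]) simp_all
    from DERIV_image_chain[OF this d\<rho>[OF t]]
    have "((\<lambda>t. Bf G p (\<rho> t)) has_real_derivative w t) (at t within ?I)"
      using q[of "\<rho> t"] by (simp add: o_def w_def)
    from DERIV_add[OF DERIV_const this]
    show "((\<lambda>t. a + Bf G p (\<rho> t)) has_real_derivative w t) (at t within ?I)" by simp
  qed
  have \<gamma>2: "\<gamma> t 2 = ht s (\<rho> t)" for t by (simp add: \<gamma>_def)
  have \<gamma>c: "\<gamma> t \<in> cyl" if "t \<in> ?I" for t using lifted_cont(4)[OF l] that by blast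
  have dw: "(w has_real_derivative - p * G' (\<rho> t) * qf G p (\<rho> t) / (G (\<rho> t))\<^sup>2) (at t within ?I)"
    and dv: "(v has_real_derivative sg s * (p\<^sup>2 * G' (\<rho> t) / (2 * (G (\<rho> t))\<^sup>2))) (at t within ?I)"
    if t: "t \<in> ?I" for t
  proof -
    have dG: "((\<lambda>t. G (\<rho> t)) has_real_derivative G' (\<rho> t) * qf G p (\<rho> t)) (at t within ?I)"
      by (rule DERIV_chain2[OF G_deriv d\<rho>[OF t]])
    show "(w has_real_derivative - p * G' (\<rho> t) * qf G p (\<rho> t) / (G (\<rho> t))\<^sup>2) (at t within ?I)"
      unfolding w_def using DERIV_divide[OF DERIV_const dG, of p] by (simp add: power2_eq_square mult.assoc)
    have "((\<lambda>t. qf G p (\<rho> t)) has_real_derivative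
        p\<^sup>2 * G' (\<rho> t) / (G (\<rho> t))\<^sup>2 / (2 * qf G p (\<rho> t)) * qf G p (\<rho> t)) (at t within ?I)"
      by (rule DERIV_chain2[OF qf_deriv[OF p] d\<rho>[OF t]])
    \<comment> \<open>The factor \<open>qf\<close> from the chain rule cancels the \<open>qf\<close>
      in the denominator of its derivative.\<close>
    then have "((\<lambda>t. qf G p (\<rho> t)) has_real_derivative p\<^sup>2 * G' (\<rho> t) / (2 * (G (\<rho> t))\<^sup>2)) (at t within ?I)"
      using q[of "\<rho> t"] by (simp add: field_simps)
    then show "(v has_real_derivative sg s * (p\<^sup>2 * G' (\<rho> t) / (2 * (G (\<rho> t))\<^sup>2))) (at t within ?I)"
      unfolding v_def by (rule DERIV_cmult)
  qed
  have "geodesic_on (rev_mfd G) ?I \<gamma>"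
    unfolding geodesic_on_rev_mfd
  proof (intro conjI allI)
    show "continuous_on ?I \<gamma>" "\<gamma> \<in> ?I \<rightarrow> cyl" by (rule lifted_cont[OF l])+
    fix \<alpha> s'
    let ?C = "chart_times ?I \<gamma> (ch \<alpha> s')"
    \<comment> \<open>In the chart \<open>ch \<alpha> s'\<close> height components carry the sign
      \<open>sg s'\<close>. It is independent of \<open>s\<close>, which marks the starting end of
      the geodesic.\<close>
    define V where "V k t = (if k = 0 then w t else sg s' * v t)" for k :: nat and t
    define A where "A k t = (if k = 0 then - p * G' (\<rho> t) * qf G p (\<rho> t) / (G (\<rho> t))\<^sup>2
      else sg s' * (sg s * (p\<^sup>2 * G' (\<rho> t) / (2 * (G (\<rho> t))\<^sup>2))))" for k :: nat and t
    have "((\<lambda>u. coord \<alpha> s' (\<gamma> u) k) has_real_derivative V k t) (at t within ?C) \<and>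
      (V k has_real_derivative A k t) (at t within ?C) \<and>
      (if k = 0 then G (\<gamma> t 2) * A 0 t + G' (ht s' (\<gamma> t 2)) * V 0 t * V 1 t
       else A 1 t - G' (ht s' (\<gamma> t 2)) / 2 * (V 0 t)\<^sup>2) = 0"
      if t: "t \<in> ?C" and k: "k < 2" for t k
    proof -
      have tI: "t \<in> ?I" "\<gamma> t \<in> cdom \<alpha> s'" using t by (simp_all add: chart_times_def)
      have at: "at t within ?C = at t within ?I"
        by (rule at_chart_times[OF lifted_cont(3,4)[OF l] t])
      have "((\<lambda>u. coord \<alpha> s' (\<gamma> u) k) has_real_derivative V k t) (at t within ?I)"
        using coord_lifted_deriv[OF l tI] less_2_cases[OF k] by (auto simp: V_def)
      moreover have "(V k has_real_derivative A k t) (at t within ?I)"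
      proof (cases "k = 0")
        case True
        then show ?thesis using dw[OF tI(1)] unfolding V_def A_def by simp
      next
        case False
        then show ?thesis using DERIV_cmult[OF dv[OF tI(1)], of "sg s'"] unfolding V_def A_def by simp
      qed
      moreover have "G (\<gamma> t 2) * A 0 t + G' (ht s' (\<gamma> t 2)) * V 0 t * V 1 t = 0"
      proof -
        have "G' (ht s' (\<gamma> t 2)) * V 0 t * V 1 t = (sg s * sg s) * (sg s' * sg s') * (G' (\<rho> t) * w t * qf G p (\<rho> t))"
          by (simp add: V_def v_def \<gamma>2 G'_ht mult_ac)
        then show ?thesis by (simp add: \<gamma>2 A_def w_def power2_eq_square)
      qed
      moreover have "A 1 t - G' (ht s' (\<gamma> t 2)) / 2 * (V 0 t)\<^sup>2 = 0"
        by (simp add: \<gamma>2 A_def V_def w_def G'_ht power_divide)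
      ultimately show ?thesis unfolding at by simp
    qed
    then show "\<exists>V A. \<forall>t\<in>?C. \<forall>k<2. ((\<lambda>u. coord \<alpha> s' (\<gamma> u) k) has_real_derivative V k t) (at t within ?C) \<and>
      (V k has_real_derivative A k t) (at t within ?C) \<and>
      (if k = 0 then G (\<gamma> t 2) * A 0 t + G' (ht s' (\<gamma> t 2)) * V 0 t * V 1 t
       else A 1 t - G' (ht s' (\<gamma> t 2)) / 2 * (V 0 t)\<^sup>2) = 0"
      by (intro exI[of _ V] exI[of _ A] ballI allI impI)
  qed
  moreover
  note vel = velocity_lifted[OF l T, where G = G]
  have "ginner (rev_mfd G) (\<gamma> t) (velocity (rev_mfd G) ?I \<gamma> t) (velocity (rev_mfd G) ?I \<gamma> t) = 1"
    if t: "t \<in> ?I" for t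
  proof -
    have "G (\<rho> t) * w t * w t = p\<^sup>2 / G (\<rho> t)" by (simp add: w_def power2_eq_square)
    moreover have "v t * v t = 1 - p\<^sup>2 / G (\<rho> t)"
    proof -
      have "v t * v t = (qf G p (\<rho> t))\<^sup>2" by (simp add: v_def sg_def power2_eq_square)
      then show ?thesis using qf_square[of p "\<rho> t"] p by simp
    qed
    ultimately show ?thesis
      using ginner_vec_at[OF \<gamma>c[OF t] vel[OF t] vel[OF t]] by (simp add: \<gamma>2)
  qed
  ultimately have unit: "unit_speed_geodesic_on (rev_mfd G) ?I \<gamma>"
    unfolding unit_speed_geodesic_on_def by blast
  have \<gamma>0: "\<gamma> 0 = P" and \<gamma>T: "\<gamma> ?T = P'" by (simp_all add: \<gamma>_def P P' \<rho>0 \<rho>T)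
  have b: "\<gamma> 0 \<in> bdry (rev_mfd G)" "\<gamma> ?T \<in> bdry (rev_mfd G)"
    using \<gamma>c[OF I(1)] \<gamma>c[OF I(2)] unfolding \<gamma>0 \<gamma>T by (cases s; simp add: bdry_rev_mfd P P')+
  have "(\<gamma> 0 2 = 0) = s" by (cases s) (simp_all add: \<gamma>0 P)
  then have "ginner (rev_mfd G) (\<gamma> 0) (velocity (rev_mfd G) ?I \<gamma> 0) (inward_normal (rev_mfd G) (\<gamma> 0)) = v 0 * sg s"
    using ginner_vec_at[OF \<gamma>c[OF I(1)] vel[OF I(1)] vec_at_normal[OF b(1)]]
    unfolding inward_normal_eq[OF b(1)] by simp
  also have "v 0 * sg s = qf G p (\<rho> 0)" by (simp add: v_def sg_def)
  finally have n: "0 < ginner (rev_mfd G) (\<gamma> 0) (velocity (rev_mfd G) ?I \<gamma> 0) (inward_normal (rev_mfd G) (\<gamma> 0))"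
    using q by simp
  have inner: "\<gamma> t \<notin> bdry (rev_mfd G)" if t: "0 < t" "t < ?T" for t
  proof -
    have tI: "t \<in> ?I" using t by simp
    \<comment> \<open>\<open>Af\<close> takes the values 0 and \<open>?T\<close> at the two ends,
      but the value \<open>t\<close>, strictly in between, at \<open>\<rho> t\<close>.\<close>
    have "\<rho> t \<noteq> 0" "\<rho> t \<noteq> hgt" using \<rho>[OF tI] t by auto
    then show ?thesis by (cases s) (simp_all add: bdry_rev_mfd \<gamma>2)
  qed
  have "((\<gamma> 0, velocity (rev_mfd G) ?I \<gamma> 0), (\<gamma> ?T, velocity (rev_mfd G) ?I \<gamma> ?T), ?T) \<in> lens_Omega (rev_mfd G)"
    unfolding lens_Omega_def mem_Collect_eq
    using T unit b n inner by (intro exI[of _ \<gamma>] exI[of _ ?T] conjI refl allI impI) simp_all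
  moreover have "w 0 = p" "w ?T = p" using G_end by (simp_all add: w_def \<rho>0 \<rho>T)
  then have "bdry_proj (rev_mfd G) (\<gamma> 0, velocity (rev_mfd G) ?I \<gamma> 0) = (P, tangential P p)"
    "bdry_proj (rev_mfd G) (\<gamma> ?T, velocity (rev_mfd G) ?I \<gamma> ?T) = (P', tangential P' p)"
    using bdry_proj_vec_at[OF b(1) vel[OF I(1)]] bdry_proj_vec_at[OF b(2) vel[OF I(2)]] \<gamma>0 \<gamma>T by simp_all
  ultimately show "x \<in> lens_Omega' (rev_mfd G)"
    unfolding lens_Omega'_def x by (intro image_eqI[rotated]) (assumption, simp)
qed

lemma lens_Omega'_rev_mfd:
  "lens_Omega' (rev_mfd G) = clairaut_lens (\<lambda>p. Af G p hgt) (\<lambda>p. Bf G p hgt)"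
  by (rule equalityI[OF lens_Omega'_subset lens_Omega'_superset])

end

section \<open>The boundary isometry\<close>

definition bbox :: "(nat \<Rightarrow> real) set" where "bbox = {x \<in> hbox. x 1 = 0}"

text \<open>The shape of the coordinate representations of the identity between boundary charts. An
  overlap can consist of two arcs with different shifts, so the translation is only local.\<close>

definition local_translation :: "(nat \<Rightarrow> real) set \<Rightarrow> ((nat \<Rightarrow> real) \<Rightarrow> real) \<Rightarrow> bool" where
  "local_translation S f \<longleftrightarrow> (\<forall>x\<in>S. \<exists>\<epsilon>>0. \<forall>y\<in>S. \<bar>y 0 - x 0\<bar> < \<epsilon> \<longrightarrow> f y = f x + (y 0 - x 0))"

lemma bbox_right_open:
  assumes "openin (top_of_set bbox) S" "x \<in> S"
  shows "\<exists>\<epsilon>>0. \<forall>u. x 0 \<le> u \<and> u < x 0 + \<epsilon> \<longrightarrow> x(0 := u) \<in> S"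
proof (rule right_open[OF assms])
  have "x \<in> bbox" using assms openin_subset by fastforce
  then show "\<exists>\<epsilon>>0. \<forall>u. x 0 \<le> u \<and> u < x 0 + \<epsilon> \<longrightarrow> x(0 := u) \<in> bbox"
    by (intro exI[of _ "pi - x 0"]) (auto simp: bbox_def hbox_def)
qed

lemma partial_deriv_translation:
  assumes "openin (top_of_set bbox) S" "local_translation S f" "x \<in> S"
  shows "partial_deriv S 0 f x = 1"
proof -
  obtain \<epsilon> where \<epsilon>: "0 < \<epsilon>" "\<And>u. x 0 \<le> u \<Longrightarrow> u < x 0 + \<epsilon> \<Longrightarrow> x(0 := u) \<in> S"
    using bbox_right_open[OF assms(1,3)] by auto
  obtain \<delta> where \<delta>: "0 < \<delta>" "\<forall>y\<in>S. \<bar>y 0 - x 0\<bar> < \<delta> \<longrightarrow> f y = f x + (y 0 - x 0)"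
    using assms(2,3) unfolding local_translation_def by blast
  define g where "g u = f x + (u - x 0)" for u
  have g: "(g has_real_derivative 1) (at (x 0))"
    unfolding g_def by (auto intro!: derivative_eq_intros)
  show ?thesis
  proof (rule partial_deriv_eqI[where g = g and \<epsilon> = "min \<epsilon> \<delta>"])
    fix u assume "\<bar>u - x 0\<bar> < min \<epsilon> \<delta>" and S: "x(0 := u) \<in> S"
    then show "f (x(0 := u)) = g u" using bspec[OF \<delta>(2) S] by (simp add: g_def)
  qed (use \<epsilon> \<delta>(1) g in simp_all)
qed

text \<open>Constancy is assumed on \<open>S\<close> only, since a partial derivative is controlled
  only there. Relative openness of \<open>S\<close> determines the derivative on \<open>S\<close> as
  0, and the induction continues with that constant.\<close>

lemma Ck_on_const:
  assumes "openin (top_of_set bbox) S"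
  shows "(\<forall>x\<in>S. f x = c) \<Longrightarrow> Ck_on r 1 S f"
proof (induction r arbitrary: f c)
  case 0
  then show ?case by (simp cong: continuous_on_cong)
next
  case (Suc r)
  have c: "continuous_on S f" using Suc.prems by (simp cong: continuous_on_cong)
  have d: "(\<lambda>s. f (x(0 := s))) differentiable (at (x 0) within {s. x(0 := s) \<in> S})" if "x \<in> S" for x
  proof -
    have "((\<lambda>s. f (x(0 := s))) has_derivative (\<lambda>_. 0)) (at (x 0) within {s. x(0 := s) \<in> S})"
      by (rule has_derivative_transform_within[OF has_derivative_const[of c] zero_less_one])
        (use Suc.prems that in simp_all)
    then show ?thesis by (rule differentiableI)
  qed
  have "partial_deriv S 0 f x = 0" if x: "x \<in> S" for x
  proof -
    obtain \<epsilon> where \<epsilon>: "0 < \<epsilon>" "\<And>u. x 0 \<le> u \<Longrightarrow> u < x 0 + \<epsilon> \<Longrightarrow> x(0 := u) \<in> S"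
      using bbox_right_open[OF assms x] by auto
    show ?thesis
      by (rule partial_deriv_eqI[where \<epsilon> = \<epsilon> and g = "\<lambda>_. c"]) (use \<epsilon> Suc.prems in simp_all)
  qed
  then have "Ck_on r 1 S (partial_deriv S 0 f)" by (intro Suc.IH[of _ 0]) simp
  with c d show ?case by simp
qed

lemma smooth_translation:
  assumes S: "openin (top_of_set bbox) S" and f: "local_translation S f"
  shows "smooth_fun_on 1 S f"
proof -
  have c: "continuous_on S f"
    unfolding continuous_on_def
  proof
    fix x assume x: "x \<in> S"
    obtain \<delta> where \<delta>: "0 < \<delta>" "\<forall>y\<in>S. \<bar>y 0 - x 0\<bar> < \<delta> \<longrightarrow> f y = f x + (y 0 - x 0)"
      using f x unfolding local_translation_def by blast
    have "continuous_on S (\<lambda>y. f x + (y 0 - x 0))"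
      by (intro continuous_on_add continuous_on_diff continuous_on_const continuous_on_app)
    then have "((\<lambda>y. f x + (y 0 - x 0)) \<longlongrightarrow> f x + (x 0 - x 0)) (at x within S)"
      using x unfolding continuous_on_def by (rule bspec)
    then have "((\<lambda>y. f x + (y 0 - x 0)) \<longlongrightarrow> f x) (at x within S)" by simp
    moreover have "\<forall>\<^sub>F y in at x within S. f x + (y 0 - x 0) = f y"
    proof -
      have "open {y. \<bar>y (0::nat) - x 0\<bar> < \<delta>}"
        by (rule open_Collect_less)
          (rule continuous_on_rabs continuous_on_diff continuous_on_const continuous_on_app)+
      then show ?thesis
        unfolding eventually_at_topological using \<delta> by (intro exI[of _ "{y. \<bar>y 0 - x 0\<bar> < \<delta>}"]) simp
    qed
    ultimately show "(f \<longlongrightarrow> f x) (at x within S)" by (rule Lim_transform_eventually)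
  qed
  have d: "(\<lambda>s. f (x(0 := s))) differentiable (at (x 0) within {s. x(0 := s) \<in> S})" if x: "x \<in> S" for x
  proof -
    obtain \<delta> where \<delta>: "0 < \<delta>" "\<forall>y\<in>S. \<bar>y 0 - x 0\<bar> < \<delta> \<longrightarrow> f y = f x + (y 0 - x 0)"
      using f x unfolding local_translation_def by blast
    have "((\<lambda>u. f x + (u - x 0)) has_real_derivative 1) (at (x 0) within {s. x(0 := s) \<in> S})"
      by (auto intro!: derivative_eq_intros)
    then have "((\<lambda>s. f (x(0 := s))) has_real_derivative 1) (at (x 0) within {s. x(0 := s) \<in> S})"
    proof (rule has_field_derivative_transform_within[OF _ \<delta>(1)])
      fix u assume "u \<in> {s. x(0 := s) \<in> S}" "dist u (x 0) < \<delta>"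
      then show "f x + (u - x 0) = f (x(0 := u))"
        using bspec[OF \<delta>(2), of "x(0 := u)"] by (simp add: dist_real_def)
    qed (use x in simp)
    then show ?thesis by (meson differentiableI has_field_derivative_imp_has_derivative)
  qed
  \<comment> \<open>The first derivative is constantly 1 on \<open>S\<close>, so all orders follow
    from the constant case.\<close>
  have "Ck_on r 1 S (partial_deriv S 0 f)" for r
    by (rule Ck_on_const[OF S, of _ 1]) (simp add: partial_deriv_translation[OF S f])
  then have "Ck_on r 1 S f" for r
    using c d by (cases r) simp_all
  then show ?thesis by (simp add: smooth_fun_on_def)
qed

lemma unco_in_bdry_iff: "x \<in> hbox \<Longrightarrow> unco \<alpha> s x \<in> bdry (rev_mfd G) \<longleftrightarrow> x 1 = 0"
  by (cases s) (auto simp: bdry_rev_mfd unco_def hbox_def)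

definition bdry_overlap :: "real \<Rightarrow> bool \<Rightarrow> real \<Rightarrow> bool \<Rightarrow> (nat \<Rightarrow> real) set" where
  "bdry_overlap \<alpha> s \<beta> t = {x \<in> bbox. unco \<alpha> s x \<in> cdom \<beta> t}"

lemma openin_bdry_overlap: "openin (top_of_set bbox) (bdry_overlap \<alpha> s \<beta> t)"
proof -
  have "openin (top_of_set bbox) (bbox \<inter> unco \<alpha> s -` cdom \<beta> t)"
  proof (rule continuous_openin_preimage[OF continuous_on_unco _ openin_cdom])
    show "unco \<alpha> s \<in> bbox \<rightarrow> cyl"
      using subsetD[OF cdom_subset unco_in_cdom] by (simp add: bbox_def Pi_iff)
  qed
  moreover have "bbox \<inter> unco \<alpha> s -` cdom \<beta> t = bdry_overlap \<alpha> s \<beta> t" by (auto simp: bdry_overlap_def)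
  ultimately show ?thesis by simp
qed

lemma bdry_overlap_translation:
  assumes "\<And>x. x \<in> bdry_overlap \<alpha> s \<beta> t \<Longrightarrow> f x = coord \<beta> t (unco \<alpha> s x) 0"
  shows "local_translation (bdry_overlap \<alpha> s \<beta> t) f"
  unfolding local_translation_def
proof
  let ?S = "bdry_overlap \<alpha> s \<beta> t"
  fix x assume x: "x \<in> ?S"
  then have "x \<in> hbox" "unco \<alpha> s x \<in> cdom \<beta> t" by (simp_all add: bdry_overlap_def bbox_def)
  from transition_local[OF this] obtain \<epsilon> where \<epsilon>: "\<epsilon> > 0" "\<forall>y. \<bar>y 0 - x 0\<bar> < \<epsilon> \<longrightarrow>
    coord \<beta> t (unco \<alpha> s y) 0 = coord \<beta> t (unco \<alpha> s x) 0 + (y 0 - x 0)" by blast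
  have "f y = f x + (y 0 - x 0)" if "y \<in> ?S" "\<bar>y 0 - x 0\<bar> < \<epsilon>" for y
    unfolding assms[OF that(1)] assms[OF x] using \<epsilon>(2)[THEN spec[of _ y], THEN mp, OF that(2)] .
  then show "\<exists>\<epsilon>>0. \<forall>y\<in>?S. \<bar>y 0 - x 0\<bar> < \<epsilon> \<longrightarrow> f y = f x + (y 0 - x 0)"
    by (intro exI[of _ \<epsilon>] conjI ballI impI \<epsilon>(1))
qed

lemma bdry_subchart_image:
  assumes "subchart \<alpha> s e" "W \<subseteq> fst e" "W = {p \<in> cdom \<alpha> s \<inter> bdry (rev_mfd G). p \<in> cdom \<beta> t}"
  shows "snd e ` W = bdry_overlap \<alpha> s \<beta> t"
proof -
  have "unco \<alpha> s x \<in> W \<longleftrightarrow> x 1 = 0 \<and> unco \<alpha> s x \<in> cdom \<beta> t" if "x \<in> hbox" for x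
    using unco_in_bdry_iff[OF that, of \<alpha> s G] unco_in_cdom[OF that] assms(3) by simp
  then show ?thesis
    unfolding subchart_image[OF assms(1,2)] bdry_overlap_def bbox_def by auto
qed

text \<open>The map is assumed to be the identity on the boundary only, in order to cover
  \<open>inv_into\<close> of the boundary and \<open>id\<close>, which is unspecified
  elsewhere.\<close>

lemma bdry_rep_dom_id:
  assumes "\<forall>p\<in>bdry (rev_mfd G). \<phi> p = p"
  shows "bdry_rep_dom (rev_mfd G) \<phi> (ch \<alpha> s) (ch \<beta> t) = bdry_overlap \<alpha> s \<beta> t"
  unfolding bdry_rep_dom_def
  by (rule bdry_subchart_image[OF subchart_ch]) (use assms in auto)

lemma bdry_rep_id:
  assumes "\<forall>p\<in>bdry (rev_mfd G). \<phi> p = p" "x \<in> bdry_overlap \<alpha> s \<beta> t"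
  shows "bdry_rep \<phi> (ch \<alpha> s) (ch \<beta> t) k x = coord \<beta> t (unco \<alpha> s x) k"
proof -
  have x: "x \<in> hbox" "x 1 = 0" using assms(2) by (simp_all add: bdry_overlap_def bbox_def)
  then have "chart_inv (ch \<alpha> s) x = unco \<alpha> s x"
    by (intro chart_inv_subchart[OF subchart_ch]) (simp_all add: unco_in_cdom)
  then show ?thesis using x assms(1) unco_in_bdry_iff[OF x(1), of \<alpha> s G] by (simp add: bdry_rep_def)
qed

lemma smooth_bdry_map_id:
  assumes "\<forall>p\<in>bdry (rev_mfd G1). \<phi> p = p"
  shows "smooth_bdry_map (rev_mfd G1) (rev_mfd G2) \<phi>"
  unfolding smooth_bdry_map_def rev_mfd_simps ball_atlas
proof (intro allI impI)
  fix \<alpha> s \<beta> t and k :: nat assume "k < 2 - 1"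
  then have k: "k = 0" by simp
  have "smooth_fun_on 1 (bdry_overlap \<alpha> s \<beta> t) (bdry_rep \<phi> (ch \<alpha> s) (ch \<beta> t) 0)"
    by (intro smooth_translation[OF openin_bdry_overlap] bdry_overlap_translation bdry_rep_id[OF assms])
  then show "smooth_fun_on (2 - 1) (bdry_rep_dom (rev_mfd G1) \<phi> (ch \<alpha> s) (ch \<beta> t))
      (bdry_rep \<phi> (ch \<alpha> s) (ch \<beta> t) k)"
    unfolding bdry_rep_dom_id[OF assms] k by simp
qed

text \<open>Both manifolds have the same charts, and a local translation has derivative 1, so
  angular components are preserved.\<close>

lemma bdry_differential_id:
  assumes P: "P \<in> bdry (rev_mfd G1)"
  shows "bdry_differential (rev_mfd G1) (rev_mfd G2) id (P, tangential P w) = (P, tangential P w)"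
proof -
  have "P \<in> cyl" using P by (simp add: bdry_rev_mfd)
  then obtain \<alpha> s where c: "chart_at (rev_mfd G1) P = ch \<alpha> s" "P \<in> cdom \<alpha> s"
    by (rule chart_at_rev_mfd)
  have i: "\<forall>p\<in>bdry (rev_mfd G1). id p = p" by simp
  have pd: "partial_deriv (bdry_rep_dom (rev_mfd G1) id (ch \<alpha> s) (ch \<beta> t)) 0
      (bdry_rep id (ch \<alpha> s) (ch \<beta> t) 0) (coord \<alpha> s P) = 1" if "P \<in> cdom \<beta> t" for \<beta> t
  proof -
    have "coord \<alpha> s P 1 = 0"
      using unco_in_bdry_iff[OF coord_in_hbox[OF c(2)], of \<alpha> s G1] P by (simp add: unco_coord[OF c(2)])
    then have "coord \<alpha> s P \<in> bdry_overlap \<alpha> s \<beta> t"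
      using that c(2) by (simp add: bdry_overlap_def bbox_def coord_in_hbox unco_coord)
    then show ?thesis
      unfolding bdry_rep_dom_id[of G1 id, OF i]
      by (intro partial_deriv_translation[OF openin_bdry_overlap] bdry_overlap_translation
          bdry_rep_id[of G1 id, OF i])
  qed
  have "snd (bdry_differential (rev_mfd G1) (rev_mfd G2) id (P, tangential P w)) d k = tangential P w d k" for d k
  proof (cases "(\<exists>\<beta> t. d = ch \<beta> t) \<and> P \<in> fst d \<and> k = 0")
    case True
    then obtain \<beta> t where d: "d = ch \<beta> t" "P \<in> cdom \<beta> t" and k: "k = 0" by auto
    have "tangential P w (ch \<alpha> s) 0 = w" "tangential P w (ch \<beta> t) 0 = w"
      using c(2) d(2) by (auto simp: tangential_def)
    then show ?thesis
      using pd[OF d(2)] d(2) by (auto simp: bdry_differential_def c(1) d(1) k Let_def)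
  next
    case False
    then show ?thesis
      by (auto simp: bdry_differential_def tangential_def)
  qed
  then show ?thesis by (simp add: bdry_differential_def prod_eq_iff fun_eq_iff)
qed

lemma inv_into_id: "p \<in> S \<Longrightarrow> inv_into S id p = p"
  using inv_into_f_f[of id S p] by simp

text \<open>Both profiles equal 1 at the ends, so both boundaries are the same pair of unit
  circles.\<close>

lemma bdry_isometry_id:
  assumes "profile G1 G1'" "profile G2 G2'"
  shows "bdry_isometry (rev_mfd G1) (rev_mfd G2) id"
proof -
  have B: "bdry (rev_mfd G1) = bdry (rev_mfd G2)" by (simp add: bdry_rev_mfd)
  have "ginner (rev_mfd G2) P (tangential P a) (tangential P b) = ginner (rev_mfd G1) P (tangential P a) (tangential P b)"
    if "P \<in> bdry (rev_mfd G1)" for P a b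
  proof -
    have P: "P \<in> cyl" "P 2 = 0 \<or> P 2 = hgt" using that by (simp_all add: bdry_rev_mfd)
    show ?thesis
      unfolding profile.ginner_vec_at[OF assms(1) P(1) vec_at_tangential vec_at_tangential]
        profile.ginner_vec_at[OF assms(2) P(1) vec_at_tangential vec_at_tangential]
        profile.G_end[OF assms(1) P(2)] profile.G_end[OF assms(2) P(2)] ..
  qed
  moreover have "homeomorphic_map (subtopology (top_of_set cyl) (bdry (rev_mfd G1)))
      (subtopology (top_of_set cyl) (bdry (rev_mfd G2))) id"
    unfolding B by (simp add: homeomorphic_map_id)
  moreover have "smooth_bdry_map (rev_mfd G1) (rev_mfd G2) id" by (rule smooth_bdry_map_id) simp
  moreover have "smooth_bdry_map (rev_mfd G2) (rev_mfd G1) (inv_into (bdry (rev_mfd G1)) id)"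
    by (rule smooth_bdry_map_id) (simp add: B inv_into_id)
  ultimately show ?thesis
    unfolding bdry_isometry_def
    by (auto simp: profile.bdry_tangent_space_eq[OF assms(1)] bdry_differential_id)
qed

section \<open>Boundary normal coordinates and jets\<close>

lemma adist_pos:
  assumes "cmod z = 1" "cmod z' = 1" "z \<noteq> z'"
  shows "0 < adist z z'"
proof -
  have n: "cmod (z' / z) = 1" using assms by (simp add: norm_divide)
  then have "z' / z \<noteq> 0" by (metis norm_zero zero_neq_one)
  then have "cis (Arg (z' / z)) = z' / z" using n by (simp add: cis_Arg sgn_div_norm)
  moreover have "z' / z \<noteq> 1" using assms by auto
  ultimately have "Arg (z' / z) \<noteq> 0" by (metis cis_zero)
  then show ?thesis by (simp add: adist_def)
qed

lemma closest_bdry_point_unique: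
  assumes "closest_bdry_point M p q" "closest_bdry_point M p q'"
  shows "q = q'"
proof (rule ccontr)
  assume "q \<noteq> q'"
  then have "mfd_dist M p q < mfd_dist M p q'" "mfd_dist M p q' < mfd_dist M p q"
    using assms unfolding closest_bdry_point_def by metis+
  then show False by simp
qed

lemma bdry_foot_eq: "closest_bdry_point M p q \<Longrightarrow> bdry_foot M p = q"
  unfolding bdry_foot_def by (rule the_equality) (assumption, rule closest_bdry_point_unique)

context profile begin

text \<open>On \<open>[0, 1]\<close> a square root is at least its argument. The bound says that a
  calibration with small \<open>m\<close> loses only second order in height.\<close>

lemma Qf_ge:
  assumes "0 \<le> m" "m \<le> 1" "0 \<le> r"
  shows "r * (1 - m\<^sup>2) \<le> Qf G m r"
proof -
  have "1 - m\<^sup>2 \<le> qf G m x" for x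
  proof -
    have "m\<^sup>2 / G x \<le> m\<^sup>2" using G_ge_1[of x] by (simp add: divide_le_eq mult_left_le_one_le mult_le_cancel_left1)
    moreover have y: "0 \<le> 1 - m\<^sup>2 / G x" "1 - m\<^sup>2 / G x \<le> 1" using p2_G[of m x] assms by simp_all
    moreover have "(1 - m\<^sup>2 / G x)\<^sup>2 \<le> 1 - m\<^sup>2 / G x"
      using mult_left_le[OF y(2,1)] by (simp add: power2_eq_square)
    then have "1 - m\<^sup>2 / G x \<le> qf G m x" unfolding qf_def by (rule real_le_rsqrt)
    ultimately show ?thesis by linarith
  qed
  then have "integral {0..r} (\<lambda>_. 1 - m\<^sup>2) \<le> integral {0..r} (qf G m)"
    by (intro integral_le integrable_const_ivl integrable_continuous_real continuous_on_qf)
  then show ?thesis using assms(3) by (simp add: Qf_def)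
qed

text \<open>Strictness is needed for the uniqueness of the closest boundary point. With \<delta> the
  angular distance and \<open>r\<close> the height, the form with constant \<open>m\<close> gains
  \<open>m * \<delta>\<close> in angle and loses at most \<open>r * m^2\<close> in height, so a
  small positive \<open>m\<close> wins.\<close>

lemma dist_gt_height:
  assumes P: "P \<in> cyl" "P' \<in> cyl" "zc P \<noteq> zc P'" "P' 2 = 0"
  shows "P 2 < mfd_dist (rev_mfd G) P P'"
proof -
  let ?r = "P 2" and ?\<delta> = "adist (zc P) (zc P')"
  \<comment> \<open>Any \<open>m\<close> in \<open>(0, 1]\<close> with
    \<open>r * m < \<delta>\<close> serves.\<close>
  define m where "m = ?\<delta> / (?\<delta> + ?r + 1)"
  have r: "0 \<le> ?r" by (rule cyl_props(2)[OF P(1)])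
  have \<delta>: "0 < ?\<delta>" by (rule adist_pos[OF cyl_props(1)[OF P(1)] cyl_props(1)[OF P(2)] P(3)])
  have m: "0 < m" "m \<le> 1" using r \<delta> by (simp_all add: m_def)
  have "?r * m < ?\<delta>"
  proof -
    have "?r * m = ?\<delta> * (?r / (?\<delta> + ?r + 1))" by (simp add: m_def)
    also have "\<dots> < ?\<delta> * 1" using r \<delta> by (intro mult_strict_left_mono) simp_all
    finally show ?thesis by simp
  qed
  then have "0 < m * (?\<delta> - ?r * m)" using m(1) by simp
  then have "?r < m * ?\<delta> + ?r * (1 - m\<^sup>2)" by (simp add: algebra_simps power2_eq_square)
  also have "\<dots> \<le> m * ?\<delta> + \<bar>Qf G m (P' 2) - Qf G m ?r\<bar>"
    using Qf_ge[of m ?r] m r by (simp add: P(4) Qf_def)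
  also have "\<dots> \<le> mfd_dist (rev_mfd G) P P'" using dist_ge[OF P(1,2), of m] m by simp
  finally show ?thesis .
qed

text \<open>Vertical segments realise the distances to both end circles, and all other points of the
  bottom circle are strictly farther. Half the height is where the two ends tie.\<close>

lemma closest_bdry_point_bottom:
  assumes p: "p \<in> cyl" and q: "q \<in> cyl" "q 2 = 0"
  shows "closest_bdry_point (rev_mfd G) p q \<longleftrightarrow> q = pt (zc p) 0 \<and> p 2 < hgt / 2"
proof -
  note cp = cyl_props[OF p]
  have b: "pt (zc p) 0 \<in> bdry (rev_mfd G)" "pt (zc p) hgt \<in> bdry (rev_mfd G)"
    using cp by (simp_all add: bdry_rev_mfd)
  have d: "mfd_dist (rev_mfd G) p (pt (zc p) 0) = p 2" "mfd_dist (rev_mfd G) p (pt (zc p) hgt) = hgt - p 2"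
    using dist_vertical[OF p, of "pt (zc p) 0"] dist_vertical[OF p, of "pt (zc p) hgt"] cp by simp_all
  show ?thesis
  proof
    assume c: "closest_bdry_point (rev_mfd G) p q"
    then have cl: "\<And>q'. q' \<in> bdry (rev_mfd G) \<Longrightarrow> q' \<noteq> q \<Longrightarrow> mfd_dist (rev_mfd G) p q < mfd_dist (rev_mfd G) p q'"
      unfolding closest_bdry_point_def by blast
    have "p 2 \<le> mfd_dist (rev_mfd G) p q" using dist_ge_height[OF p q(1)] q(2) cp by simp
    then have eq: "q = pt (zc p) 0" using cl[OF b(1)] d(1) by force
    moreover have "pt (zc p) hgt \<noteq> q" by (simp add: eq)
    ultimately show "q = pt (zc p) 0 \<and> p 2 < hgt / 2" using cl[OF b(2)] d by simp
  next
    assume a: "q = pt (zc p) 0 \<and> p 2 < hgt / 2"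
    have "p 2 < mfd_dist (rev_mfd G) p q'" if "q' \<in> bdry (rev_mfd G)" "q' \<noteq> q" for q'
    proof -
      have q': "q' \<in> cyl" "q' 2 = 0 \<or> q' 2 = hgt" using that(1) by (simp_all add: bdry_rev_mfd)
      show ?thesis
      proof (cases "q' 2 = 0")
        case True
        have "zc p \<noteq> zc q'" using that(2) cyl_props(4)[OF q'(1)] a True by auto
        then show ?thesis using dist_gt_height[OF p q'(1)] True by simp
      next
        case False
        then have "\<bar>hgt - p 2\<bar> \<le> mfd_dist (rev_mfd G) p q'"
          using dist_ge_height[OF p q'(1)] q'(2) by simp
        then show ?thesis using a by linarith
      qed
    qed
    then show "closest_bdry_point (rev_mfd G) p q"
      using a b(1) d(1) by (simp add: closest_bdry_point_def)
  qed
qed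

text \<open>Only the values of \<open>b\<close> on its domain are prescribed, so that the chart
  pushed forward by the identity, which agrees with the original one only there, is covered
  too.\<close>

lemma bnc_chart_bottom:
  assumes b: "fst b = {q \<in> cdom 0 True. q 2 = 0}" "\<forall>q\<in>fst b. snd b q = coord 0 True q"
  shows "fst (bnc_chart (rev_mfd G) b) = {p \<in> cdom 0 True. p 2 < hgt / 2}"
    and "subchart 0 True (bnc_chart (rev_mfd G) b)"
proof -
  have foot: "pt (zc p) 0 \<in> fst b" if "p \<in> cdom 0 True" for p
    using that cyl_props[of p] by (simp add: b(1) cdom_def)
  have cl: "closest_bdry_point (rev_mfd G) p (pt (zc p) 0)" if "p \<in> cyl" "p 2 < hgt / 2" for p
    using closest_bdry_point_bottom[OF that(1), of "pt (zc p) 0"] cyl_props[OF that(1)] that(2) by simp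
  show dom: "fst (bnc_chart (rev_mfd G) b) = {p \<in> cdom 0 True. p 2 < hgt / 2}"
  proof (intro equalityI subsetI)
    fix p assume "p \<in> fst (bnc_chart (rev_mfd G) b)"
    then obtain q where q: "p \<in> cyl" "q \<in> fst b" "closest_bdry_point (rev_mfd G) p q"
      by (auto simp: bnc_chart_def bnc_dom_def)
    then have qc: "q \<in> cdom 0 True" "q 2 = 0" by (simp_all add: b(1))
    then have "q \<in> cyl" using cdom_subset by blast
    then have qp: "q = pt (zc p) 0" "p 2 < hgt / 2"
      using closest_bdry_point_bottom[of p q] q qc by simp_all
    then have "p 2 < hgt" using hgt_pos(1) by linarith
    then show "p \<in> {p \<in> cdom 0 True. p 2 < hgt / 2}"
      using q(1) qc qp by (simp add: cdom_def)
  next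
    fix p assume p: "p \<in> {p \<in> cdom 0 True. p 2 < hgt / 2}"
    then have "p \<in> cyl" using cdom_subset by blast
    then show "p \<in> fst (bnc_chart (rev_mfd G) b)"
      using foot[of p] cl[of p] p by (auto simp: bnc_chart_def bnc_dom_def)
  qed
  show "subchart 0 True (bnc_chart (rev_mfd G) b)"
    unfolding subchart_def dom
  proof (intro conjI ballI)
    fix p assume p: "p \<in> {p \<in> cdom 0 True. p 2 < hgt / 2}"
    then have pc: "p \<in> cyl" "p \<in> cdom 0 True" using cdom_subset by blast+
    have f: "bdry_foot (rev_mfd G) p = pt (zc p) 0" by (rule bdry_foot_eq[OF cl]) (use pc p in simp_all)
    have "mfd_dist (rev_mfd G) p (pt (zc p) 0) = p 2"
      using dist_vertical[OF pc(1), of "pt (zc p) 0"] cyl_props[OF pc(1)] by simp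
    then have "bnc (rev_mfd G) b p = (coord 0 True (pt (zc p) 0))(1 := p 2)"
      using bspec[OF b(2) foot[OF pc(2)]] by (simp add: bnc_def f)
    also have "\<dots> = coord 0 True p" by (simp add: coord_def fun_eq_iff)
    finally show "snd (bnc_chart (rev_mfd G) b) p = coord 0 True p" by (simp add: bnc_chart_def)
  qed auto
qed

text \<open>The atlas chart picked at a point may be of either type; the symmetry of
  \<open>G\<close> makes the value the same. For the component 00 only the first column of the
  Jacobian enters.\<close>

lemma bnc_metric_bottom:
  assumes b: "fst b = {q \<in> cdom 0 True. q 2 = 0}" "\<forall>q\<in>fst b. snd b q = coord 0 True q"
    and u: "0 \<le> u" "u < hgt / 2"
  shows "bnc_metric (rev_mfd G) b 0 0 ((\<lambda>_. 0)(1 := u)) = G u"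
proof -
  let ?e = "bnc_chart (rev_mfd G) b" and ?y = "(\<lambda>_. 0 :: real)(1 := u) :: nat \<Rightarrow> real"
  note e = bnc_chart_bottom[OF b]
  have y: "?y \<in> hbox" using u by (auto simp: hbox_def)
  have p: "unco 0 True ?y \<in> fst ?e"
    using u unco_in_cdom[OF y, of 0 True] unfolding e(1) by (simp add: unco_def)
  have inv: "chart_inv ?e ?y = unco 0 True ?y" by (rule chart_inv_subchart[OF e(2) y p])
  have "unco 0 True ?y \<in> cyl" using unco_in_cdom[OF y] cdom_subset by blast
  then obtain \<beta> t where c: "chart_at (rev_mfd G) (unco 0 True ?y) = ch \<beta> t" "unco 0 True ?y \<in> cdom \<beta> t"
    by (rule chart_at_rev_mfd)
  have o: "openin (top_of_set cyl) (fst ?e)"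
  proof -
    have "{p \<in> cdom 0 True. p 2 < hgt / 2} = cdom 0 True \<inter> {p. p 2 < hgt / 2}" by auto
    moreover have "open {p. p (2::nat) < hgt / 2}"
      by (rule open_Collect_less) (rule continuous_on_app continuous_on_const)+
    ultimately show ?thesis unfolding e(1) using openin_cdom by (simp add: openin_Int_open)
  qed
  have yo: "?y \<in> chart_overlap ?e (ch \<beta> t)"
    unfolding chart_overlap_def using subchart_image[OF e(2), of "fst ?e \<inter> cdom \<beta> t"] y p c(2) by simp
  have J: "transition_jac ?e (ch \<beta> t) 0 0 ?y = 1" "transition_jac ?e (ch \<beta> t) 1 0 ?y = 0"
    by (simp_all only: transition_jac_subchart[OF e(2) o yo, of 0 0]
        transition_jac_subchart[OF e(2) o yo, of 1 0]) simp_all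
  have "transition ?e (ch \<beta> t) ?y 1 = ht t u"
    unfolding transition_subchart[OF e(2) yo] by (simp add: coord_components[unfolded One_nat_def] unco_def)
  then show ?thesis
    unfolding bnc_metric_def Let_def inv c(1) rev_mfd_simps
    unfolding sum_less_2 J by (simp add: rev_metric_def)
qed

lemma bdry_jet_bottom:
  assumes b: "fst b = {q \<in> cdom 0 True. q 2 = 0}" "\<forall>q\<in>fst b. snd b q = coord 0 True q"
    and G'': "\<And>x. (G' has_real_derivative G'' x) (at x)"
  shows "bdry_jet (rev_mfd G) b 2 0 0 (\<lambda>_. 0) = G'' 0"
proof -
  define D where "D f s = vector_derivative f (at s within {0..})" for f :: "real \<Rightarrow> real" and s
  \<comment> \<open>Needed on \<open>{0..<hgt/2}\<close> and not just at 0, because the derivative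
    is differentiated again. The bound \<open>hgt / 2\<close> is the height below which boundary
    normal coordinates from the bottom circle are available.\<close>
  have D: "D f s = g' s"
    if f: "\<And>s. 0 \<le> s \<Longrightarrow> s < hgt / 2 \<Longrightarrow> f s = g s" and g: "\<And>s. (g has_real_derivative g' s) (at s)"
      and s: "0 \<le> s" "s < hgt / 2" for f g g' s
  proof -
    have "(g has_vector_derivative g' s) (at s within {0..})"
      using g has_real_derivative_iff_has_vector_derivative has_vector_derivative_at_within by blast
    then have "(f has_vector_derivative g' s) (at s within {0..})"
      by (rule has_vector_derivative_transform_within[of _ _ _ _ "hgt / 2 - s"])
        (use f s in \<open>auto simp: dist_real_def abs_less_iff\<close>)
    moreover have "s islimpt {s..<s + 1}" by (simp add: islimpt_Ico)
    then have "s islimpt {0..}" by (rule islimpt_subset) (use s in auto)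
    then have "at s within {0..} \<noteq> bot" by (simp add: trivial_limit_within)
    ultimately show ?thesis unfolding D_def by (intro vector_derivative_within)
  qed
  let ?f = "\<lambda>s. bnc_metric (rev_mfd G) b 0 0 ((\<lambda>_. 0)(1 := s))"
  have 1: "D ?f s = G' s" if "0 \<le> s" "s < hgt / 2" for s
    by (rule D[OF bnc_metric_bottom[OF b] G_deriv that])
  have "D (D ?f) 0 = G'' 0" by (rule D[OF 1 G'']) simp_all
  then show ?thesis
    by (simp add: bdry_jet_def D_def[abs_def, symmetric] numeral_2_eq_2)
qed

end

definition bottom_chart :: "(nat \<Rightarrow> real) chart" where
  "bottom_chart = ({q \<in> cdom 0 True. q 2 = 0}, coord 0 True)"

lemma subchart_bottom: "subchart 0 True bottom_chart"
  by (auto simp: subchart_def bottom_chart_def)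

lemma fst_bottom_chart: "fst bottom_chart = cdom 0 True \<inter> bdry (rev_mfd G)"
  using cdom_subset[of 0 True] by (auto simp: bottom_chart_def bdry_rev_mfd cdom_def)

lemma bottom_overlap:
  "chart_overlap (ch \<alpha> s) bottom_chart = bdry_overlap \<alpha> s 0 True"
  "chart_overlap bottom_chart (ch \<alpha> s) = bdry_overlap 0 True \<alpha> s"
  \<comment> \<open>The boundary set is the same for every profile; the constant 1 is an arbitrary
    instance.\<close>
  unfolding chart_overlap_def fst_bottom_chart[where G = "\<lambda>_. 1"]
  by (rule bdry_subchart_image[OF subchart_ch, where G = "\<lambda>_. 1"], auto)[1]
    (rule bdry_subchart_image[OF subchart_bottom, where G = "\<lambda>_. 1"],
      auto simp: fst_bottom_chart[where G = "\<lambda>_. 1"])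

lemma bottom_image: "snd bottom_chart ` fst bottom_chart = bbox"
proof -
  have "snd bottom_chart ` fst bottom_chart = {x \<in> hbox. unco 0 True x \<in> fst bottom_chart}"
    by (rule subchart_image[OF subchart_bottom]) simp
  also have "\<dots> = bbox"
    using unco_in_cdom[of _ 0 True] by (auto simp: bottom_chart_def bbox_def unco_def)
  finally show ?thesis .
qed

lemma bdry_chart_bottom: "bdry_chart (rev_mfd G) bottom_chart"
proof -
  have 1: "openin (subtopology (top_of_set cyl) (bdry (rev_mfd G))) (fst bottom_chart)"
    unfolding fst_bottom_chart[where G = G] using openin_cdom by (rule openin_subtopology_Int)
  have 2: "openin (Euclidean_space (Suc 0)) bbox"
  proof -
    have *: "bbox = {x. \<forall>i\<ge>1. x i = 0} \<inter> ({x. - pi < x 0} \<inter> {x. x 0 < pi})"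
    proof (intro equalityI subsetI)
      fix x assume x: "x \<in> bbox"
      have "x i = 0" if "1 \<le> i" for i using x that by (cases "i = 1") (auto simp: bbox_def hbox_def)
      with x show "x \<in> {x. \<forall>i\<ge>1. x i = 0} \<inter> ({x. - pi < x 0} \<inter> {x. x 0 < pi})"
        by (simp add: bbox_def hbox_def)
    qed (simp add: bbox_def hbox_def)
    have o: "open {x. - pi < x (0::nat)}" "open {x. x (0::nat) < pi}"
      by (rule open_Collect_less continuous_on_app continuous_on_const)+
    show ?thesis
      unfolding Euclidean_space_1 * by (rule openin_open_Int) (rule open_Int o)+
  qed
  have V: "fst bottom_chart \<subseteq> cyl" "bbox \<subseteq> {x. \<forall>i\<ge>1. x i = 0}"
    using cdom_subset 2 openin_subset[OF 2] by (auto simp: bottom_chart_def Euclidean_space_1)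
  have "homeomorphic_map (top_of_set (fst bottom_chart)) (top_of_set bbox) (coord 0 True)"
    unfolding homeomorphic_map_maps homeomorphic_maps_def
  proof (rule exI[of _ "unco 0 True"], intro conjI ballI)
    have sub: "fst bottom_chart \<subseteq> cdom 0 True" by (auto simp: bottom_chart_def)
    show "continuous_map (top_of_set (fst bottom_chart)) (top_of_set bbox) (coord 0 True)"
      using continuous_on_subset[OF continuous_on_coord sub] bottom_image
      by (auto simp: bottom_chart_def)
    show "continuous_map (top_of_set bbox) (top_of_set (fst bottom_chart)) (unco 0 True)"
    proof -
      have "unco 0 True x \<in> fst bottom_chart" if "x \<in> bbox" for x
        using that unco_in_cdom[of x 0 True] by (simp add: bottom_chart_def bbox_def) (simp add: unco_def)
      then show ?thesis using continuous_on_unco by (simp add: Pi_iff)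
    qed
  qed (use unco_coord coord_unco in \<open>auto simp: bottom_chart_def bbox_def\<close>)
  then have 3: "homeomorphic_map (subtopology (top_of_set cyl) (fst bottom_chart))
      (subtopology (Euclidean_space (Suc 0)) bbox) (snd bottom_chart)"
    using V by (simp add: Euclidean_space_1 subtopology_subtopology Int_absorb1 bottom_chart_def)
  have 4: "smooth_fun_on 1 (chart_overlap (ch \<alpha> s) bottom_chart) (\<lambda>x. transition (ch \<alpha> s) bottom_chart x 0)"
    for \<alpha> s
    unfolding bottom_overlap
  proof (intro smooth_translation[OF openin_bdry_overlap] bdry_overlap_translation)
    fix x assume "x \<in> bdry_overlap \<alpha> s 0 True"
    then have "x \<in> chart_overlap (ch \<alpha> s) bottom_chart" by (simp add: bottom_overlap)
    from transition_subchart[OF subchart_ch this]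
    show "transition (ch \<alpha> s) bottom_chart x 0 = coord 0 True (unco \<alpha> s x) 0" by (simp add: bottom_chart_def)
  qed
  have 5: "smooth_fun_on 1 (chart_overlap bottom_chart (ch \<alpha> s)) (\<lambda>x. transition bottom_chart (ch \<alpha> s) x 0)"
    for \<alpha> s
    unfolding bottom_overlap
  proof (intro smooth_translation[OF openin_bdry_overlap] bdry_overlap_translation)
    fix x assume "x \<in> bdry_overlap 0 True \<alpha> s"
    then have "x \<in> chart_overlap bottom_chart (ch \<alpha> s)" by (simp add: bottom_overlap)
    from transition_subchart[OF subchart_bottom this]
    show "transition bottom_chart (ch \<alpha> s) x 0 = coord \<alpha> s (unco 0 True x) 0" by simp
  qed
  show ?thesis
    unfolding bdry_chart_def Let_def rev_mfd_simps ball_atlas bottom_image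
    using 1 2 3 4 5 by simp
qed

section \<open>The two profiles\<close>

definition wave :: "nat \<Rightarrow> real \<Rightarrow> real" where "wave k x = 1 + (sin (real k * x))\<^sup>2"

definition wave' :: "nat \<Rightarrow> real \<Rightarrow> real" where "wave' k x = real k * sin (2 * (real k * x))"

lemma wave_le_2: "wave k x \<le> 2"
  using abs_square_le_1[of "sin (real k * x)"] abs_sin_le_one by (simp add: wave_def)

lemma has_sum_sin_cos:
  fixes c h :: real
  shows "((\<lambda>n. (cos_coeff n * c ^ n) * h ^ n) has_sum cos (c * h)) UNIV"
    and "((\<lambda>n. (sin_coeff n * c ^ n) * h ^ n) has_sum sin (c * h)) UNIV"
proof -
  have "((\<lambda>n. cos_coeff n *\<^sub>R (c * h) ^ n) has_sum cos (c * h)) UNIV"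
    by (rule norm_summable_imp_has_sum[OF summable_norm_cos cos_converges])
  then show "((\<lambda>n. (cos_coeff n * c ^ n) * h ^ n) has_sum cos (c * h)) UNIV"
    by (simp add: power_mult_distrib mult.assoc)
  have "((\<lambda>n. sin_coeff n *\<^sub>R (c * h) ^ n) has_sum sin (c * h)) UNIV"
    by (rule norm_summable_imp_has_sum[OF summable_norm_sin sin_converges])
  then show "((\<lambda>n. (sin_coeff n * c ^ n) * h ^ n) has_sum sin (c * h)) UNIV"
    by (simp add: power_mult_distrib mult.assoc)
qed

lemma profile_wave: "profile (wave k) (wave' k)"
proof
  fix x :: real
  show "(wave k has_real_derivative wave' k x) (at x)"
    unfolding wave_def[abs_def] wave'_def sin_double
    by (auto intro!: derivative_eq_intros)
  show "1 \<le> wave k x" by (simp add: wave_def)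
  show "wave k 0 = 1" by (simp add: wave_def)
  \<comment> \<open>\<open>real k * hgt\<close> is a multiple of \<open>2 * pi\<close>, so the
    reflection only changes the sign of the sine, and the square removes it.\<close>
  have "real k * (hgt - x) = real (4 * k) * pi - real k * x" by (simp add: hgt_def algebra_simps)
  then have "sin (real k * (hgt - x)) = - sin (real k * x)"
    by (simp only: sin_diff sin_npi cos_npi) (simp add: power_mult)
  then show "wave k (hgt - x) = wave k x" by (simp add: wave_def)
next
  fix a :: real
  let ?c = "2 * real k"
  \<comment> \<open>Coefficients of \<open>3 / 2 - cos (2 * k * x) / 2\<close>, which equals
    \<open>1 + sin^2 (k * x)\<close>, with the cosine at \<open>x = a + h\<close> expanded by the
    addition theorem.\<close>
  define c where "c n = (if n = 0 then 3 / 2 else if n = 1 then 0 else 0) +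
    ((- cos (?c * a) / 2) * (cos_coeff n * ?c ^ n) + (sin (?c * a) / 2) * (sin_coeff n * ?c ^ n))" for n :: nat
  have "((\<lambda>n. c n * h ^ n) has_sum wave k (a + h)) UNIV" for h
  proof -
    have "((\<lambda>n. (- cos (?c * a) / 2) * ((cos_coeff n * ?c ^ n) * h ^ n) + (sin (?c * a) / 2) * ((sin_coeff n * ?c ^ n) * h ^ n))
        has_sum (- cos (?c * a) / 2) * cos (?c * h) + (sin (?c * a) / 2) * sin (?c * h)) UNIV"
      by (intro has_sum_add has_sum_cmult_right has_sum_sin_cos)
    from has_sum_add[OF has_sum_affine[of "3 / 2" 0 h] this]
    have "((\<lambda>n. c n * h ^ n) has_sum 3 / 2 + 0 * h + ((- cos (?c * a) / 2) * cos (?c * h) + (sin (?c * a) / 2) * sin (?c * h))) UNIV"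
      by (simp only: c_def distrib_right mult.assoc)
    moreover have W: "wave k (a + h) = 3 / 2 - cos (?c * a + ?c * h) / 2"
    proof -
      have "cos (2 * (real k * (a + h))) = 1 - 2 * (sin (real k * (a + h)))\<^sup>2"
        by (rule cos_double_sin)
      moreover have "2 * (real k * (a + h)) = ?c * a + ?c * h" by (simp add: algebra_simps)
      ultimately show ?thesis by (simp add: wave_def field_simps)
    qed
    have "3 / 2 + 0 * h + ((- cos (?c * a) / 2) * cos (?c * h) + (sin (?c * a) / 2) * sin (?c * h)) = wave k (a + h)"
      unfolding W cos_add by (simp add: field_simps)
    ultimately show ?thesis by (simp only:)
  qed
  then show "\<exists>c. \<forall>h. ((\<lambda>n. c n * h ^ n) has_sum wave k (a + h)) UNIV" by blast
qed

text \<open>Substituting \<open>y = 2 * x\<close> gives half the integral over two periods, and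
  these contribute equally.\<close>

lemma integral_double_frequency:
  fixes f :: "real \<Rightarrow> real"
  assumes f: "continuous_on UNIV f" and per: "\<And>x. f (x + c) = f x" and c: "0 \<le> c"
  shows "integral {0..c} (\<lambda>x. f (2 * x)) = integral {0..c} f"
proof -
  have cont: "continuous_on S f" for S using f continuous_on_subset by blast
  have "((\<lambda>x. 2 *\<^sub>R f (2 * x)) has_integral integral {2 * 0..2 * c} f) {0..c}"
    by (rule has_integral_substitution[where c = 0 and d = "2 * c"])
      (use c cont in \<open>auto intro!: derivative_eq_intros\<close>)
  from integral_unique[OF this]
  have "2 * integral {0..c} (\<lambda>x. f (2 * x)) = integral {0..2 * c} f" by simp
  also have "\<dots> = integral {0..c} f + integral {c..2 * c} f"
    by (rule Henstock_Kurzweil_Integration.integral_combine[symmetric])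
      (use c cont in \<open>auto intro: integrable_continuous_real\<close>)
  also have "integral {c..2 * c} f = integral {0..c} (f \<circ> (\<lambda>x. x + c))"
    using integral_shift[of 0 c c f] cont by simp
  also have "\<dots> = integral {0..c} f" by (simp add: o_def per)
  finally show ?thesis by simp
qed

lemma integral_wave_2:
  assumes "continuous_on UNIV (\<lambda>x. F (wave 1 x))"
  shows "integral {0..hgt} (\<lambda>x. F (wave 2 x)) = integral {0..hgt} (\<lambda>x :: real. F (wave 1 x) :: real)"
proof -
  have "sin (x + hgt) = sin x" for x
    using sin_periodic[of x] sin_periodic[of "x + 2 * pi"] by (simp add: hgt_def add.assoc)
  then have "wave 1 (x + hgt) = wave 1 x" for x by (simp add: wave_def)
  moreover have "wave 2 x = wave 1 (2 * x)" for x by (simp add: wave_def)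
  ultimately show ?thesis
    using integral_double_frequency[OF assms, of hgt] by simp
qed

lemma Af_Bf_wave:
  assumes "\<bar>p\<bar> < 1"
  shows "Af (wave 2) p hgt = Af (wave 1) p hgt" "Bf (wave 2) p hgt = Bf (wave 1) p hgt"
proof -
  interpret profile "wave 1" "wave' 1" by (rule profile_wave)
  show "Af (wave 2) p hgt = Af (wave 1) p hgt"
    using integral_wave_2[of "\<lambda>y. 1 / sqrt (1 - p\<^sup>2 / y)"] continuous_on_Af[OF assms, of UNIV]
    by (simp add: Af_def qf_def)
  show "Bf (wave 2) p hgt = Bf (wave 1) p hgt"
    using integral_wave_2[of "\<lambda>y. p / (y * sqrt (1 - p\<^sup>2 / y))"] continuous_on_Bf[OF assms, of UNIV]
    by (simp add: Bf_def qf_def)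
qed

text \<open>For \<open>p = 1/2\<close> the rotation angle is at least \<open>hgt / 4 = \<pi>\<close>: this is why the height is \<open>4\<pi>\<close>.\<close>

lemma (in profile) Bf_attains:
  assumes G2: "\<And>x. G x \<le> 2" and \<delta>: "0 \<le> \<delta>" "\<delta> \<le> pi"
  obtains p where "0 \<le> p" "p < 1" "Bf G p hgt = \<delta>"
proof -
  \<comment> \<open>With \<open>p \<le> 1/2\<close> the factor \<open>qf\<close> stays positive and
    the integrand is jointly continuous; at \<open>p = 1\<close> it would blow up at the
    ends.\<close>
  have "continuous_on {0..1 / 2} (\<lambda>p. Bf G p hgt)"
    unfolding Bf_def box_real(2)[symmetric]
  proof (rule integral_continuous_on_param)
    have cG: "continuous_on ({0..1 / 2} \<times> {0..hgt}) (\<lambda>x. G (snd x))"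
      by (rule continuous_on_compose2[OF continuous_on_G[of UNIV]]) (auto intro: continuous_on_snd continuous_on_id)
    have "G t * sqrt (1 - p\<^sup>2 / G t) \<noteq> 0" if "0 \<le> p" "p \<le> 1 / 2" for p t
      using qf_bounds(2)[of p t] that by (simp add: qf_def)
    then have "continuous_on ({0..1 / 2} \<times> {0..hgt})
        (\<lambda>x. fst x / (G (snd x) * sqrt (1 - (fst x)\<^sup>2 / G (snd x))))"
      by (intro continuous_on_divide continuous_on_mult continuous_on_real_sqrt continuous_on_diff
          continuous_on_power continuous_on_const continuous_on_fst continuous_on_id cG ballI) auto
    then show "continuous_on (cbox 0 (1 / 2) \<times> cbox 0 hgt) (\<lambda>(p, t). p / (G t * qf G p t))"
      by (simp add: split_def qf_def)
  qed
  moreover have "Bf G 0 hgt \<le> \<delta>" using \<delta> by (simp add: Bf_def)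
  moreover have "\<delta> \<le> Bf G (1 / 2) hgt"
  proof -
    have "1 / 4 \<le> (1 / 2) / (G x * qf G (1 / 2) x)" for x
    proof -
      have q: "0 < qf G (1 / 2) x" "qf G (1 / 2) x \<le> 1" by (rule qf_bounds; simp)+
      have "G x * qf G (1 / 2) x \<le> 2 * 1" using G2[of x] q G_pos(1)[of x] by (intro mult_mono) simp_all
      then show ?thesis using q by (simp add: field_simps)
    qed
    then have "integral {0..hgt} (\<lambda>_. 1 / 4) \<le> Bf G (1 / 2) hgt"
      unfolding Bf_def
      by (intro integral_le integrable_const_ivl integrable_continuous_real continuous_on_Bf) simp_all
    then show ?thesis using \<delta>(2) by (simp add: hgt_def)
  qed
  ultimately have "\<exists>p\<ge>0. p \<le> 1 / 2 \<and> Bf G p hgt = \<delta>" by (intro IVT') simp_all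
  then obtain p where "0 \<le> p" "p \<le> 1 / 2" "Bf G p hgt = \<delta>" by (elim exE conjE)
  then show thesis by (intro that[of p]) simp_all
qed

section \<open>Comparison of the two cylinders\<close>

text \<open>For points on different circles, the constant \<open>p\<close> found for the first
  profile gives the right rotation for the second as well, and then the lengths agree too. On one
  circle both distances are the angular one.\<close>

lemma mfd_dist_wave:
  assumes "P \<in> bdry (rev_mfd (wave 1))" "P' \<in> bdry (rev_mfd (wave 1))"
  shows "mfd_dist (rev_mfd (wave 2)) P P' = mfd_dist (rev_mfd (wave 1)) P P'"
proof -
  interpret w1: profile "wave 1" "wave' 1" by (rule profile_wave)
  interpret w2: profile "wave 2" "wave' 2" by (rule profile_wave)
  have B: "P \<in> bdry (rev_mfd (wave 2))" "P' \<in> bdry (rev_mfd (wave 2))" using assms by (simp_all add: bdry_rev_mfd)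
  have c: "P \<in> cyl" "P' \<in> cyl" using assms by (simp_all add: bdry_rev_mfd)
  show ?thesis
  proof (cases "P 2 = P' 2")
    case True
    then show ?thesis using w1.dist_same_side[OF assms] w2.dist_same_side[OF B] by simp
  next
    case False
    define s where "s \<longleftrightarrow> P 2 = 0"
    have h: "P 2 = ht s 0" "P' 2 = ht s hgt"
      using False assms by (auto simp: bdry_rev_mfd s_def ht_def)
    have "0 \<le> adist (zc P) (zc P')" "adist (zc P) (zc P') \<le> pi"
      using Arg_bounded[of "zc P' / zc P"] by (simp_all add: adist_def abs_le_iff)
    then obtain p where p: "0 \<le> p" "p < 1" "Bf (wave 1) p hgt = adist (zc P) (zc P')"
      by (rule w1.Bf_attains[OF wave_le_2])
    have p': "\<bar>p\<bar> < 1" using p by simp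
    have "Bf (wave 2) p hgt = adist (zc P) (zc P')" using Af_Bf_wave(2)[OF p'] p(3) by simp
    from w2.dist_opposite[OF c h p(1,2) this] w1.dist_opposite[OF c h p]
    show ?thesis using Af_Bf_wave(1)[OF p'] by simp
  qed
qed

lemma clairaut_lens_bdry:
  assumes "((P, v), (P', v'), T) \<in> clairaut_lens A B"
  shows "P \<in> bdry (rev_mfd G)" "P' \<in> bdry (rev_mfd G)"
    "\<exists>p. v = tangential P p \<and> v' = tangential P' p"
proof -
  obtain a s p where p: "P = pt (cis a) (ht s 0)" "P' = pt (cis (a + B p)) (ht s hgt)"
    "v = tangential P p" "v' = tangential P' p"
    using assms unfolding clairaut_lens_def by auto
  show "P \<in> bdry (rev_mfd G)" "P' \<in> bdry (rev_mfd G)"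
    unfolding bdry_rev_mfd p by (cases s; simp)+
  show "\<exists>p. v = tangential P p \<and> v' = tangential P' p" using p(3,4) by blast
qed

lemma clairaut_lens_mono:
  assumes "\<And>p. \<bar>p\<bar> < 1 \<Longrightarrow> A p = A' p" "\<And>p. \<bar>p\<bar> < 1 \<Longrightarrow> B p = B' p"
  shows "clairaut_lens A B \<subseteq> clairaut_lens A' B'"
proof
  fix x assume "x \<in> clairaut_lens A B"
  then obtain P P' p a s where x: "x = ((P, tangential P p), (P', tangential P' p), A p)"
    and p: "\<bar>p\<bar> < 1" and P: "P = pt (cis a) (ht s 0)" "P' = pt (cis (a + B p)) (ht s hgt)"
    unfolding clairaut_lens_def by auto
  show "x \<in> clairaut_lens A' B'"
    unfolding clairaut_lens_def mem_Collect_eq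
    by (intro exI[of _ P] exI[of _ P'] exI[of _ p] conjI exI[of _ a] exI[of _ s])
      (use x p P assms[OF p] in simp_all)
qed

lemma same_lens_wave: "same_lens_data (rev_mfd (wave 1)) (rev_mfd (wave 2)) id"
proof -
  let ?M = "rev_mfd (wave 1)" and ?N = "rev_mfd (wave 2)"
  let ?f = "\<lambda>(v, w, T). (bdry_differential ?M ?N id v, bdry_differential ?M ?N id w, T)"
  have L: "lens_Omega' ?M = clairaut_lens (\<lambda>p. Af (wave 1) p hgt) (\<lambda>p. Bf (wave 1) p hgt)"
    "lens_Omega' ?N = clairaut_lens (\<lambda>p. Af (wave 2) p hgt) (\<lambda>p. Bf (wave 2) p hgt)"
    by (rule profile.lens_Omega'_rev_mfd[OF profile_wave])+
  have "lens_Omega' ?M = lens_Omega' ?N"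
    unfolding L using Af_Bf_wave by (intro equalityI clairaut_lens_mono) simp_all
  \<comment> \<open>The vectors in the lens data are tangential at boundary points, where the
    differential of the identity fixes them.\<close>
  moreover have "?f x = x" if "x \<in> lens_Omega' ?M" for x
  proof -
    obtain P v P' v' T where x: "x = ((P, v), (P', v'), T)" by (metis prod.collapse)
    note m = that[unfolded x L(1)]
    note c = clairaut_lens_bdry(1,2)[OF m, where G = "wave 1"]
    obtain p where "v = tangential P p" "v' = tangential P' p"
      using clairaut_lens_bdry(3)[OF m] by blast
    then show ?thesis using bdry_differential_id[OF c(1)] bdry_differential_id[OF c(2)] by (simp add: x)
  qed
  then have "?f ` lens_Omega' ?M = id ` lens_Omega' ?M" by (intro image_cong) simp_all
  ultimately have "?f ` lens_Omega' ?M = lens_Omega' ?N" by simp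
  then show ?thesis
    unfolding same_lens_data_def using mfd_dist_wave by simp
qed

lemma jets_differ_wave: "bdry_jets_differ (rev_mfd (wave 1)) (rev_mfd (wave 2)) id"
proof -
  have d: "(wave' k has_real_derivative 2 * (real k)\<^sup>2 * cos (2 * (real k * x))) (at x)" for k x
    unfolding wave'_def[abs_def] by (auto intro!: derivative_eq_intros simp: power2_eq_square)
  let ?b = "push_chart id bottom_chart"
  have b: "fst bottom_chart = {q \<in> cdom 0 True. q 2 = 0}" "\<forall>q\<in>fst bottom_chart. snd bottom_chart q = coord 0 True q"
    by (simp_all add: bottom_chart_def)
  have b': "fst ?b = {q \<in> cdom 0 True. q 2 = 0}" "\<forall>q\<in>fst ?b. snd ?b q = coord 0 True q"
    by (simp_all add: push_chart_def bottom_chart_def inv_into_id)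
  have "bdry_jet (rev_mfd (wave 1)) bottom_chart 2 0 0 (\<lambda>_. 0) = 2"
    "bdry_jet (rev_mfd (wave 2)) ?b 2 0 0 (\<lambda>_. 0) = 8"
    using profile.bdry_jet_bottom[OF profile_wave b d] profile.bdry_jet_bottom[OF profile_wave b' d]
    by simp_all
  moreover have "(\<lambda>_. 0) \<in> snd bottom_chart ` fst bottom_chart"
    unfolding bottom_image by (simp add: bbox_def hbox_def)
  ultimately show ?thesis
    unfolding bdry_jets_differ_def
    by (intro exI[of _ bottom_chart] exI[of _ 2] exI[of _ 0] exI[of _ "\<lambda>_. 0"] conjI bdry_chart_bottom) simp_all
qed

theorem theorem4p3:
  shows "\<exists>(M1 :: (nat \<Rightarrow> real) riem_mfd) (M2 :: (nat \<Rightarrow> real) riem_mfd) (\<phi> :: (nat \<Rightarrow> real) \<Rightarrow> nat \<Rightarrow> real).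
           compact_analytic_riem_mfd M1 \<and> compact_analytic_riem_mfd M2 \<and>
           bdry_isometry M1 M2 \<phi> \<and> same_lens_data M1 M2 \<phi> \<and> bdry_jets_differ M1 M2 \<phi>"
  by (intro exI[of _ "rev_mfd (wave 1)"] exI[of _ "rev_mfd (wave 2)"] exI[of _ id] conjI
      profile.compact_analytic[OF profile_wave] bdry_isometry_id[OF profile_wave profile_wave]
      same_lens_wave jets_differ_wave)

end
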